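(* Let $A$ be a commutative noetherian ring, $\mathfrak{a}$ an ideal of $A$, $G$ a finite group, and $M$ a finitely generated module over the group ring $A[G]$. Then: (a) (lower bound) $\operatorname{depth}(\mathfrak{a},M^G)\ge\min\{\operatorname{depth}(\mathfrak{a},M),\,h_{\mathfrak{a}}+1\}$, where $h_{\mathfrak{a}}=\inf_{q>0}\{q+\operatorname{depth}(\mathfrak{a},H^q(G,M))\}$. (b) (upper bound) Assume that $H^{p_0}_{\mathfrak{a}}(H^{q_0}(G,M))\neq 0$ for some $p_0\ge 0$, $q_0>0$ with $s=p_0+q_0<\operatorname{depth}(\mathfrak{a},M)$. Assume further that $H^{s+1-\ell}_{\mathfrak{a}}(H^{\ell}(G,M))=0$ holds for $\ell=1,\dots,q_0-1$ and $H^{s-1-\ell}_{\mathfrak{a}}(H^{\ell}(G,M))=0$ holds for $\ell>q_0$. Then $\operatorname{depth}(\mathfrak{a},M^G)\le s+1$.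
   Context: $H^i_{\mathfrak{a}}$ denotes the $i$-th local cohomology functor with respect to $\mathfrak{a}$, i.e. the $i$-th right derived functor of the $\mathfrak{a}$-torsion functor $\Gamma_{\mathfrak{a}}(M)=\{m\in M\mid m \text{ is annihilated by some power of } \mathfrak{a}\}$ (zero for $i<0$). For a finitely generated $A$-module $V$, $\operatorname{depth}(\mathfrak{a},V)=\inf\{i\mid H^i_{\mathfrak{a}}(V)\neq 0\}$, with $\inf\emptyset=\infty$. $H^q(G,M)$ is group cohomology, regarded as an $A$-module via the action of $A$ on $M$ (these modules are finitely generated over $A$); $M^G=H^0(G,M)$ is the $A$-module of $G$-invariants. *)

theory Defs
  imports "HOL-Algebra.Module" "HOL-Algebra.Ideal_Product" "HOL-Algebra.Ring_Divisibility"
    "HOL-Library.Extended_Nat"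
begin

section \<open>Modules\<close>

text \<open>The library locale \<open>module\<close> requires a commutative ring of scalars, so modules over a
  group ring need their own locale. For commutative scalars the two agree.\<close>

locale left_module = R?: ring R + M?: abelian_group M
  for R :: "('a, 'r) ring_scheme" (structure) and M :: "('a, 'm) module" (structure) +
  assumes smult_closed:
      "\<lbrakk>a \<in> carrier R; x \<in> carrier M\<rbrakk> \<Longrightarrow> a \<odot>\<^bsub>M\<^esub> x \<in> carrier M"
    and smult_l_distr:
      "\<lbrakk>a \<in> carrier R; b \<in> carrier R; x \<in> carrier M\<rbrakk> \<Longrightarrow>
        (a \<oplus>\<^bsub>R\<^esub> b) \<odot>\<^bsub>M\<^esub> x = a \<odot>\<^bsub>M\<^esub> x \<oplus>\<^bsub>M\<^esub> b \<odot>\<^bsub>M\<^esub> x"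
    and smult_r_distr:
      "\<lbrakk>a \<in> carrier R; x \<in> carrier M; y \<in> carrier M\<rbrakk> \<Longrightarrow>
        a \<odot>\<^bsub>M\<^esub> (x \<oplus>\<^bsub>M\<^esub> y) = a \<odot>\<^bsub>M\<^esub> x \<oplus>\<^bsub>M\<^esub> a \<odot>\<^bsub>M\<^esub> y"
    and smult_assoc:
      "\<lbrakk>a \<in> carrier R; b \<in> carrier R; x \<in> carrier M\<rbrakk> \<Longrightarrow>
        (a \<otimes>\<^bsub>R\<^esub> b) \<odot>\<^bsub>M\<^esub> x = a \<odot>\<^bsub>M\<^esub> (b \<odot>\<^bsub>M\<^esub> x)"
    and smult_one:
      "x \<in> carrier M \<Longrightarrow> \<one>\<^bsub>R\<^esub> \<odot>\<^bsub>M\<^esub> x = x"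

definition fin_gen_module :: "('a, 'r) ring_scheme \<Rightarrow> ('a, 'm) module \<Rightarrow> bool" where
  "fin_gen_module R M \<longleftrightarrow>
    (\<exists>S. finite S \<and> S \<subseteq> carrier M \<and>
      (\<forall>x\<in>carrier M. \<exists>c \<in> S \<rightarrow> carrier R. x = (\<Oplus>\<^bsub>M\<^esub>s\<in>S. c s \<odot>\<^bsub>M\<^esub> s)))"

definition zero_module :: "('a, 'm) module \<Rightarrow> bool" where
  "zero_module M \<longleftrightarrow> carrier M = {\<zero>\<^bsub>M\<^esub>}"

definition module_hom ::
    "('a, 'r) ring_scheme \<Rightarrow> ('a, 'm) module \<Rightarrow> ('a, 'n) module \<Rightarrow> ('m \<Rightarrow> 'n) set" where
  "module_hom R M N =
    {f \<in> carrier M \<rightarrow> carrier N.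
      (\<forall>x\<in>carrier M. \<forall>y\<in>carrier M. f (x \<oplus>\<^bsub>M\<^esub> y) = f x \<oplus>\<^bsub>N\<^esub> f y) \<and>
      (\<forall>a\<in>carrier R. \<forall>x\<in>carrier M. f (a \<odot>\<^bsub>M\<^esub> x) = a \<odot>\<^bsub>N\<^esub> f x)}"

text \<open>The ring fields \<open>mult\<close> and \<open>one\<close> of the record type \<open>module\<close> play no role for modules.\<close>

definition quot_module :: "('a, 'm) module \<Rightarrow> 'm set \<Rightarrow> ('a, 'm set) module" where
  "quot_module M N =
    \<lparr>carrier = a_rcosets\<^bsub>M\<^esub> N, monoid.mult = undefined, one = undefined,
     zero = N, add = set_add M,
     smult = (\<lambda>a C. \<Union>x\<in>C. N +>\<^bsub>M\<^esub> (a \<odot>\<^bsub>M\<^esub> x))\<rparr>"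

text \<open>The \<open>n\<close>-th cohomology of a cochain complex \<open>C 0 \<rightarrow> C 1 \<rightarrow> \<dots>\<close> with \<open>d n : C n \<rightarrow> C (n + 1)\<close>.\<close>

definition cohomology ::
    "(nat \<Rightarrow> ('a, 'm) module) \<Rightarrow> (nat \<Rightarrow> 'm \<Rightarrow> 'm) \<Rightarrow> nat \<Rightarrow> ('a, 'm set) module" where
  "cohomology C d n =
    quot_module ((C n)\<lparr>carrier := {x \<in> carrier (C n). d n x = \<zero>\<^bsub>C (Suc n)\<^esub>}\<rparr>)
      (case n of 0 \<Rightarrow> {\<zero>\<^bsub>C 0\<^esub>} | Suc k \<Rightarrow> d k ` carrier (C k))"


section \<open>Local cohomology\<close>

text \<open>The test modules \<open>N\<close>, \<open>P\<close> range over the type \<open>'a \<times> 'u\<close>, since HOL cannot quantify over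
  types. This type contains a copy of the ring and of its ideals, so by Baer's criterion
  \<open>J\<close> then has the extension property for modules on arbitrary types.\<close>

definition injective_module :: "('a, 'r) ring_scheme \<Rightarrow> ('a, 'u) module \<Rightarrow> bool" where
  "injective_module R J \<longleftrightarrow> module R J \<and>
    (\<forall>(N :: ('a, 'a \<times> 'u) module) (P :: ('a, 'a \<times> 'u) module) f g.
      module R N \<longrightarrow> module R P \<longrightarrow> f \<in> module_hom R N P \<longrightarrow> inj_on f (carrier N) \<longrightarrow>
      g \<in> module_hom R N J \<longrightarrow>
      (\<exists>h \<in> module_hom R P J. \<forall>x\<in>carrier N. h (f x) = g x))"

text \<open>Exactness of \<open>0 \<rightarrow> M \<rightarrow> I 0 \<rightarrow> I 1 \<rightarrow> \<dots>\<close> with augmentation \<open>e\<close> and all \<open>I n\<close> injective.\<close>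

definition injective_resolution ::
    "('a, 'r) ring_scheme \<Rightarrow> ('a, 'm) module \<Rightarrow> ('m \<Rightarrow> 'u) \<Rightarrow>
      (nat \<Rightarrow> ('a, 'u) module) \<Rightarrow> (nat \<Rightarrow> 'u \<Rightarrow> 'u) \<Rightarrow> bool" where
  "injective_resolution R M e I d \<longleftrightarrow>
    (\<forall>n. injective_module R (I n) \<and> d n \<in> module_hom R (I n) (I (Suc n))) \<and>
    e \<in> module_hom R M (I 0) \<and> inj_on e (carrier M) \<and>
    e ` carrier M = {x \<in> carrier (I 0). d 0 x = \<zero>\<^bsub>I 1\<^esub>} \<and>
    (\<forall>n. d n ` carrier (I n) =
      {x \<in> carrier (I (Suc n)). d (Suc n) x = \<zero>\<^bsub>I (Suc (Suc n))\<^esub>})"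

text \<open>A type \<open>U\<close> that can carry an injective resolution of every module on \<open>'m\<close>: it contains
  copies of \<open>'m\<close> and \<open>'a\<close>, is infinite, and satisfies \<open>|U|^|'a| = |U|\<close>. Hence a module \<open>N\<close> with
  \<open>|N| \<le> |U|\<close> has a divisible hull \<open>D\<close> with \<open>|D| \<le> |U|\<close>, and \<open>N\<close> embeds into the injective
  module of additive maps from \<open>'a\<close> to \<open>D\<close>, of cardinality at most \<open>|U|\<close>; the same
  bound then holds for the cokernel, and the construction can be iterated.\<close>

type_synonym ('a, 'm) resolution_type = "'a list \<Rightarrow> 'm + nat"

definition chosen_resolution ::
    "('a, 'r) ring_scheme \<Rightarrow> ('a, 'm) module \<Rightarrow>
      (nat \<Rightarrow> ('a, ('a, 'm) resolution_type) module) \<times>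
      (nat \<Rightarrow> ('a, 'm) resolution_type \<Rightarrow> ('a, 'm) resolution_type)" where
  "chosen_resolution R M = (SOME (I, d). \<exists>e. injective_resolution R M e I d)"

definition torsion :: "('a, 'r) ring_scheme \<Rightarrow> 'a set \<Rightarrow> ('a, 'm) module \<Rightarrow> ('a, 'm) module" where
  "torsion R \<aa> M = M\<lparr>carrier :=
    {m \<in> carrier M. \<exists>n::nat. \<forall>a \<in> \<aa> [^]\<^bsub>ideals_set R\<^esub> n. a \<odot>\<^bsub>M\<^esub> m = \<zero>\<^bsub>M\<^esub>}\<rparr>"

text \<open>The \<open>i\<close>-th right derived functor of \<open>torsion R \<aa>\<close>, on objects, for an integer \<open>i\<close>. The
  functor acts on morphisms by restriction, so the differentials stay the same.\<close>

definition local_cohomology ::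
    "('a, 'r) ring_scheme \<Rightarrow> 'a set \<Rightarrow> int \<Rightarrow> ('a, 'm) module \<Rightarrow>
      ('a, ('a, 'm) resolution_type set) module" where
  "local_cohomology R \<aa> i M =
    (let (I, d) = chosen_resolution R M in
      if i < 0 then quot_module ((I 0)\<lparr>carrier := {\<zero>\<^bsub>I 0\<^esub>}\<rparr>) {\<zero>\<^bsub>I 0\<^esub>}
      else cohomology (\<lambda>n. torsion R \<aa> (I n)) d (nat i))"

text \<open>In \<open>enat\<close> the infimum of the empty set is \<open>\<infinity>\<close>.\<close>

definition depth :: "('a, 'r) ring_scheme \<Rightarrow> 'a set \<Rightarrow> ('a, 'm) module \<Rightarrow> enat" where
  "depth R \<aa> V = Inf {enat i |i. \<not> zero_module (local_cohomology R \<aa> (int i) V)}"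


section \<open>Group rings and group cohomology\<close>

text \<open>The group ring of a finite group: all functions from the group to the ring have finite
  support. Multiplication is convolution.\<close>

definition group_ring :: "('a, 'r) ring_scheme \<Rightarrow> ('g, 's) monoid_scheme \<Rightarrow> ('g \<Rightarrow> 'a) ring" where
  "group_ring A G =
    \<lparr>carrier = carrier G \<rightarrow>\<^sub>E carrier A,
     monoid.mult = (\<lambda>u v. \<lambda>x\<in>carrier G. \<Oplus>\<^bsub>A\<^esub>y\<in>carrier G. u y \<otimes>\<^bsub>A\<^esub> v (inv\<^bsub>G\<^esub> y \<otimes>\<^bsub>G\<^esub> x)),
     one = (\<lambda>x\<in>carrier G. if x = \<one>\<^bsub>G\<^esub> then \<one>\<^bsub>A\<^esub> else \<zero>\<^bsub>A\<^esub>),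
     zero = (\<lambda>x\<in>carrier G. \<zero>\<^bsub>A\<^esub>),
     add = (\<lambda>u v. \<lambda>x\<in>carrier G. u x \<oplus>\<^bsub>A\<^esub> v x)\<rparr>"

text \<open>The element \<open>a \<cdot> g\<close> of the group ring.\<close>

definition group_ring_monom ::
    "('a, 'r) ring_scheme \<Rightarrow> ('g, 's) monoid_scheme \<Rightarrow> 'a \<Rightarrow> 'g \<Rightarrow> 'g \<Rightarrow> 'a" where
  "group_ring_monom A G a g = (\<lambda>x\<in>carrier G. if x = g then a else \<zero>\<^bsub>A\<^esub>)"

definition group_act ::
    "('a, 'r) ring_scheme \<Rightarrow> ('g, 's) monoid_scheme \<Rightarrow> ('g \<Rightarrow> 'a, 'm) module \<Rightarrow> 'g \<Rightarrow> 'm \<Rightarrow> 'm" where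
  "group_act A G M g x = group_ring_monom A G \<one>\<^bsub>A\<^esub> g \<odot>\<^bsub>M\<^esub> x"

text \<open>Restriction of scalars along \<open>A \<rightarrow> A[G]\<close>, \<open>a \<mapsto> a \<cdot> 1\<close>.\<close>

definition base_module ::
    "('a, 'r) ring_scheme \<Rightarrow> ('g, 's) monoid_scheme \<Rightarrow> ('g \<Rightarrow> 'a, 'm) module \<Rightarrow> ('a, 'm) module" where
  "base_module A G M =
    \<lparr>carrier = carrier M, monoid.mult = monoid.mult M, one = one M, zero = zero M, add = add M,
     smult = (\<lambda>a x. group_ring_monom A G a \<one>\<^bsub>G\<^esub> \<odot>\<^bsub>M\<^esub> x)\<rparr>"

definition invariants ::
    "('a, 'r) ring_scheme \<Rightarrow> ('g, 's) monoid_scheme \<Rightarrow> ('g \<Rightarrow> 'a, 'm) module \<Rightarrow> ('a, 'm) module" where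
  "invariants A G M = (base_module A G M)\<lparr>carrier :=
    {x \<in> carrier M. \<forall>g\<in>carrier G. group_act A G M g x = x}\<rparr>"

text \<open>Inhomogeneous cochains: the maps \<open>G^n \<rightarrow> M\<close>, where \<open>G^n\<close> consists of the lists of length
  \<open>n\<close>.\<close>

definition tuples :: "('g, 's) monoid_scheme \<Rightarrow> nat \<Rightarrow> 'g list set" where
  "tuples G n = {gs. set gs \<subseteq> carrier G \<and> length gs = n}"

definition cochains ::
    "('a, 'r) ring_scheme \<Rightarrow> ('g, 's) monoid_scheme \<Rightarrow> ('g \<Rightarrow> 'a, 'm) module \<Rightarrow> nat \<Rightarrow>
      ('a, 'g list \<Rightarrow> 'm) module" where
  "cochains A G M n =
    \<lparr>carrier = tuples G n \<rightarrow>\<^sub>E carrier M, monoid.mult = undefined, one = undefined,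
     zero = (\<lambda>gs\<in>tuples G n. \<zero>\<^bsub>M\<^esub>),
     add = (\<lambda>\<phi> \<psi>. \<lambda>gs\<in>tuples G n. \<phi> gs \<oplus>\<^bsub>M\<^esub> \<psi> gs),
     smult = (\<lambda>a \<phi>. \<lambda>gs\<in>tuples G n. a \<odot>\<^bsub>base_module A G M\<^esub> \<phi> gs)\<rparr>"

text \<open>\<open>(g\<^sub>0, \<dots>, g\<^sub>n) \<mapsto> (g\<^sub>0, \<dots>, g\<^sub>i g\<^sub>i\<^sub>+\<^sub>1, \<dots>, g\<^sub>n)\<close>\<close>

definition merge_at :: "('g, 's) monoid_scheme \<Rightarrow> nat \<Rightarrow> 'g list \<Rightarrow> 'g list" where
  "merge_at G i gs = take i gs @ [gs ! i \<otimes>\<^bsub>G\<^esub> gs ! Suc i] @ drop (Suc (Suc i)) gs"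

definition alternate :: "('a, 'm) module \<Rightarrow> nat \<Rightarrow> 'm \<Rightarrow> 'm" where
  "alternate M k x = (if even k then x else \<ominus>\<^bsub>M\<^esub> x)"

definition coboundary ::
    "('a, 'r) ring_scheme \<Rightarrow> ('g, 's) monoid_scheme \<Rightarrow> ('g \<Rightarrow> 'a, 'm) module \<Rightarrow> nat \<Rightarrow>
      ('g list \<Rightarrow> 'm) \<Rightarrow> 'g list \<Rightarrow> 'm" where
  "coboundary A G M n \<phi> = (\<lambda>gs\<in>tuples G (Suc n).
    group_act A G M (hd gs) (\<phi> (tl gs))
    \<oplus>\<^bsub>M\<^esub> (\<Oplus>\<^bsub>M\<^esub>i\<in>{..<n}. alternate M (Suc i) (\<phi> (merge_at G i gs)))
    \<oplus>\<^bsub>M\<^esub> alternate M (Suc n) (\<phi> (butlast gs)))"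

definition group_cohomology ::
    "('a, 'r) ring_scheme \<Rightarrow> ('g, 's) monoid_scheme \<Rightarrow> ('g \<Rightarrow> 'a, 'm) module \<Rightarrow> nat \<Rightarrow>
      ('a, ('g list \<Rightarrow> 'm) set) module" where
  "group_cohomology A G M q = cohomology (cochains A G M) (coboundary A G M) q"

definition cohomological_height ::
    "('a, 'r) ring_scheme \<Rightarrow> 'a set \<Rightarrow> ('g, 's) monoid_scheme \<Rightarrow> ('g \<Rightarrow> 'a, 'm) module \<Rightarrow> enat" where
  "cohomological_height A \<aa> G M =
    (INF q\<in>{0<..}. enat q + depth A \<aa> (group_cohomology A G M q))"

end

theory Submission
  imports Defs "HOL-Library.Poly_Mapping" "HOL-Library.Countable"
begin

text \<open>Write \<open>C\<close> for the complex of inhomogeneous cochains, with cocycles \<open>Z n\<close> and coboundaries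
  \<open>B n\<close>. As an \<open>A\<close>-module \<open>C n\<close> is a finite power of \<open>M\<close>, so its local cohomology vanishes below
  \<open>depth \<aa> M\<close>. The long exact sequences of \<open>0 \<rightarrow> Z n \<rightarrow> C n \<rightarrow> B n \<rightarrow> 0\<close> and
  \<open>0 \<rightarrow> B n \<rightarrow> Z (n + 1) \<rightarrow> H (n + 1) \<rightarrow> 0\<close> therefore shift vanishing along the complex, which
  replaces the spectral sequences. They are needed only in the form
  ``two of the neighbouring terms vanish, hence so does the third'', and this follows from a
  horseshoe resolution together with the comparison of injective resolutions. Since the local
  cohomology is computed from a chosen resolution on a fixed type, one also has to show that such a
  resolution exists.\<close>

section \<open>Homomorphisms, images and quotients of modules\<close>

text \<open>How the indices move: vanishing for \<open>X\<close> in degree \<open>p\<close> is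
  reduced to \<open>B 0\<close> and \<open>Z 1\<close> in degree \<open>p - 1\<close>, then to
  \<open>Z 2\<close> in degree \<open>p - 2\<close>, and so on. Each step asks for one
  \<open>H n\<close>, always of total degree \<open>p - 1\<close>, which explains the
  \<open>+ 1\<close> in the lower bound; the descent ends in degree 0, where \<open>Z n\<close>
  embeds into \<open>C n\<close>. For the upper bound the sequences are also read the other way: if
  degree \<open>s + 1\<close> of the invariants vanished, so would degree \<open>p0 + 1\<close> of
  \<open>B (q0 - 1)\<close> and degree \<open>p0\<close> of \<open>Z q0\<close>, and these two
  enclose degree \<open>p0\<close> of \<open>H q0\<close>. The formal obstacle is types. The three
  modules of a short exact sequence live on three types, hence so do their chosen resolutions, and
  the horseshoe lives on a product of two of these, whereas \<open>injective_module\<close> tests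
  only modules on one type. Injectivity against all types is therefore recovered by splitting each
  chosen module off an explicit one, the additive maps from \<open>R\<close> into a divisible
  group.\<close>

lemma module_abelian_group: "module R M \<Longrightarrow> abelian_group M"
  by (rule module.axioms(2))

lemma module_cring: "module R M \<Longrightarrow> cring R"
  by (rule module.axioms(1))

lemma module_homI:
  assumes "\<And>x. x \<in> carrier M \<Longrightarrow> f x \<in> carrier N"
    and "\<And>x y. x \<in> carrier M \<Longrightarrow> y \<in> carrier M \<Longrightarrow> f (x \<oplus>\<^bsub>M\<^esub> y) = f x \<oplus>\<^bsub>N\<^esub> f y"
    and "\<And>a x. a \<in> carrier R \<Longrightarrow> x \<in> carrier M \<Longrightarrow> f (a \<odot>\<^bsub>M\<^esub> x) = a \<odot>\<^bsub>N\<^esub> f x"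
  shows "f \<in> module_hom R M N"
  using assms by (auto simp: module_hom_def)

lemma hom_closed: "f \<in> module_hom R M N \<Longrightarrow> x \<in> carrier M \<Longrightarrow> f x \<in> carrier N"
  by (auto simp: module_hom_def)

lemma hom_add:
  "f \<in> module_hom R M N \<Longrightarrow> x \<in> carrier M \<Longrightarrow> y \<in> carrier M \<Longrightarrow> f (x \<oplus>\<^bsub>M\<^esub> y) = f x \<oplus>\<^bsub>N\<^esub> f y"
  by (auto simp: module_hom_def)

lemma hom_smult:
  "f \<in> module_hom R M N \<Longrightarrow> a \<in> carrier R \<Longrightarrow> x \<in> carrier M \<Longrightarrow> f (a \<odot>\<^bsub>M\<^esub> x) = a \<odot>\<^bsub>N\<^esub> f x"
  by (auto simp: module_hom_def)

lemma additive_zero: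
  assumes "abelian_group M" "abelian_group N" "f \<zero>\<^bsub>M\<^esub> \<in> carrier N"
    "f (\<zero>\<^bsub>M\<^esub> \<oplus>\<^bsub>M\<^esub> \<zero>\<^bsub>M\<^esub>) = f \<zero>\<^bsub>M\<^esub> \<oplus>\<^bsub>N\<^esub> f \<zero>\<^bsub>M\<^esub>"
  shows "f \<zero>\<^bsub>M\<^esub> = \<zero>\<^bsub>N\<^esub>"
proof -
  interpret M: abelian_group M by fact
  interpret N: abelian_group N by fact
  show ?thesis using assms(3,4) by simp
qed

lemma hom_zero:
  assumes "module R M" "module R N" "f \<in> module_hom R M N"
  shows "f \<zero>\<^bsub>M\<^esub> = \<zero>\<^bsub>N\<^esub>"
proof -
  interpret M: abelian_group M using assms(1) by (rule module_abelian_group)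
  show ?thesis
    using hom_add[OF assms(3) M.zero_closed M.zero_closed] hom_closed[OF assms(3) M.zero_closed]
    by (intro additive_zero module_abelian_group[OF assms(1)] module_abelian_group[OF assms(2)])
qed

lemma hom_uminus:
  assumes "module R M" "module R N" "f \<in> module_hom R M N" "x \<in> carrier M"
  shows "f (\<ominus>\<^bsub>M\<^esub> x) = \<ominus>\<^bsub>N\<^esub> f x"
proof -
  interpret M: abelian_group M using assms(1) by (rule module_abelian_group)
  interpret N: abelian_group N using assms(2) by (rule module_abelian_group)
  have "f (\<ominus>\<^bsub>M\<^esub> x) \<oplus>\<^bsub>N\<^esub> f x = \<zero>\<^bsub>N\<^esub>"
    using assms(4) hom_zero[OF assms(1-3)]
    by (simp add: hom_add[OF assms(3), symmetric] M.l_neg)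
  then show ?thesis using assms(4) hom_closed[OF assms(3)] by (metis M.a_inv_closed N.minus_equality)
qed

lemma hom_minus:
  assumes "module R M" "module R N" "f \<in> module_hom R M N" "x \<in> carrier M" "y \<in> carrier M"
  shows "f (x \<ominus>\<^bsub>M\<^esub> y) = f x \<ominus>\<^bsub>N\<^esub> f y"
proof -
  interpret M: abelian_group M using assms(1) by (rule module_abelian_group)
  show ?thesis using assms by (simp add: a_minus_def hom_add[OF assms(3)] hom_uminus)
qed

lemma (in abelian_group) diff_eq_zero_iff:
  "x \<in> carrier G \<Longrightarrow> y \<in> carrier G \<Longrightarrow> x \<ominus> y = \<zero> \<longleftrightarrow> x = y"
  by (metis a_inv_closed a_minus_def add.inv_closed add.inv_comm add.inv_inv minus_equality r_neg)

lemma (in abelian_group) neg_zero: "\<ominus> \<zero> = \<zero>"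
  by (rule minus_equality) auto

lemma (in abelian_group) diff_zero: "x \<in> carrier G \<Longrightarrow> x \<ominus> \<zero> = x"
  by (simp add: a_minus_def neg_zero)

lemma (in abelian_group) diff_add_eq:
  "x \<in> carrier G \<Longrightarrow> y \<in> carrier G \<Longrightarrow> (x \<ominus> y) \<oplus> y = x"
  by (simp add: a_minus_def a_assoc l_neg)

lemma hom_inj_onI:
  assumes "module R M" "module R N" "f \<in> module_hom R M N"
    "\<And>x. x \<in> carrier M \<Longrightarrow> f x = \<zero>\<^bsub>N\<^esub> \<Longrightarrow> x = \<zero>\<^bsub>M\<^esub>"
  shows "inj_on f (carrier M)"
proof (rule inj_onI)
  interpret M: abelian_group M using assms(1) by (rule module_abelian_group)
  interpret N: abelian_group N using assms(2) by (rule module_abelian_group)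
  fix x y assume xy: "x \<in> carrier M" "y \<in> carrier M" "f x = f y"
  then have "f (x \<ominus>\<^bsub>M\<^esub> y) = \<zero>\<^bsub>N\<^esub>"
    using hom_closed[OF assms(3)] by (simp add: hom_minus[OF assms(1-3)] N.diff_eq_zero_iff)
  then show "x = y" using assms(4) xy M.diff_eq_zero_iff by auto
qed

lemma hom_comp:
  "f \<in> module_hom R M N \<Longrightarrow> g \<in> module_hom R N P \<Longrightarrow> (\<lambda>x. g (f x)) \<in> module_hom R M P"
  by (auto simp: module_hom_def Pi_iff)

lemma hom_diff:
  assumes "module R M" "module R N" "f \<in> module_hom R M N" "g \<in> module_hom R M N"
  shows "(\<lambda>x. f x \<ominus>\<^bsub>N\<^esub> g x) \<in> module_hom R M N"
proof -
  interpret M: abelian_group M using assms(1) by (rule module_abelian_group)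
  interpret N': abelian_group N using assms(2) by (rule module_abelian_group)
  interpret N: module R N by fact
  note c = hom_closed[OF assms(3)] hom_closed[OF assms(4)]
  show ?thesis
    by (rule module_homI)
      (auto simp: c hom_add[OF assms(3)] hom_add[OF assms(4)] hom_smult[OF assms(3)]
        hom_smult[OF assms(4)] a_minus_def N'.minus_add N'.a_ac N.smult_r_distr N.smult_r_minus)
qed

lemma hom_neg:
  assumes "module R M" "module R N" "f \<in> module_hom R M N"
  shows "(\<lambda>x. \<ominus>\<^bsub>N\<^esub> f x) \<in> module_hom R M N"
proof -
  interpret N': abelian_group N using assms(2) by (rule module_abelian_group)
  interpret N: module R N by fact
  note c = hom_closed[OF assms(3)]
  show ?thesis
    by (rule module_homI)
      (auto simp: c hom_add[OF assms(3)] hom_smult[OF assms(3)] N'.minus_add N.smult_r_minus)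
qed

section \<open>Submodules, kernels and images\<close>

lemma submodule_subset: "submodule N R M \<Longrightarrow> x \<in> N \<Longrightarrow> x \<in> carrier M"
  by (auto simp: submodule_def subgroup_def)

lemma submodule_zero: "submodule N R M \<Longrightarrow> \<zero>\<^bsub>M\<^esub> \<in> N"
  by (auto simp: submodule_def subgroup_def)

lemma submodule_add: "submodule N R M \<Longrightarrow> x \<in> N \<Longrightarrow> y \<in> N \<Longrightarrow> x \<oplus>\<^bsub>M\<^esub> y \<in> N"
  by (auto simp: submodule_def subgroup_def)

lemma submodule_uminus: "submodule N R M \<Longrightarrow> x \<in> N \<Longrightarrow> \<ominus>\<^bsub>M\<^esub> x \<in> N"
  by (auto simp: submodule_def subgroup_def a_inv_def)

lemma submodule_smult: "submodule N R M \<Longrightarrow> a \<in> carrier R \<Longrightarrow> x \<in> N \<Longrightarrow> a \<odot>\<^bsub>M\<^esub> x \<in> N"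
  by (auto simp: submodule_def submodule_axioms_def)

lemma submodule_zeroset: "module R M \<Longrightarrow> submodule {\<zero>\<^bsub>M\<^esub>} R M"
proof -
  assume M: "module R M"
  interpret M': abelian_group M using M by (rule module_abelian_group)
  interpret M: module R M by (rule M)
  show ?thesis by (rule M.submoduleI) auto
qed

lemma submodule_module: "module R M \<Longrightarrow> submodule N R M \<Longrightarrow> module R (M\<lparr>carrier := N\<rparr>)"
  using submodule.submodule_is_module .

lemma submodule_kernel:
  assumes "module R M" "module R N" "f \<in> module_hom R M N"
  shows "submodule {x \<in> carrier M. f x = \<zero>\<^bsub>N\<^esub>} R M"
proof -
  interpret M': abelian_group M using assms(1) by (rule module_abelian_group)
  interpret M: module R M by fact
  interpret N': abelian_group N using assms(2) by (rule module_abelian_group)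
  interpret N: module R N by fact
  show ?thesis using hom_zero[OF assms]
    by (intro M.submoduleI) (auto simp: hom_add[OF assms(3)] hom_uminus[OF assms] hom_smult[OF assms(3)])
qed

lemma submodule_image:
  assumes "module R M" "module R N" "f \<in> module_hom R M N"
  shows "submodule (f ` carrier M) R N"
proof -
  interpret M': abelian_group M using assms(1) by (rule module_abelian_group)
  interpret M: module R M by fact
  interpret N: module R N by fact
  show ?thesis
  proof (rule N.submoduleI)
    show "\<zero>\<^bsub>N\<^esub> \<in> f ` carrier M" using hom_zero[OF assms] by (metis M'.zero_closed imageI)
  next
    fix a assume "a \<in> f ` carrier M" then show "\<ominus>\<^bsub>N\<^esub> a \<in> f ` carrier M"
      using hom_uminus[OF assms] by (metis (no_types, lifting) M'.a_inv_closed image_iff)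
  next
    fix a b assume "a \<in> f ` carrier M" "b \<in> f ` carrier M" then show "a \<oplus>\<^bsub>N\<^esub> b \<in> f ` carrier M"
      using hom_add[OF assms(3)] by (metis (no_types, lifting) M'.a_closed image_iff)
  next
    fix a x assume "a \<in> carrier R" "x \<in> f ` carrier M" then show "a \<odot>\<^bsub>N\<^esub> x \<in> f ` carrier M"
      using hom_smult[OF assms(3)] by (metis (no_types, lifting) M.smult_closed image_iff)
  qed (use hom_closed[OF assms(3)] in auto)
qed

text \<open>The group laws pass through a surjection that respects addition, and inverses are images
  of inverses. \<open>W\<close> is not yet known to be a group, so the image of zero has to be
  assumed; it cannot be derived as in \<open>additive_zero\<close>.\<close>

lemma abelian_group_image:
  assumes "abelian_group X" and im: "p ` carrier X = carrier W"
    and add: "\<And>x y. x \<in> carrier X \<Longrightarrow> y \<in> carrier X \<Longrightarrow> p (x \<oplus>\<^bsub>X\<^esub> y) = p x \<oplus>\<^bsub>W\<^esub> p y"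
    and zero: "p \<zero>\<^bsub>X\<^esub> = \<zero>\<^bsub>W\<^esub>"
  shows "abelian_group W"
proof -
  interpret X: abelian_group X by fact
  have *: "\<And>w. w \<in> carrier W \<Longrightarrow> \<exists>x\<in>carrier X. w = p x" using im by auto
  have cl: "\<And>x. x \<in> carrier X \<Longrightarrow> p x \<in> carrier W" using im by auto
  show ?thesis
  proof (rule abelian_groupI)
    fix x y assume "x \<in> carrier W" "y \<in> carrier W"
    then obtain x' y' where "x' \<in> carrier X" "y' \<in> carrier X" "x = p x'" "y = p y'" using * by metis
    then show "x \<oplus>\<^bsub>W\<^esub> y \<in> carrier W" "x \<oplus>\<^bsub>W\<^esub> y = y \<oplus>\<^bsub>W\<^esub> x"
      using cl by (simp_all add: add[symmetric] X.a_comm)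
  next
    show "\<zero>\<^bsub>W\<^esub> \<in> carrier W" using cl zero by (metis X.zero_closed)
  next
    fix x y z assume "x \<in> carrier W" "y \<in> carrier W" "z \<in> carrier W"
    then obtain x' y' z' where "x' \<in> carrier X" "y' \<in> carrier X" "z' \<in> carrier X"
      "x = p x'" "y = p y'" "z = p z'" using * by metis
    then show "x \<oplus>\<^bsub>W\<^esub> y \<oplus>\<^bsub>W\<^esub> z = x \<oplus>\<^bsub>W\<^esub> (y \<oplus>\<^bsub>W\<^esub> z)"
      by (simp add: add[symmetric] X.a_assoc)
  next
    fix x assume "x \<in> carrier W"
    then obtain x' where x': "x' \<in> carrier X" "x = p x'" using * by metis
    then show "\<zero>\<^bsub>W\<^esub> \<oplus>\<^bsub>W\<^esub> x = x" by (metis X.l_zero X.zero_closed add zero)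
    show "\<exists>y\<in>carrier W. y \<oplus>\<^bsub>W\<^esub> x = \<zero>\<^bsub>W\<^esub>"
      using x' cl by (metis X.a_inv_closed X.l_neg add zero)
  qed
qed

lemma module_image:
  assumes X: "module R X" and im: "p ` carrier X = carrier W"
    and add: "\<And>x y. x \<in> carrier X \<Longrightarrow> y \<in> carrier X \<Longrightarrow> p (x \<oplus>\<^bsub>X\<^esub> y) = p x \<oplus>\<^bsub>W\<^esub> p y"
    and zero: "p \<zero>\<^bsub>X\<^esub> = \<zero>\<^bsub>W\<^esub>"
    and sm: "\<And>a x. a \<in> carrier R \<Longrightarrow> x \<in> carrier X \<Longrightarrow> p (a \<odot>\<^bsub>X\<^esub> x) = a \<odot>\<^bsub>W\<^esub> p x"
  shows "module R W"
proof -
  interpret X': abelian_group X using X by (rule module_abelian_group)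
  interpret X: module R X by fact
  have *: "\<And>w. w \<in> carrier W \<Longrightarrow> \<exists>x\<in>carrier X. w = p x" using im by auto
  have cl: "\<And>x. x \<in> carrier X \<Longrightarrow> p x \<in> carrier W" using im by auto
  show ?thesis
  proof (rule moduleI)
    show "cring R" ..
    show "abelian_group W"
      using X'.abelian_group_axioms im add zero by (rule abelian_group_image)
  next
    fix a x assume a: "a \<in> carrier R" and "x \<in> carrier W"
    then obtain x' where x': "x' \<in> carrier X" "x = p x'" using * by metis
    then show "a \<odot>\<^bsub>W\<^esub> x \<in> carrier W" using a cl by (simp add: sm[symmetric])
    fix b assume b: "b \<in> carrier R"
    show "(a \<oplus>\<^bsub>R\<^esub> b) \<odot>\<^bsub>W\<^esub> x = a \<odot>\<^bsub>W\<^esub> x \<oplus>\<^bsub>W\<^esub> b \<odot>\<^bsub>W\<^esub> x"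
      using a b x' by (simp add: sm[symmetric] add[symmetric] X.smult_l_distr)
    show "(a \<otimes>\<^bsub>R\<^esub> b) \<odot>\<^bsub>W\<^esub> x = a \<odot>\<^bsub>W\<^esub> (b \<odot>\<^bsub>W\<^esub> x)"
      using a b x' by (simp add: sm[symmetric] X.smult_assoc1)
  next
    fix a x y assume a: "a \<in> carrier R" and "x \<in> carrier W" "y \<in> carrier W"
    then obtain x' y' where x': "x' \<in> carrier X" "x = p x'" "y' \<in> carrier X" "y = p y'" using * by metis
    then show "a \<odot>\<^bsub>W\<^esub> (x \<oplus>\<^bsub>W\<^esub> y) = a \<odot>\<^bsub>W\<^esub> x \<oplus>\<^bsub>W\<^esub> a \<odot>\<^bsub>W\<^esub> y"
      using a by (simp add: sm[symmetric] add[symmetric] X.smult_r_distr)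
  next
    fix x assume "x \<in> carrier W"
    then obtain x' where x': "x' \<in> carrier X" "x = p x'" using * by metis
    then show "\<one>\<^bsub>R\<^esub> \<odot>\<^bsub>W\<^esub> x = x" by (simp add: sm[symmetric])
  qed
qed

text \<open>If \<open>p\<close> identifies exactly the elements that agree modulo a submodule, this
  is a model of the quotient on the type of the values of \<open>p\<close>; if \<open>p\<close> is
  injective, it is a copy of \<open>X\<close>. The first use avoids passing to sets, the second
  moves a module to a prescribed type.\<close>

definition push_module :: "('a, 'x) module \<Rightarrow> ('x \<Rightarrow> 'w) \<Rightarrow> ('a, 'w) module" where
  "push_module X p = (let q = inv_into (carrier X) p in
     \<lparr>carrier = p ` carrier X, monoid.mult = undefined, one = undefined, zero = p \<zero>\<^bsub>X\<^esub>,
      add = (\<lambda>u v. p (q u \<oplus>\<^bsub>X\<^esub> q v)), smult = (\<lambda>a u. p (a \<odot>\<^bsub>X\<^esub> q u))\<rparr>)"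

context
  fixes R :: "('a, 'r) ring_scheme" and X :: "('a, 'x) module" and N :: "'x set" and p :: "'x \<Rightarrow> 'w"
  assumes X: "module R X" and N: "submodule N R X"
    and p: "\<And>x y. x \<in> carrier X \<Longrightarrow> y \<in> carrier X \<Longrightarrow> p x = p y \<longleftrightarrow> x \<ominus>\<^bsub>X\<^esub> y \<in> N"
begin

lemma push_module_carrier: "carrier (push_module X p) = p ` carrier X"
  by (simp add: push_module_def Let_def)

lemma push_module_hom: "p \<in> module_hom R X (push_module X p)"
proof -
  interpret X': abelian_group X using X by (rule module_abelian_group)
  interpret X: module R X by (rule X)
  define q where "q = inv_into (carrier X) p"
  have q: "q (p x) \<in> carrier X" "q (p x) \<ominus>\<^bsub>X\<^esub> x \<in> N" if "x \<in> carrier X" for x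
  proof -
    show c: "q (p x) \<in> carrier X" unfolding q_def using that by (simp add: inv_into_into)
    have "p (q (p x)) = p x" unfolding q_def using that by (simp add: f_inv_into_f)
    then show "q (p x) \<ominus>\<^bsub>X\<^esub> x \<in> N" using p c that by blast
  qed
  show ?thesis
  proof (rule module_homI)
    fix x y assume xy: "x \<in> carrier X" "y \<in> carrier X"
    have "(q (p x) \<ominus>\<^bsub>X\<^esub> x) \<oplus>\<^bsub>X\<^esub> (q (p y) \<ominus>\<^bsub>X\<^esub> y) \<in> N" using q xy submodule_add[OF N] by blast
    also have "(q (p x) \<ominus>\<^bsub>X\<^esub> x) \<oplus>\<^bsub>X\<^esub> (q (p y) \<ominus>\<^bsub>X\<^esub> y) = (q (p x) \<oplus>\<^bsub>X\<^esub> q (p y)) \<ominus>\<^bsub>X\<^esub> (x \<oplus>\<^bsub>X\<^esub> y)"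
      using q xy by (simp add: a_minus_def X'.minus_add X'.a_ac)
    finally have "p (q (p x) \<oplus>\<^bsub>X\<^esub> q (p y)) = p (x \<oplus>\<^bsub>X\<^esub> y)" using q xy by (subst p) auto
    then show "p (x \<oplus>\<^bsub>X\<^esub> y) = p x \<oplus>\<^bsub>push_module X p\<^esub> p y"
      by (simp add: push_module_def Let_def q_def)
  next
    fix a x assume xy: "a \<in> carrier R" "x \<in> carrier X"
    have "a \<odot>\<^bsub>X\<^esub> (q (p x) \<ominus>\<^bsub>X\<^esub> x) \<in> N" using q xy submodule_smult[OF N] by blast
    also have "a \<odot>\<^bsub>X\<^esub> (q (p x) \<ominus>\<^bsub>X\<^esub> x) = (a \<odot>\<^bsub>X\<^esub> q (p x)) \<ominus>\<^bsub>X\<^esub> (a \<odot>\<^bsub>X\<^esub> x)"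
      using q xy by (simp add: a_minus_def X.smult_r_distr X.smult_r_minus)
    finally have "p (a \<odot>\<^bsub>X\<^esub> q (p x)) = p (a \<odot>\<^bsub>X\<^esub> x)" using q xy by (subst p) auto
    then show "p (a \<odot>\<^bsub>X\<^esub> x) = a \<odot>\<^bsub>push_module X p\<^esub> p x"
      by (simp add: push_module_def Let_def q_def)
  qed (auto simp: push_module_carrier)
qed

lemma push_module_module: "module R (push_module X p)"
  using X
proof (rule module_image)
  show "p \<zero>\<^bsub>X\<^esub> = \<zero>\<^bsub>push_module X p\<^esub>" by (simp add: push_module_def Let_def)
qed (auto simp: push_module_carrier hom_add[OF push_module_hom] hom_smult[OF push_module_hom])

lemma push_module_kernel: "x \<in> carrier X \<Longrightarrow> p x = \<zero>\<^bsub>push_module X p\<^esub> \<longleftrightarrow> x \<in> N"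
proof -
  assume x: "x \<in> carrier X"
  interpret X': abelian_group X using X by (rule module_abelian_group)
  interpret X: module R X by (rule X)
  show ?thesis using p[OF x X'.zero_closed] x
    by (simp add: push_module_def Let_def X'.diff_zero)
qed

end

context
  fixes R :: "('a, 'r) ring_scheme" and X :: "('a, 'x) module" and p :: "'x \<Rightarrow> 'w"
  assumes X: "module R X" and p: "inj_on p (carrier X)"
begin

lemma push_inj: "x \<in> carrier X \<Longrightarrow> y \<in> carrier X \<Longrightarrow> p x = p y \<longleftrightarrow> x \<ominus>\<^bsub>X\<^esub> y \<in> {\<zero>\<^bsub>X\<^esub>}"
  using abelian_group.diff_eq_zero_iff[OF module_abelian_group[OF X]] p by (auto dest: inj_onD)

lemma push_inj_hom: "p \<in> module_hom R X (push_module X p)"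
  using X submodule_zeroset[OF X] push_inj by (rule push_module_hom)

lemma push_inj_module: "module R (push_module X p)"
  using X submodule_zeroset[OF X] push_inj by (rule push_module_module)

lemma push_inv_hom: "inv_into (carrier X) p \<in> module_hom R (push_module X p) X"
proof (rule module_homI)
  interpret X: module R X by (rule X)
  let ?q = "inv_into (carrier X) p"
  have c: "carrier (push_module X p) = p ` carrier X" by (simp add: push_module_def Let_def)
  show "?q x \<in> carrier X" if "x \<in> carrier (push_module X p)" for x
    using that unfolding c by (rule inv_into_into)
  show "?q (x \<oplus>\<^bsub>push_module X p\<^esub> y) = ?q x \<oplus>\<^bsub>X\<^esub> ?q y"
    if "x \<in> carrier (push_module X p)" "y \<in> carrier (push_module X p)" for x y
    using that unfolding c by (simp add: push_module_def Let_def inv_into_into p)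
  show "?q (a \<odot>\<^bsub>push_module X p\<^esub> x) = a \<odot>\<^bsub>X\<^esub> ?q x"
    if "a \<in> carrier R" "x \<in> carrier (push_module X p)" for a x
    using that unfolding c by (simp add: push_module_def Let_def inv_into_into p)
qed

end

section \<open>Quotient modules\<close>

context
  fixes R :: "('a, 'r) ring_scheme" and X :: "('a, 'x) module" and N :: "'x set"
  assumes X: "module R X" and N: "submodule N R X"
begin

lemma additive_subgroup_submodule: "additive_subgroup N X"
  using N by (simp add: additive_subgroup_def submodule_def)

lemma abelian_subgroup_submodule: "abelian_subgroup N X"
  using module_abelian_group[OF X] additive_subgroup_submodule by (rule abelian_subgroupI3[rotated])

lemma quot_module_carrier: "carrier (quot_module X N) = (\<lambda>x. N +>\<^bsub>X\<^esub> x) ` carrier X"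
  by (auto simp: quot_module_def A_RCOSETS_def' a_r_coset_def)

lemma quot_module_coset_eq:
  "x \<in> carrier X \<Longrightarrow> y \<in> carrier X \<Longrightarrow> N +>\<^bsub>X\<^esub> x = N +>\<^bsub>X\<^esub> y \<longleftrightarrow> x \<ominus>\<^bsub>X\<^esub> y \<in> N"
proof -
  assume xy: "x \<in> carrier X" "y \<in> carrier X"
  interpret X: abelian_group X using X by (rule module_abelian_group)
  interpret N: abelian_subgroup N X by (rule abelian_subgroup_submodule)
  have "x \<ominus>\<^bsub>X\<^esub> y \<in> N \<longleftrightarrow> x \<in> N +>\<^bsub>X\<^esub> y"
    using xy N.a_rcos_module[of y x] by (simp add: X.minus_eq)
  then show ?thesis using xy N.a_repr_independence'[of x y] N.a_rcos_self[of x] by auto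
qed

lemma quot_module_hom: "(\<lambda>x. N +>\<^bsub>X\<^esub> x) \<in> module_hom R X (quot_module X N)"
proof (rule module_homI)
  interpret X': abelian_group X using X by (rule module_abelian_group)
  interpret X: module R X by (rule X)
  interpret N: abelian_subgroup N X by (rule abelian_subgroup_submodule)
  show "N +>\<^bsub>X\<^esub> (x \<oplus>\<^bsub>X\<^esub> y) = (N +>\<^bsub>X\<^esub> x) \<oplus>\<^bsub>quot_module X N\<^esub> (N +>\<^bsub>X\<^esub> y)"
    if "x \<in> carrier X" "y \<in> carrier X" for x y
    using that by (simp add: quot_module_def N.a_rcos_sum)
  show "N +>\<^bsub>X\<^esub> (a \<odot>\<^bsub>X\<^esub> x) = a \<odot>\<^bsub>quot_module X N\<^esub> (N +>\<^bsub>X\<^esub> x)"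
    if a: "a \<in> carrier R" "x \<in> carrier X" for a x
  proof -
    \<comment> \<open>The scalar action on cosets is a union over representatives, so every member
      of that union must be shown to be the same coset.\<close>
    have "N +>\<^bsub>X\<^esub> (a \<odot>\<^bsub>X\<^esub> y) = N +>\<^bsub>X\<^esub> (a \<odot>\<^bsub>X\<^esub> x)" if y: "y \<in> N +>\<^bsub>X\<^esub> x" for y
    proof -
      have yc: "y \<in> carrier X" using y a using N.a_elemrcos_carrier[OF _ y] by blast
      have "y \<ominus>\<^bsub>X\<^esub> x \<in> N" using y yc a N.a_repr_independence'[OF y] quot_module_coset_eq[of y x] by auto
      then have "a \<odot>\<^bsub>X\<^esub> (y \<ominus>\<^bsub>X\<^esub> x) \<in> N" using a submodule_smult[OF N] by blast
      then show ?thesis using a yc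
        by (subst quot_module_coset_eq) (auto simp: a_minus_def X.smult_r_distr X.smult_r_minus)
    qed
    then have "(\<Union>y\<in>N +>\<^bsub>X\<^esub> x. N +>\<^bsub>X\<^esub> (a \<odot>\<^bsub>X\<^esub> y)) = N +>\<^bsub>X\<^esub> (a \<odot>\<^bsub>X\<^esub> x)"
      using N.a_rcos_self[OF a(2)] by blast
    then show ?thesis by (simp add: quot_module_def)
  qed
qed (auto simp: quot_module_carrier)

lemma quot_module_module: "module R (quot_module X N)"
  using X
proof (rule module_image)
  interpret X: abelian_group X using X by (rule module_abelian_group)
  interpret N: abelian_subgroup N X by (rule abelian_subgroup_submodule)
  show "N +>\<^bsub>X\<^esub> \<zero>\<^bsub>X\<^esub> = \<zero>\<^bsub>quot_module X N\<^esub>"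
    by (simp add: quot_module_def) (metis N.a_subset X.a_coset_add_zero)
qed (auto simp: quot_module_carrier hom_add[OF quot_module_hom] hom_smult[OF quot_module_hom])

lemma quot_module_kernel: "x \<in> carrier X \<Longrightarrow> N +>\<^bsub>X\<^esub> x = \<zero>\<^bsub>quot_module X N\<^esub> \<longleftrightarrow> x \<in> N"
proof -
  assume x: "x \<in> carrier X"
  interpret X: abelian_group X using X by (rule module_abelian_group)
  have "N +>\<^bsub>X\<^esub> \<zero>\<^bsub>X\<^esub> = \<zero>\<^bsub>quot_module X N\<^esub>"
    using hom_zero[OF X quot_module_module quot_module_hom] .
  then show ?thesis using quot_module_coset_eq[OF x X.zero_closed] x by (simp add: X.diff_zero)
qed

end

section \<open>Injective hulls\<close>

text \<open>HOL cannot quantify over the type of \<open>P\<close>, so injectivity is expressed for one \<open>P\<close> at a time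
  and proved polymorphically in its type.\<close>

definition ext_into :: "('a, 'r) ring_scheme \<Rightarrow> ('a, 'u) module \<Rightarrow> ('a, 'p) module \<Rightarrow> bool" where
  "ext_into R J P \<longleftrightarrow> (\<forall>N g. submodule N R P \<longrightarrow> g \<in> module_hom R (P\<lparr>carrier := N\<rparr>) J \<longrightarrow>
    (\<exists>h \<in> module_hom R P J. \<forall>x\<in>N. h x = g x))"

text \<open>Since \<open>\<phi>\<close> kills the kernel of \<open>d\<close>, it descends to the
  image of \<open>d\<close> and extends from there to \<open>P\<close>. Chain maps, homotopies and
  the twist of the horseshoe are all obtained in this form.\<close>

lemma ext_into_factor:
  assumes X: "module R X" and P: "module R P" and J: "module R J"
    and d: "d \<in> module_hom R X P" and \<phi>: "\<phi> \<in> module_hom R X J" and ext: "ext_into R J P"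
    and ker: "\<And>x. x \<in> carrier X \<Longrightarrow> d x = \<zero>\<^bsub>P\<^esub> \<Longrightarrow> \<phi> x = \<zero>\<^bsub>J\<^esub>"
  shows "\<exists>\<psi> \<in> module_hom R P J. \<forall>x\<in>carrier X. \<psi> (d x) = \<phi> x"
proof -
  interpret X': abelian_group X using X by (rule module_abelian_group)
  interpret P': abelian_group P using P by (rule module_abelian_group)
  interpret J': abelian_group J using J by (rule module_abelian_group)
  interpret X: module R X by (rule X)
  define N where "N = d ` carrier X"
  have N: "submodule N R P" unfolding N_def using X P d by (rule submodule_image)
  \<comment> \<open>Any preimage under \<open>d\<close> serves, because two of them differ by an
    element that \<open>\<phi>\<close> kills.\<close>
  define g where "g u = \<phi> (inv_into (carrier X) d u)" for u
  have g: "g (d x) = \<phi> x" if x: "x \<in> carrier X" for x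
  proof -
    let ?y = "inv_into (carrier X) d (d x)"
    have y: "?y \<in> carrier X" "d ?y = d x" using x by (auto simp: inv_into_into f_inv_into_f)
    then have "d (?y \<ominus>\<^bsub>X\<^esub> x) = \<zero>\<^bsub>P\<^esub>"
      using x hom_closed[OF d] by (simp add: hom_minus[OF X P d] P'.diff_eq_zero_iff)
    then have "\<phi> (?y \<ominus>\<^bsub>X\<^esub> x) = \<zero>\<^bsub>J\<^esub>" using ker x y by simp
    then show ?thesis
      using x y hom_closed[OF \<phi>] by (simp add: g_def hom_minus[OF X J \<phi>] J'.diff_eq_zero_iff)
  qed
  have "g \<in> module_hom R (P\<lparr>carrier := N\<rparr>) J"
  proof (rule module_homI)
    fix x assume "x \<in> carrier (P\<lparr>carrier := N\<rparr>)"
    then obtain x' where x': "x' \<in> carrier X" "x = d x'" by (auto simp: N_def)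
    then show "g x \<in> carrier J" using g hom_closed[OF \<phi>] by simp
    show "g (a \<odot>\<^bsub>P\<lparr>carrier := N\<rparr>\<^esub> x) = a \<odot>\<^bsub>J\<^esub> g x" if "a \<in> carrier R" for a
      using that x' by (simp add: hom_smult[OF d, symmetric] g hom_smult[OF \<phi>])
    fix y assume "y \<in> carrier (P\<lparr>carrier := N\<rparr>)"
    then obtain y' where y': "y' \<in> carrier X" "y = d y'" by (auto simp: N_def)
    show "g (x \<oplus>\<^bsub>P\<lparr>carrier := N\<rparr>\<^esub> y) = g x \<oplus>\<^bsub>J\<^esub> g y"
      using x' y' by (simp add: hom_add[OF d, symmetric] g hom_add[OF \<phi>])
  qed
  then obtain h where "h \<in> module_hom R P J" "\<forall>x\<in>N. h x = g x"
    using ext N unfolding ext_into_def by blast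
  then show ?thesis using g by (auto simp: N_def)
qed

lemma ext_into_retract:
  assumes ext: "ext_into R J' P" and r: "r \<in> module_hom R J' J" and s: "s \<in> module_hom R J J'"
    and rs: "\<And>x. x \<in> carrier J \<Longrightarrow> r (s x) = x"
  shows "ext_into R J P"
  unfolding ext_into_def
proof (intro allI impI)
  fix N g assume N: "submodule N R P" and g: "g \<in> module_hom R (P\<lparr>carrier := N\<rparr>) J"
  obtain h where h: "h \<in> module_hom R P J'" "\<forall>x\<in>N. h x = s (g x)"
    using ext[unfolded ext_into_def, rule_format, OF N hom_comp[OF g s]] by blast
  have "\<forall>x\<in>N. r (h x) = g x" using h(2) rs hom_closed[OF g] by simp
  then show "\<exists>h\<in>module_hom R P J. \<forall>x\<in>N. h x = g x"
    using hom_comp[OF h(1) r] by (intro bexI[where x = "\<lambda>x. r (h x)"])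
qed

section \<open>Extension of additive maps into divisible groups\<close>

definition divisible_group :: "('d, 'e) ring_scheme \<Rightarrow> bool" where
  "divisible_group D \<longleftrightarrow> (\<forall>n::nat. \<forall>x\<in>carrier D. n > 0 \<longrightarrow> (\<exists>y\<in>carrier D. add_pow D n y = x))"

lemma int_add_pow_of_nat: "add_pow G (int n) x = add_pow G n x"
  by (simp add: add_pow_def int_pow_int)

text \<open>Partial additive maps as graphs, so that Zorn's lemma applies to inclusion.\<close>

locale additive_relation = P: abelian_group P + D: abelian_group D
  for P :: "('p, 'e1) ring_scheme" and D :: "('d, 'e2) ring_scheme" +
  fixes H :: "('p \<times> 'd) set"
  assumes subset: "H \<subseteq> carrier P \<times> carrier D"
    and zero: "(\<zero>\<^bsub>P\<^esub>, \<zero>\<^bsub>D\<^esub>) \<in> H"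
    and add: "(x, d) \<in> H \<Longrightarrow> (y, e) \<in> H \<Longrightarrow> (x \<oplus>\<^bsub>P\<^esub> y, d \<oplus>\<^bsub>D\<^esub> e) \<in> H"
    and neg: "(x, d) \<in> H \<Longrightarrow> (\<ominus>\<^bsub>P\<^esub> x, \<ominus>\<^bsub>D\<^esub> d) \<in> H"
    and functional: "(\<zero>\<^bsub>P\<^esub>, d) \<in> H \<Longrightarrow> d = \<zero>\<^bsub>D\<^esub>"
begin

lemma nat_pow: "(x, d) \<in> H \<Longrightarrow> (add_pow P (n::nat) x, add_pow D n d) \<in> H"
  by (induction n) (auto simp: zero add)

lemma int_pow: "(x, d) \<in> H \<Longrightarrow> (add_pow P (m::int) x, add_pow D m d) \<in> H"
proof (cases m rule: int_cases2)
  case (nonpos n)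
  assume H: "(x, d) \<in> H"
  then have "x \<in> carrier P" "d \<in> carrier D" using subset by auto
  then show ?thesis using neg[OF nat_pow[OF H, of n]]
    by (simp add: nonpos P.add.int_pow_neg D.add.int_pow_neg int_add_pow_of_nat)
qed (auto simp: nat_pow int_add_pow_of_nat)

text \<open>Two values of \<open>x\<close> differ by a value of zero, so it is enough that the
  locale demands uniqueness there.\<close>

lemma functional2: "(x, d) \<in> H \<Longrightarrow> (x, e) \<in> H \<Longrightarrow> d = e"
proof -
  assume H: "(x, d) \<in> H" "(x, e) \<in> H"
  then have "x \<in> carrier P" "d \<in> carrier D" "e \<in> carrier D" using subset by auto
  moreover have "d \<oplus>\<^bsub>D\<^esub> \<ominus>\<^bsub>D\<^esub> e = \<zero>\<^bsub>D\<^esub>"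
    using add[OF H(1) neg[OF H(2)]] \<open>x \<in> carrier P\<close> by (intro functional) (simp add: P.r_neg)
  ultimately show ?thesis using D.diff_eq_zero_iff[of d e] by (simp add: a_minus_def)
qed

text \<open>Adjoins \<open>p\<close> with the value \<open>y\<close>. A conflict can arise only at a
  multiple of \<open>p\<close> that already has a value, and \<open>comp\<close> rules this
  out.\<close>

lemma extend:
  assumes p: "p \<in> carrier P" and y: "y \<in> carrier D"
    and comp: "\<And>j e. (add_pow P (j::int) p, e) \<in> H \<Longrightarrow> e = add_pow D j y"
  shows "additive_relation P D {(x \<oplus>\<^bsub>P\<^esub> add_pow P (j::int) p, d \<oplus>\<^bsub>D\<^esub> add_pow D j y) | x d j. (x, d) \<in> H}"
    (is "additive_relation P D ?K")
proof
  note sub = subset[THEN subsetD]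
  show "?K \<subseteq> carrier P \<times> carrier D" using sub p y by force
  show "(\<zero>\<^bsub>P\<^esub>, \<zero>\<^bsub>D\<^esub>) \<in> ?K"
    using zero by (intro CollectI exI[of _ "\<zero>\<^bsub>P\<^esub>"] exI[of _ "\<zero>\<^bsub>D\<^esub>"] exI[of _ "0::int"])
      (simp add: add_pow_def)
next
  fix u d v e assume "(u, d) \<in> ?K" "(v, e) \<in> ?K"
  then obtain x d' j x' e' j' where *: "u = x \<oplus>\<^bsub>P\<^esub> add_pow P (j::int) p" "d = d' \<oplus>\<^bsub>D\<^esub> add_pow D j y"
      "(x, d') \<in> H"
    "v = x' \<oplus>\<^bsub>P\<^esub> add_pow P (j'::int) p" "e = e' \<oplus>\<^bsub>D\<^esub> add_pow D (j') y" "(x', e') \<in> H" by blast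
  then have "x \<in> carrier P" "x' \<in> carrier P" "d' \<in> carrier D" "e' \<in> carrier D" using subset by auto
  then have "u \<oplus>\<^bsub>P\<^esub> v = (x \<oplus>\<^bsub>P\<^esub> x') \<oplus>\<^bsub>P\<^esub> add_pow P (j + j') p" "d \<oplus>\<^bsub>D\<^esub> e = (d' \<oplus>\<^bsub>D\<^esub> e') \<oplus>\<^bsub>D\<^esub> add_pow D (j + j') y"
    using * p y by (simp_all add: P.add.int_pow_mult D.add.int_pow_mult P.a_ac D.a_ac)
  then show "(u \<oplus>\<^bsub>P\<^esub> v, d \<oplus>\<^bsub>D\<^esub> e) \<in> ?K" using add[OF *(3,6)] by blast
next
  fix u d assume "(u, d) \<in> ?K"
  then obtain x d' j where *: "u = x \<oplus>\<^bsub>P\<^esub> add_pow P (j::int) p" "d = d' \<oplus>\<^bsub>D\<^esub> add_pow D j y" "(x, d') \<in>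
      H" by blast
  then have "x \<in> carrier P" "d' \<in> carrier D" using subset by auto
  then have "\<ominus>\<^bsub>P\<^esub> u = (\<ominus>\<^bsub>P\<^esub> x) \<oplus>\<^bsub>P\<^esub> add_pow P (-j) p" "\<ominus>\<^bsub>D\<^esub> d = (\<ominus>\<^bsub>D\<^esub> d') \<oplus>\<^bsub>D\<^esub> add_pow D (-j) y"
    using * p y by (simp_all add: P.add.int_pow_neg D.add.int_pow_neg P.minus_add D.minus_add)
  then show "(\<ominus>\<^bsub>P\<^esub> u, \<ominus>\<^bsub>D\<^esub> d) \<in> ?K" using neg[OF *(3)] by blast
next
  fix d assume "(\<zero>\<^bsub>P\<^esub>, d) \<in> ?K"
  then obtain x d' j where *: "\<zero>\<^bsub>P\<^esub> = x \<oplus>\<^bsub>P\<^esub> add_pow P (j::int) p" "d = d' \<oplus>\<^bsub>D\<^esub> add_pow D j y" "(x, d')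
      \<in> H" by blast
  then have c: "x \<in> carrier P" "d' \<in> carrier D" using subset by auto
  have "add_pow P j p = \<ominus>\<^bsub>P\<^esub> x" using c p *(1)
    by (metis P.a_comm P.add.int_pow_closed P.minus_equality)
  then have "\<ominus>\<^bsub>D\<^esub> d' = add_pow D j y" using comp neg[OF *(3)] by simp
  then show "d = \<zero>\<^bsub>D\<^esub>" using *(2) c by (metis D.r_neg)
qed

end

text \<open>Divisible groups are injective among abelian groups. A maximal graph is total, because
  any further element could be given a value by division.\<close>

lemma additive_extension:
  assumes P: "abelian_group P" and D: "abelian_group D" and div: "divisible_group D"
    and N: "N \<subseteq> carrier P" "\<zero>\<^bsub>P\<^esub> \<in> N" "\<And>x. x \<in> N \<Longrightarrow> \<ominus>\<^bsub>P\<^esub> x \<in> N"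
      "\<And>x y. x \<in> N \<Longrightarrow> y \<in> N \<Longrightarrow> x \<oplus>\<^bsub>P\<^esub> y \<in> N"
    and g: "\<And>x. x \<in> N \<Longrightarrow> g x \<in> carrier D"
      "\<And>x y. x \<in> N \<Longrightarrow> y \<in> N \<Longrightarrow> g (x \<oplus>\<^bsub>P\<^esub> y) = g x \<oplus>\<^bsub>D\<^esub> g y"
  obtains h where "\<And>x. x \<in> carrier P \<Longrightarrow> h x \<in> carrier D"
    "\<And>x y. x \<in> carrier P \<Longrightarrow> y \<in> carrier P \<Longrightarrow> h (x \<oplus>\<^bsub>P\<^esub> y) = h x \<oplus>\<^bsub>D\<^esub> h y"
    "\<And>x. x \<in> N \<Longrightarrow> h x = g x"
proof -
  interpret P: abelian_group P by (rule P)
  interpret D: abelian_group D by (rule D)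
  define S where "S = {H. additive_relation P D H \<and> (\<lambda>x. (x, g x)) ` N \<subseteq> H}"
  have g0: "g \<zero>\<^bsub>P\<^esub> = \<zero>\<^bsub>D\<^esub>" using g(1)[OF N(2)] g(2)[OF N(2) N(2)] by (rule additive_zero[OF P D])
  have graph: "additive_relation P D ((\<lambda>x. (x, g x)) ` N)"
  proof
    fix x d assume "(x, d) \<in> (\<lambda>x. (x, g x)) ` N"
    then have x: "x \<in> N" "d = g x" by auto
    then have "g (\<ominus>\<^bsub>P\<^esub> x) \<oplus>\<^bsub>D\<^esub> g x = \<zero>\<^bsub>D\<^esub>"
      using N g(2)[of "\<ominus>\<^bsub>P\<^esub> x" x] g0 P.l_neg[of x] by (metis subsetD)
    then have "g (\<ominus>\<^bsub>P\<^esub> x) = \<ominus>\<^bsub>D\<^esub> d" using x N g(1) D.minus_equality by metis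
    then show "(\<ominus>\<^bsub>P\<^esub> x, \<ominus>\<^bsub>D\<^esub> d) \<in> (\<lambda>x. (x, g x)) ` N" using x N by force
  qed (use N g g0 in auto)
  have "\<exists>H\<in>S. \<forall>X\<in>S. H \<subseteq> X \<longrightarrow> X = H"
  proof (rule subset_Zorn_nonempty)
    show "S \<noteq> {}" using graph by (auto simp: S_def)
    fix \<C> assume ne: "\<C> \<noteq> {}" and ch: "subset.chain S \<C>"
    have mem: "additive_relation P D H" "(\<lambda>x. (x, g x)) ` N \<subseteq> H" if "H \<in> \<C>" for H
      using ch that by (auto simp: S_def subset.chain_def)
    \<comment> \<open>Closure under addition involves two members of the chain; the larger one
      contains both pairs.\<close>
    have two: "\<exists>H\<in>\<C>. a \<in> H \<and> b \<in> H" if ab: "a \<in> \<Union>\<C>" "b \<in> \<Union>\<C>" for a b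
    proof -
      obtain H1 where "H1 \<in> \<C>" "a \<in> H1" using ab(1) by blast
      moreover obtain H2 where "H2 \<in> \<C>" "b \<in> H2" using ab(2) by blast
      moreover from calculation have "H1 \<subseteq> H2 \<or> H2 \<subseteq> H1"
        using ch unfolding subset_chain_def by blast
      ultimately show ?thesis by blast
    qed
    have "additive_relation P D (\<Union>\<C>)"
    proof
      show "\<Union>\<C> \<subseteq> carrier P \<times> carrier D" using mem additive_relation.subset by blast
      show "(\<zero>\<^bsub>P\<^esub>, \<zero>\<^bsub>D\<^esub>) \<in> \<Union>\<C>" using mem additive_relation.zero ne by blast
      show "(x \<oplus>\<^bsub>P\<^esub> y, d \<oplus>\<^bsub>D\<^esub> e) \<in> \<Union>\<C>" if xy: "(x, d) \<in> \<Union>\<C>" "(y, e) \<in> \<Union>\<C>" for x d y e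
            proof -
        obtain H where "H \<in> \<C>" "(x, d) \<in> H" "(y, e) \<in> H" using two[OF xy] by blast
        then show ?thesis using additive_relation.add[OF mem(1)] by (intro UnionI)
      qed
      show "(\<ominus>\<^bsub>P\<^esub> x, \<ominus>\<^bsub>D\<^esub> d) \<in> \<Union>\<C>" if "(x, d) \<in> \<Union>\<C>" for x d
        using that additive_relation.neg[OF mem(1)] by (elim UnionE) (rule UnionI)
      show "d = \<zero>\<^bsub>D\<^esub>" if "(\<zero>\<^bsub>P\<^esub>, d) \<in> \<Union>\<C>" for d
        using that additive_relation.functional[OF mem(1)] by (elim UnionE)
    qed
    then show "\<Union>\<C> \<in> S" using ne mem by (auto simp: S_def)
  qed
  then obtain H where HS: "H \<in> S" and max: "\<And>X. X \<in> S \<Longrightarrow> H \<subseteq> X \<Longrightarrow> X = H" by metis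
  from HS have H: "additive_relation P D H" "(\<lambda>x. (x, g x)) ` N \<subseteq> H" by (simp_all add: S_def)
  interpret H: additive_relation P D H by (rule H)
  have total: "\<exists>d. (p, d) \<in> H" if p: "p \<in> carrier P" for p
  proof -
    \<comment> \<open>The value \<open>y\<close> sought for \<open>p\<close> has to agree with
      \<open>H\<close> at every multiple of \<open>p\<close> in its domain.\<close>
    have "\<exists>y\<in>carrier D. \<forall>j e. (add_pow P (j::int) p, e) \<in> H \<longrightarrow> e = add_pow D j y"
    proof (cases "\<exists>k::nat. k > 0 \<and> (\<exists>e. (add_pow P k p, e) \<in> H)")
      \<comment> \<open>No positive multiple of \<open>p\<close> has a value, hence no negative one
        either, so only \<open>j = 0\<close> occurs and zero is a consistent value.\<close>
      case False
      have "e = add_pow D j \<zero>\<^bsub>D\<^esub>" if je: "(add_pow P (j::int) p, e) \<in> H" for j e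
      proof (cases j rule: int_cases2)
        case (nonneg n)
        then have "n = 0" using False je by (auto simp: int_add_pow_of_nat)
        then show ?thesis using je nonneg H.functional by (simp add: add_pow_def)
      next
        case (nonpos n)
        have "(add_pow P n p, \<ominus>\<^bsub>D\<^esub> e) \<in> H" using H.neg[OF je] p nonpos
          by (simp add: P.add.int_pow_neg int_add_pow_of_nat)
        then have "n = 0" using False by auto
        then show ?thesis using je nonpos H.functional by (simp add: add_pow_def)
      qed
      then show ?thesis by blast
    next
      case True
      \<comment> \<open>The \<open>j\<close> for which \<open>j\<close> times \<open>p\<close> has a
        value form a subgroup of the integers. Its generator \<open>k\<close> is the only place
        where \<open>y\<close> must be matched, and divisibility solves
        \<open>k y = e0\<close>.\<close>
      define k where "k = (LEAST k::nat. k > 0 \<and> (\<exists>e. (add_pow P k p, e) \<in> H))"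
      have "k > 0 \<and> (\<exists>e. (add_pow P k p, e) \<in> H)" unfolding k_def using True by (rule LeastI_ex)
      then obtain e0 where k: "k > 0" "(add_pow P k p, e0) \<in> H" by blast
      have kmin: "\<not> (\<exists>e. (add_pow P n p, e) \<in> H)" if "0 < n" "n < k" for n
        using not_less_Least[of n "\<lambda>k. k > 0 \<and> (\<exists>e. (add_pow P k p, e) \<in> H)"] that k_def by blast
      have "e0 \<in> carrier D" using k H.subset by auto
      then obtain y where y: "y \<in> carrier D" "add_pow D k y = e0"
        using div k unfolding divisible_group_def by blast
      have "e = add_pow D j y" if je: "(add_pow P (j::int) p, e) \<in> H" for j e
      proof -
        \<comment> \<open>Division with remainder: \<open>r\<close> times \<open>p\<close> has a
          value again, and minimality of \<open>k\<close> forces \<open>r = 0\<close>.\<close>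
        define m r where "m = j div int k" and "r = nat (j mod int k)"
        have j: "j = int k * m + int r" using k by (simp add: m_def r_def)
        have mk: "(add_pow P (int k * m) p, add_pow D (int k * m) y) \<in> H"
          using H.int_pow[OF k(2), of m] p y(1)
          by (simp add: y(2)[symmetric] int_add_pow_of_nat[symmetric] P.add.int_pow_pow
              D.add.int_pow_pow)
        have "(add_pow P j p \<oplus>\<^bsub>P\<^esub> \<ominus>\<^bsub>P\<^esub> (add_pow P (int k * m) p), e \<oplus>\<^bsub>D\<^esub> \<ominus>\<^bsub>D\<^esub> (add_pow D (int k * m) y)) \<in> H"
          using H.add[OF je H.neg[OF mk]] .
        moreover have "add_pow P j p \<oplus>\<^bsub>P\<^esub> \<ominus>\<^bsub>P\<^esub> (add_pow P (int k * m) p) = add_pow P r p"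
          using p j P.add.int_pow_diff[OF p, of j "int k * m"] by (simp add: int_add_pow_of_nat)
        ultimately have rH: "(add_pow P r p, e \<oplus>\<^bsub>D\<^esub> \<ominus>\<^bsub>D\<^esub> (add_pow D (int k * m) y)) \<in> H" by simp
        have "r < k" using k by (simp add: r_def nat_less_iff)
        then have "r = 0" using kmin rH by blast
        then have "j = int k * m" using j by simp
        then show ?thesis using H.functional2[OF je] mk by simp
      qed
      then show ?thesis using y by blast
    qed
    then obtain y where y: "y \<in> carrier D" "\<And>j e. (add_pow P (j::int) p, e) \<in> H \<Longrightarrow> e = add_pow D j
        y" by blast
    define K where "K = {(x \<oplus>\<^bsub>P\<^esub> add_pow P (j::int) p, d \<oplus>\<^bsub>D\<^esub> add_pow D j y) | x d j. (x, d) \<in> H}"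
    have K: "additive_relation P D K" unfolding K_def using p y by (rule H.extend)
    have HK: "H \<subseteq> K"
    proof
      fix z assume "z \<in> H"
      moreover obtain x d where "z = (x, d)" by force
      moreover from calculation have "x \<in> carrier P" "d \<in> carrier D" using H.subset by auto
      ultimately show "z \<in> K" unfolding K_def
        by (intro CollectI exI[of _ x] exI[of _ d] exI[of _ "0::int"]) (simp add: add_pow_def)
    qed
    \<comment> \<open>Maximality absorbs the extension, so \<open>p\<close> lies in the domain of
      \<open>H\<close>.\<close>
    then have "K = H" using H(2) K by (intro max) (auto simp: S_def)
    moreover have "(p, y) \<in> K" unfolding K_def using H.zero p y
      by (intro CollectI exI[of _ "\<zero>\<^bsub>P\<^esub>"] exI[of _ "\<zero>\<^bsub>D\<^esub>"] exI[of _ "1::int"]) auto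
    ultimately show ?thesis by blast
  qed
  define h where "h p = (THE d. (p, d) \<in> H)" for p
  have hH: "h p = d" if "(p, d) \<in> H" for p d
    unfolding h_def using that H.functional2 by blast
  have h: "(p, h p) \<in> H" if "p \<in> carrier P" for p using total[OF that] hH by blast
  show thesis
  proof (rule that)
    show "h x \<in> carrier D" if "x \<in> carrier P" for x using h[OF that] H.subset by auto
    show "h (x \<oplus>\<^bsub>P\<^esub> y) = h x \<oplus>\<^bsub>D\<^esub> h y" if "x \<in> carrier P" "y \<in> carrier P" for x y
      using H.add[OF h h] that by (intro hH) auto
    show "h x = g x" if "x \<in> N" for x using H(2) that by (intro hH) auto
  qed
qed


text \<open>The divisible hull of \<open>N\<close> is the rational vector space on the elements of \<open>N\<close> modulo the integral
  relations of \<open>N\<close>. Cosets are replaced by representatives to remain on a small type.\<close>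

definition integral_part :: "('a, 'u) module \<Rightarrow> ('u \<Rightarrow>\<^sub>0 rat) set" where
  "integral_part N = {f. Poly_Mapping.keys f \<subseteq> carrier N \<and> (\<forall>x. Poly_Mapping.lookup f x \<in> \<int>)}"

text \<open>On \<open>integral_part\<close> the coefficients are integers inside the rationals, and
  the floor merely reads them off as elements of type \<open>int\<close>.\<close>

definition integral_eval :: "('a, 'u) module \<Rightarrow> ('u \<Rightarrow>\<^sub>0 rat) \<Rightarrow> 'u" where
  "integral_eval N f = (\<Oplus>\<^bsub>N\<^esub>x\<in>Poly_Mapping.keys f. add_pow N \<lfloor>Poly_Mapping.lookup f x\<rfloor> x)"

definition relation_part :: "('a, 'u) module \<Rightarrow> ('u \<Rightarrow>\<^sub>0 rat) set" where
  "relation_part N = {f \<in> integral_part N. integral_eval N f = \<zero>\<^bsub>N\<^esub>}"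

definition rational_rep :: "('a, 'u) module \<Rightarrow> ('u \<Rightarrow>\<^sub>0 rat) \<Rightarrow> ('u \<Rightarrow>\<^sub>0 rat)" where
  "rational_rep N f = (SOME g. g - f \<in> relation_part N)"

text \<open>The generators range over the whole type, while the relations involve only
  \<open>carrier N\<close>. Generators outside the carrier add a free rational summand, which
  affects neither divisibility nor the injectivity of \<open>div_emb\<close>.\<close>

definition div_hull :: "('a, 'u) module \<Rightarrow> ('u \<Rightarrow>\<^sub>0 rat) ring" where
  "div_hull N = \<lparr>carrier = range (rational_rep N), monoid.mult = undefined, one = undefined,
     zero = rational_rep N 0, add = (\<lambda>x y. rational_rep N (x + y))\<rparr>"

definition div_emb :: "('a, 'u) module \<Rightarrow> 'u \<Rightarrow> ('u \<Rightarrow>\<^sub>0 rat)" where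
  "div_emb N x = rational_rep N (Poly_Mapping.single x 1)"

section \<open>The divisible hull as a divisible group containing the given one\<close>

context
  fixes N :: "('a, 'u) module"
  assumes N: "abelian_group N"
begin

interpretation N: abelian_group N by (rule N)

text \<open>Allows sums with different supports to be compared over one common finite index
  set.\<close>

lemma integral_eval_superset:
  assumes "finite S" "Poly_Mapping.keys f \<subseteq> S" "S \<subseteq> carrier N"
  shows "integral_eval N f = (\<Oplus>\<^bsub>N\<^esub>x\<in>S. add_pow N \<lfloor>Poly_Mapping.lookup f x\<rfloor> x)"
  unfolding integral_eval_def using assms
  by (intro N.add.finprod_mono_neutral_cong_left) (auto simp: in_keys_iff, simp add: add_pow_def)

lemma integral_add:
  assumes "f \<in> integral_part N" "g \<in> integral_part N"
  shows "f + g \<in> integral_part N" "integral_eval N (f + g) = integral_eval N f \<oplus>\<^bsub>N\<^esub> integral_eval N g"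
proof -
  let ?S = "Poly_Mapping.keys f \<union> Poly_Mapping.keys g"
  have S: "finite ?S" "Poly_Mapping.keys (f + g) \<subseteq> ?S" "?S \<subseteq> carrier N"
    using assms keys_add[of f g] by (auto simp: integral_part_def)
  show "f + g \<in> integral_part N"
    using S assms by (auto simp: integral_part_def lookup_add)
  have fl: "\<lfloor>Poly_Mapping.lookup (f + g) x\<rfloor> = \<lfloor>Poly_Mapping.lookup f x\<rfloor> + \<lfloor>Poly_Mapping.lookup g
      x\<rfloor>" for x
  proof -
    obtain i j where "Poly_Mapping.lookup f x = of_int i" "Poly_Mapping.lookup g x = of_int j"
      using assms by (auto simp: integral_part_def elim!: Ints_cases) (metis Ints_cases)
    then show ?thesis by (simp add: lookup_add of_int_add[symmetric] del: of_int_add)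
  qed
  have "integral_eval N (f + g) = (\<Oplus>\<^bsub>N\<^esub>x\<in>?S. add_pow N \<lfloor>Poly_Mapping.lookup f x\<rfloor> x \<oplus>\<^bsub>N\<^esub> add_pow N
      \<lfloor>Poly_Mapping.lookup g x\<rfloor> x)"
    unfolding integral_eval_superset[OF S] fl
    by (rule N.finsum_cong') (use S(3) in \<open>auto simp: N.add.int_pow_mult\<close>)
  also have "\<dots> = integral_eval N f \<oplus>\<^bsub>N\<^esub> integral_eval N g"
    using S by (subst (1 2) integral_eval_superset[of ?S]) (auto intro!: N.finsum_addf)
  finally show "integral_eval N (f + g) = integral_eval N f \<oplus>\<^bsub>N\<^esub> integral_eval N g" .
qed

lemma integral_eval_closed: "f \<in> integral_part N \<Longrightarrow> integral_eval N f \<in> carrier N"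
  unfolding integral_eval_def by (rule N.finsum_closed) (auto simp: integral_part_def)

lemma integral_zero: "0 \<in> integral_part N" "integral_eval N 0 = \<zero>\<^bsub>N\<^esub>"
  by (auto simp: integral_part_def integral_eval_def)

lemma integral_neg:
  assumes "f \<in> integral_part N"
  shows "- f \<in> integral_part N" "integral_eval N (- f) = \<ominus>\<^bsub>N\<^esub> integral_eval N f"
proof -
  show m: "- f \<in> integral_part N" using assms by (auto simp: integral_part_def lookup_uminus)
  have "integral_eval N (- f) \<oplus>\<^bsub>N\<^esub> integral_eval N f = \<zero>\<^bsub>N\<^esub>"
    using integral_add(2)[OF m assms] integral_zero by simp
  then show "integral_eval N (- f) = \<ominus>\<^bsub>N\<^esub> integral_eval N f"
    using integral_eval_closed assms m N.minus_equality by metis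
qed

lemma relation_part_closed:
  "0 \<in> relation_part N"
  "f \<in> relation_part N \<Longrightarrow> g \<in> relation_part N \<Longrightarrow> f + g \<in> relation_part N"
  "f \<in> relation_part N \<Longrightarrow> - f \<in> relation_part N"
  by (auto simp: relation_part_def integral_zero integral_add integral_neg N.neg_zero)

lemma rational_rep_rel: "rational_rep N f - f \<in> relation_part N"
  unfolding rational_rep_def by (rule someI[of _ f]) (simp add: relation_part_closed)

text \<open>The predicate under \<open>SOME\<close> depends only on the coset of \<open>f\<close>,
  so all members of a coset receive the same representative.\<close>

lemma rational_rep_eq_iff: "rational_rep N f = rational_rep N g \<longleftrightarrow> f - g \<in> relation_part N"
proof
  assume "rational_rep N f = rational_rep N g"
  then show "f - g \<in> relation_part N"
    using relation_part_closed(2)[OF rational_rep_rel[of g] relation_part_closed(3)[OF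
        rational_rep_rel[of f]]]
    by simp
next
  assume fg: "f - g \<in> relation_part N"
  have "h - f \<in> relation_part N \<longleftrightarrow> h - g \<in> relation_part N" for h
    using relation_part_closed(2)[OF _ fg, of "h - f"]
      relation_part_closed(2)[OF _ relation_part_closed(3)[OF fg], of "h - g"] by auto
  then show "rational_rep N f = rational_rep N g" unfolding rational_rep_def by simp
qed

lemma rational_rep_add:
  "rational_rep N (f + g) = rational_rep N f \<oplus>\<^bsub>div_hull N\<^esub> rational_rep N g"
proof -
  have "(rational_rep N f - f) + (rational_rep N g - g) \<in> relation_part N"
    by (intro relation_part_closed(2) rational_rep_rel)
  then have "rational_rep N f + rational_rep N g - (f + g) \<in> relation_part N" by (simp add:
      algebra_simps)
  then show ?thesis by (simp add: div_hull_def rational_rep_eq_iff[symmetric])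
qed

lemma div_hull_carrier: "carrier (div_hull N) = range (rational_rep N)"
  and div_hull_zero: "\<zero>\<^bsub>div_hull N\<^esub> = rational_rep N 0"
  by (simp_all add: div_hull_def)

lemma div_hull_abelian_group: "abelian_group (div_hull N)"
proof (rule abelian_group_image)
  define U :: "('u \<Rightarrow>\<^sub>0 rat) ring" where
    "U = \<lparr>carrier = UNIV, monoid.mult = undefined, one = undefined, zero = 0, add = (+)\<rparr>"
  show "abelian_group U"
    by (rule abelian_groupI) (auto simp: U_def add.assoc add.commute intro: exI[of _ "- _"])
  show "rational_rep N ` carrier U = carrier (div_hull N)" by (simp add: U_def div_hull_carrier)
  show "rational_rep N \<zero>\<^bsub>U\<^esub> = \<zero>\<^bsub>div_hull N\<^esub>" by (simp add: U_def div_hull_zero)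
  show "rational_rep N (x \<oplus>\<^bsub>U\<^esub> y) = rational_rep N x \<oplus>\<^bsub>div_hull N\<^esub> rational_rep N y" for x y
    by (simp add: U_def rational_rep_add)
qed

lemma div_hull_divisible: "divisible_group (div_hull N)"
  unfolding divisible_group_def
proof (intro allI ballI impI)
  fix n :: nat and x assume "x \<in> carrier (div_hull N)" and n: "n > 0"
  then obtain f where f: "x = rational_rep N f" by (auto simp: div_hull_carrier)
  define g where "g = Poly_Mapping.map (\<lambda>c. c / of_nat n) f"
  have lg: "Poly_Mapping.lookup g k = Poly_Mapping.lookup f k / of_nat n" for k
    by (simp add: g_def Poly_Mapping.map.rep_eq when_def)
  \<comment> \<open>Addition in the hull replaces every partial sum by a representative. The
    induction therefore carries along an honest function \<open>h\<close> in the same class, with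
    \<open>m\<close> times the coefficients of \<open>g\<close>.\<close>
  have step: "\<exists>h. add_pow (div_hull N) m (rational_rep N g) = rational_rep N h \<and>
      (\<forall>k. Poly_Mapping.lookup h k = of_nat m * Poly_Mapping.lookup g k)" for m
  proof (induction m)
    case 0
    then show ?case by (intro exI[of _ 0]) (simp add: add_pow_def div_hull_zero)
  next
    case (Suc m)
    then obtain h where "add_pow (div_hull N) m (rational_rep N g) = rational_rep N h"
      "\<forall>k. Poly_Mapping.lookup h k = of_nat m * Poly_Mapping.lookup g k" by blast
    then show ?case
      by (intro exI[of _ "h + g"]) (simp add: add_pow_def rational_rep_add[symmetric] lookup_add
          algebra_simps)
  qed
  obtain h where h: "add_pow (div_hull N) n (rational_rep N g) = rational_rep N h"
    "\<forall>k. Poly_Mapping.lookup h k = of_nat n * Poly_Mapping.lookup g k" using step[of n] by blast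
  have "h = f" using h(2) lg n by (intro poly_mapping_eqI) simp
  then show "\<exists>y\<in>carrier (div_hull N). add_pow (div_hull N) n y = x"
    using h f by (auto simp: div_hull_carrier)
qed

lemma integral_single:
  "x \<in> carrier N \<Longrightarrow> Poly_Mapping.single x 1 \<in> integral_part N"
  "x \<in> carrier N \<Longrightarrow> integral_eval N (Poly_Mapping.single x 1) = x"
  by (auto simp: integral_part_def integral_eval_def lookup_single when_def)

lemma div_emb_closed: "div_emb N x \<in> carrier (div_hull N)"
  by (auto simp: div_emb_def div_hull_carrier)

lemma div_emb_add:
  assumes "x \<in> carrier N" "y \<in> carrier N"
  shows "div_emb N (x \<oplus>\<^bsub>N\<^esub> y) = div_emb N x \<oplus>\<^bsub>div_hull N\<^esub> div_emb N y"
proof -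
  let ?s = "\<lambda>x. Poly_Mapping.single x (1::rat)"
  have xy: "?s x + ?s y \<in> integral_part N" "integral_eval N (?s x + ?s y) = x \<oplus>\<^bsub>N\<^esub> y"
    using assms by (simp_all add: integral_add integral_single)
  have "?s (x \<oplus>\<^bsub>N\<^esub> y) + - (?s x + ?s y) \<in> relation_part N"
    using assms integral_add[OF integral_single(1) integral_neg(1)[OF xy(1)], of "x \<oplus>\<^bsub>N\<^esub> y"]
    by (simp add: relation_part_def integral_neg[OF xy(1)] xy(2) N.r_neg integral_single del:
        minus_add_distrib)
  then have "?s (x \<oplus>\<^bsub>N\<^esub> y) - (?s x + ?s y) \<in> relation_part N" by (simp only: diff_conv_add_uminus)
  then show ?thesis by (simp only: div_emb_def rational_rep_add[symmetric] rational_rep_eq_iff)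
qed

text \<open>A single generator is a relation only if its evaluation vanishes, and this evaluation is
  \<open>x\<close> itself.\<close>

lemma div_emb_kernel:
  assumes "x \<in> carrier N" "div_emb N x = \<zero>\<^bsub>div_hull N\<^esub>"
  shows "x = \<zero>\<^bsub>N\<^esub>"
  using assms integral_single[of x]
  by (simp add: div_emb_def div_hull_zero rational_rep_eq_iff relation_part_def)

end


text \<open>The additive maps from \<open>R\<close> to \<open>D\<close>: a homomorphism from \<open>P\<close> into this module is the same as an
  additive map from \<open>P\<close> to \<open>D\<close>, by evaluation at \<open>\<one>\<close>.\<close>

definition coind_module :: "('a, 'r) ring_scheme \<Rightarrow> ('d, 'e) ring_scheme \<Rightarrow> ('a, 'a \<Rightarrow> 'd) module" where
  "coind_module R D =
    \<lparr>carrier = {\<phi> \<in> carrier R \<rightarrow>\<^sub>E carrier D. \<forall>a\<in>carrier R. \<forall>b\<in>carrier R.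
        \<phi> (a \<oplus>\<^bsub>R\<^esub> b) = \<phi> a \<oplus>\<^bsub>D\<^esub> \<phi> b},
     monoid.mult = undefined, one = undefined,
     zero = (\<lambda>b\<in>carrier R. \<zero>\<^bsub>D\<^esub>), add = (\<lambda>\<phi> \<psi>. \<lambda>b\<in>carrier R. \<phi> b \<oplus>\<^bsub>D\<^esub> \<psi> b),
     smult = (\<lambda>a \<phi>. \<lambda>b\<in>carrier R. \<phi> (b \<otimes>\<^bsub>R\<^esub> a))\<rparr>"

context
  fixes R :: "('a, 'r) ring_scheme" and D :: "('d, 'e) ring_scheme"
  assumes R: "cring R" and D: "abelian_group D"
begin

interpretation R: cring R by (rule R)
interpretation D: abelian_group D by (rule D)

lemma coind_closed: "\<phi> \<in> carrier (coind_module R D) \<Longrightarrow> b \<in> carrier R \<Longrightarrow> \<phi> b \<in> carrier D"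
  and coind_additive: "\<phi> \<in> carrier (coind_module R D) \<Longrightarrow> a \<in> carrier R \<Longrightarrow> b \<in> carrier R \<Longrightarrow>
    \<phi> (a \<oplus>\<^bsub>R\<^esub> b) = \<phi> a \<oplus>\<^bsub>D\<^esub> \<phi> b"
  and coind_ext: "\<phi> \<in> carrier (coind_module R D) \<Longrightarrow> \<psi> \<in> carrier (coind_module R D) \<Longrightarrow>
    (\<And>b. b \<in> carrier R \<Longrightarrow> \<phi> b = \<psi> b) \<Longrightarrow> \<phi> = \<psi>"
  and coind_memI: "(\<And>b. b \<in> carrier R \<Longrightarrow> \<xi> b \<in> carrier D) \<Longrightarrow>
    (\<And>a b. a \<in> carrier R \<Longrightarrow> b \<in> carrier R \<Longrightarrow> \<xi> (a \<oplus>\<^bsub>R\<^esub> b) = \<xi> a \<oplus>\<^bsub>D\<^esub> \<xi> b) \<Longrightarrow>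
    (\<lambda>b\<in>carrier R. \<xi> b) \<in> carrier (coind_module R D)"
  by (auto simp: coind_module_def intro: PiE_ext)

lemma coind_simps:
  "\<zero>\<^bsub>coind_module R D\<^esub> = (\<lambda>b\<in>carrier R. \<zero>\<^bsub>D\<^esub>)"
  "\<phi> \<oplus>\<^bsub>coind_module R D\<^esub> \<psi> = (\<lambda>b\<in>carrier R. \<phi> b \<oplus>\<^bsub>D\<^esub> \<psi> b)"
  "a \<odot>\<^bsub>coind_module R D\<^esub> \<phi> = (\<lambda>b\<in>carrier R. \<phi> (b \<otimes>\<^bsub>R\<^esub> a))"
  by (simp_all add: coind_module_def)

lemma coind_mem:
  "\<zero>\<^bsub>coind_module R D\<^esub> \<in> carrier (coind_module R D)"
  "\<phi> \<in> carrier (coind_module R D) \<Longrightarrow> \<psi> \<in> carrier (coind_module R D) \<Longrightarrow>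
    \<phi> \<oplus>\<^bsub>coind_module R D\<^esub> \<psi> \<in> carrier (coind_module R D)"
  "\<phi> \<in> carrier (coind_module R D) \<Longrightarrow> a \<in> carrier R \<Longrightarrow>
    a \<odot>\<^bsub>coind_module R D\<^esub> \<phi> \<in> carrier (coind_module R D)"
  "\<phi> \<in> carrier (coind_module R D) \<Longrightarrow> (\<lambda>b\<in>carrier R. \<ominus>\<^bsub>D\<^esub> \<phi> b) \<in> carrier (coind_module R D)"
  unfolding coind_simps
  by (rule coind_memI; simp add: coind_closed coind_additive D.a_ac D.minus_add R.l_distr)+

lemma coind_module_module: "module R (coind_module R D)"
proof (rule moduleI)
  show "abelian_group (coind_module R D)"
  proof (rule abelian_groupI)
    fix \<phi> assume \<phi>: "\<phi> \<in> carrier (coind_module R D)"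
    show "\<exists>\<psi>\<in>carrier (coind_module R D). \<psi> \<oplus>\<^bsub>coind_module R D\<^esub> \<phi> = \<zero>\<^bsub>coind_module R D\<^esub>"
      using \<phi> by (intro bexI[OF _ coind_mem(4)[OF \<phi>]])
        (simp add: coind_simps coind_closed D.l_neg cong: restrict_cong)
  qed (auto simp: coind_mem intro!: coind_ext, auto simp: coind_simps coind_closed D.a_ac)
qed (auto simp: R coind_mem intro!: coind_ext,
    auto simp: coind_simps coind_closed coind_additive R.r_distr R.m_ac)

text \<open>Adjunction: \<open>g\<close> is recovered from the additive map that sends
  \<open>x\<close> to \<open>g x\<close> at \<open>\<one>\<close>. That map extends additively to
  some \<open>h\<close>, and sending \<open>x\<close> to the function that maps \<open>b\<close> to
  \<open>h (b x)\<close> restores linearity.\<close>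

lemma coind_ext_into:
  assumes div: "divisible_group D" and P: "module R P"
  shows "ext_into R (coind_module R D) P"
  unfolding ext_into_def
proof (intro allI impI)
  interpret P': abelian_group P using P by (rule module_abelian_group)
  interpret P: module R P by (rule P)
  fix N g assume N: "submodule N R P" and g: "g \<in> module_hom R (P\<lparr>carrier := N\<rparr>) (coind_module R D)"
  note sub = submodule_subset[OF N]
  have gc: "x \<in> N \<Longrightarrow> g x \<in> carrier (coind_module R D)" for x
    using hom_closed[OF g] by simp
  obtain h where h: "\<And>x. x \<in> carrier P \<Longrightarrow> h x \<in> carrier D"
    "\<And>x y. x \<in> carrier P \<Longrightarrow> y \<in> carrier P \<Longrightarrow> h (x \<oplus>\<^bsub>P\<^esub> y) = h x \<oplus>\<^bsub>D\<^esub> h y"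
    "\<And>x. x \<in> N \<Longrightarrow> h x = g x \<one>\<^bsub>R\<^esub>"
  proof (rule additive_extension[OF P'.abelian_group_axioms D div, of N "\<lambda>x. g x \<one>\<^bsub>R\<^esub>"])
    show "g (x \<oplus>\<^bsub>P\<^esub> y) \<one>\<^bsub>R\<^esub> = g x \<one>\<^bsub>R\<^esub> \<oplus>\<^bsub>D\<^esub> g y \<one>\<^bsub>R\<^esub>" if "x \<in> N" "y \<in> N" for x y
      using that hom_add[OF g, of x y] by (simp add: coind_simps)
  qed (use sub submodule_zero[OF N] submodule_uminus[OF N] submodule_add[OF N] gc coind_closed in auto)
  define k where "k x = (\<lambda>b\<in>carrier R. h (b \<odot>\<^bsub>P\<^esub> x))" for x
  have kc: "k x \<in> carrier (coind_module R D)" if "x \<in> carrier P" for x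
    unfolding k_def using that by (intro coind_memI) (auto simp: h P.smult_l_distr)
  have "k \<in> module_hom R P (coind_module R D)"
    by (rule module_homI, simp add: kc; rule coind_ext)
      (auto simp: kc coind_mem, auto simp: coind_simps k_def h P.smult_r_distr P.smult_assoc1)
  moreover have "k x = g x" if x: "x \<in> N" for x
  proof (rule coind_ext)
    fix b assume b: "b \<in> carrier R"
    have "k x b = g (b \<odot>\<^bsub>P\<^esub> x) \<one>\<^bsub>R\<^esub>" using b x by (simp add: k_def h submodule_smult[OF N])
    also have "\<dots> = (b \<odot>\<^bsub>coind_module R D\<^esub> g x) \<one>\<^bsub>R\<^esub>" using hom_smult[OF g b] x by simp
    also have "\<dots> = g x b" using b by (simp add: coind_simps)
    finally show "k x b = g x b" .
  qed (use x sub kc gc in auto)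
  ultimately show "\<exists>h\<in>module_hom R P (coind_module R D). \<forall>x\<in>N. h x = g x" by blast
qed

end

text \<open>An injection back into \<open>'u\<close> keeps the result on the type of
  \<open>N\<close>, so the construction can be iterated; that such an injection exists is the
  assumption \<open>code\<close> below. The name promises an injective module containing
  \<open>N\<close>, not an essential extension.\<close>

definition inj_hull :: "('a, 'r) ring_scheme \<Rightarrow> ('a, 'u) module \<Rightarrow> ('a, 'u) module" where
  "inj_hull R N = push_module (coind_module R (div_hull N)) (SOME c. inj c)"

definition inj_hull_emb :: "('a, 'r) ring_scheme \<Rightarrow> ('a, 'u) module \<Rightarrow> 'u \<Rightarrow> 'u" where
  "inj_hull_emb R N x =
    (SOME c. inj c) (\<lambda>b\<in>carrier R. div_emb N (b \<odot>\<^bsub>N\<^esub> x))"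

section \<open>Embedding a module into an injective one on the same type\<close>

context
  fixes R :: "('a, 'r) ring_scheme" and N :: "('a, 'u) module"
  assumes N: "module R N"
    and code: "\<exists>c :: ('a \<Rightarrow> ('u \<Rightarrow>\<^sub>0 rat)) \<Rightarrow> 'u. inj c"
begin

private definition c :: "('a \<Rightarrow> ('u \<Rightarrow>\<^sub>0 rat)) \<Rightarrow> 'u" where "c = (SOME c. inj c)"

private lemma c: "inj_on c A"
  unfolding c_def using someI_ex[OF code] inj_on_subset by blast

private lemmas D = div_hull_abelian_group[OF module_abelian_group[OF N]]
private lemmas co = coind_module_module[OF module_cring[OF N] D]

lemma inj_hull_module: "module R (inj_hull R N)"
  unfolding inj_hull_def c_def[symmetric] using push_inj_module[OF co c] .

lemma inj_hull_ext_into: "module R P \<Longrightarrow> ext_into R (inj_hull R N) P"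
  unfolding inj_hull_def c_def[symmetric]
proof (rule ext_into_retract)
  assume P: "module R P"
  show "ext_into R (coind_module R (div_hull N)) P"
    using module_cring[OF N] D div_hull_divisible[OF module_abelian_group[OF N]] P by (rule
        coind_ext_into)
  show "c \<in> module_hom R (coind_module R (div_hull N)) (push_module (coind_module R (div_hull N)) c)"
    using co c by (rule push_inj_hom)
  show "inv_into (carrier (coind_module R (div_hull N))) c \<in>
      module_hom R (push_module (coind_module R (div_hull N)) c) (coind_module R (div_hull N))"
    using co c by (rule push_inv_hom)
  show "c (inv_into (carrier (coind_module R (div_hull N))) c x) = x"
    if "x \<in> carrier (push_module (coind_module R (div_hull N)) c)" for x
    using that by (simp add: push_module_def Let_def f_inv_into_f)
qed

lemma inj_hull_emb: "inj_hull_emb R N \<in> module_hom R N (inj_hull R N)"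
  and inj_hull_emb_inj: "inj_on (inj_hull_emb R N) (carrier N)"
proof -
  interpret N': abelian_group N using N by (rule module_abelian_group)
  interpret N: module R N by (rule N)
  note de = div_emb_closed[OF N'.abelian_group_axioms] div_emb_add[OF N'.abelian_group_axioms]
  define k where "k x = (\<lambda>b\<in>carrier R. div_emb N (b \<odot>\<^bsub>N\<^esub> x))" for x
  note [simp] = coind_simps[OF module_cring[OF N] D]
  have kc: "k x \<in> carrier (coind_module R (div_hull N))" if "x \<in> carrier N" for x
    unfolding k_def using that
    by (intro coind_memI[OF module_cring[OF N] D]) (auto simp: de N.smult_l_distr)
  have k: "k \<in> module_hom R N (coind_module R (div_hull N))"
    by (rule module_homI, simp add: kc; rule coind_ext[OF module_cring[OF N] D])
      (auto simp: kc coind_mem[OF module_cring[OF N] D] simp del: coind_simps[OF module_cring[OF N] D],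
        auto simp: k_def de N.smult_r_distr N.smult_assoc1)
  have kinj: "inj_on k (carrier N)"
  proof (rule hom_inj_onI[OF N co k])
    fix x assume x: "x \<in> carrier N" "k x = \<zero>\<^bsub>coind_module R (div_hull N)\<^esub>"
    then have "k x \<one>\<^bsub>R\<^esub> = \<zero>\<^bsub>div_hull N\<^esub>" by simp
    then have "div_emb N x = \<zero>\<^bsub>div_hull N\<^esub>" using x(1) by (simp add: k_def)
    then show "x = \<zero>\<^bsub>N\<^esub>" using div_emb_kernel[OF N'.abelian_group_axioms x(1)] by blast
  qed
  have e: "inj_hull_emb R N = (\<lambda>x. c (k x))" by (simp add: fun_eq_iff inj_hull_emb_def k_def c_def)
  show "inj_hull_emb R N \<in> module_hom R N (inj_hull R N)"
    unfolding e inj_hull_def c_def[symmetric] using k push_inj_hom[OF co c] by (rule hom_comp)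
  show "inj_on (inj_hull_emb R N) (carrier N)"
    unfolding e using comp_inj_on[OF kinj c] by (simp add: comp_def)
qed

end

section \<open>Injective resolutions and local cohomology\<close>

text \<open>An infinite type absorbs its square, so lists can be folded into one element. Folding
  onto the end marker \<open>n 0\<close> separates only lists of equal length, hence the length is
  stored as well.\<close>

lemma inj_list_code:
  assumes "infinite (UNIV :: 'b set)"
  shows "\<exists>f :: 'b list \<Rightarrow> 'b. inj f"
proof -
  have "(card_of ((UNIV :: 'b set) \<times> (UNIV :: 'b set)), card_of (UNIV :: 'b set)) \<in> ordIso"
    using assms by (rule card_of_Times_same_infinite)
  then obtain p :: "'b \<times> 'b \<Rightarrow> 'b" where pb: "bij_betw p (UNIV \<times> UNIV) UNIV"
    unfolding card_of_ordIso[symmetric] by blast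
  then have p: "p a = p b \<longleftrightarrow> a = b" for a b
    using bij_betw_imp_inj_on[OF pb] by (simp add: inj_eq)
  obtain n :: "nat \<Rightarrow> 'b" where n: "inj n" using infinite_countable_subset[OF assms] by blast
  define g where "g xs = foldr (\<lambda>x acc. p (x, acc)) xs (n 0)" for xs
  have g: "length xs = length ys \<Longrightarrow> g xs = g ys \<Longrightarrow> xs = ys" for xs ys
    by (induction xs ys rule: list_induct2) (auto simp: g_def p)
  have "inj (\<lambda>xs. p (n (length xs), g xs))"
    using n by (intro injI g) (auto simp: p dest: injD)
  then show ?thesis by blast
qed

text \<open>The coding is pointwise: a list of functions becomes the function of codes of the lists
  of values. The length of the list can be read off at any argument.\<close>

lemma inj_resolution_type_list:
  "\<exists>f :: ('a, 'm) resolution_type list \<Rightarrow> ('a, 'm) resolution_type. inj f"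
proof -
  have "infinite (UNIV :: ('m + nat) set)" by (metis finite_Plus_UNIV_iff infinite_UNIV_nat)
  then obtain c :: "('m + nat) list \<Rightarrow> 'm + nat" where c: "inj c" using inj_list_code by blast
  have "inj (\<lambda>(us :: ('a, 'm) resolution_type list) l. c (map (\<lambda>u. u l) us))"
  proof (rule injI)
    fix us vs :: "('a, 'm) resolution_type list"
    assume "(\<lambda>l. c (map (\<lambda>u. u l) us)) = (\<lambda>l. c (map (\<lambda>u. u l) vs))"
    then have eq: "map (\<lambda>u. u l) us = map (\<lambda>u. u l) vs" for l using c by (metis injD)
    then have len: "length us = length vs" by (metis length_map)
    show "us = vs"
    proof (rule nth_equalityI[OF len], rule ext)
      fix i l assume "i < length us"
      then show "(us ! i) l = (vs ! i) l" using eq[of l] len by (metis nth_map)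
    qed
  qed
  then show ?thesis by blast
qed

text \<open>This is the closure property for which \<open>resolution_type\<close> is shaped. A
  finitely supported function is a list of key-value pairs and so has a code in the type. A function
  from \<open>'a\<close> into the type is uncurried, its argument becoming the head of the
  list.\<close>

lemma resolution_type_code:
  "\<exists>c :: ('a \<Rightarrow> (('a, 'm) resolution_type \<Rightarrow>\<^sub>0 rat)) \<Rightarrow> ('a, 'm) resolution_type. inj c"
proof -
  obtain lc :: "('a, 'm) resolution_type list \<Rightarrow> ('a, 'm) resolution_type" where lc: "inj lc"
    using inj_resolution_type_list by blast
  define rc :: "rat \<Rightarrow> ('a, 'm) resolution_type" where "rc q = (\<lambda>_. Inr (to_nat q))" for q
  have rc: "rc q = rc q' \<longleftrightarrow> q = q'" for q q' by (auto simp: rc_def fun_eq_iff)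
  define ks where "ks f = (SOME ks. set ks = Poly_Mapping.keys f)" for f :: "('a, 'm)
      resolution_type \<Rightarrow>\<^sub>0 rat"
  have ks: "set (ks f) = Poly_Mapping.keys f" for f
    unfolding ks_def by (rule someI_ex) (rule finite_list[OF finite_keys])
  define pc where "pc f = lc (map (\<lambda>k. lc [k, rc (Poly_Mapping.lookup f k)]) (ks f))" for f
  have pc: "f = g" if "pc f = pc g" for f g
  proof -
    define \<gamma> where "\<gamma> h k = (k, Poly_Mapping.lookup h k)" for h :: "('a, 'm) resolution_type \<Rightarrow>\<^sub>0
        rat" and k
    have \<beta>: "inj (\<lambda>(k, q). lc [k, rc q])" using lc rc by (auto simp: inj_def)
    have "map (\<lambda>(k, q). lc [k, rc q]) (map (\<gamma> f) (ks f)) = map (\<lambda>(k, q). lc [k, rc q]) (map (\<gamma> g)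
        (ks g))"
      using injD[OF lc that[unfolded pc_def]] by (simp add: \<gamma>_def comp_def)
    \<comment> \<open>\<open>ks f\<close> and \<open>ks g\<close> are arbitrary enumerations;
      passing to sets replaces them by the keys themselves.\<close>
    then have "(\<lambda>(k, q). lc [k, rc q]) ` (\<gamma> f ` Poly_Mapping.keys f) = (\<lambda>(k, q). lc [k, rc q]) `
        (\<gamma> g ` Poly_Mapping.keys g)"
      unfolding ks[symmetric] list.set_map[symmetric] by (rule arg_cong)
    then have im: "\<gamma> f ` Poly_Mapping.keys f = \<gamma> g ` Poly_Mapping.keys g"
      by (simp only: inj_image_eq_iff[OF \<beta>])
    have *: "Poly_Mapping.lookup g k = Poly_Mapping.lookup f k" if "k \<in> Poly_Mapping.keys f" for k
      using imageI[OF that, of "\<gamma> f"] unfolding im by (auto simp: \<gamma>_def)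
    have **: "Poly_Mapping.lookup f k = Poly_Mapping.lookup g k" if "k \<in> Poly_Mapping.keys g" for k
      using imageI[OF that, of "\<gamma> g"] unfolding im[symmetric] by (auto simp: \<gamma>_def)
    show ?thesis by (rule poly_mapping_eqI) (metis * ** in_keys_iff)
  qed
  \<comment> \<open>The argument \<open>a\<close> is stored as the head of the list; the value at
    the empty list is a dummy.\<close>
  have "inj (\<lambda>\<phi> l. case l of [] \<Rightarrow> Inr 0 | a # l' \<Rightarrow> pc (\<phi> a) l')"
  proof (rule injI, rule ext)
    fix \<phi> \<psi> :: "'a \<Rightarrow> (('a, 'm) resolution_type \<Rightarrow>\<^sub>0 rat)" and a
    assume eq: "(\<lambda>l. case l of [] \<Rightarrow> Inr 0 | a # l' \<Rightarrow> pc (\<phi> a) l') = (\<lambda>l. case l of [] \<Rightarrow> Inr 0 | a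
        # l' \<Rightarrow> pc (\<psi> a) l')"
    have "pc (\<phi> a) = pc (\<psi> a)" by (rule ext) (use fun_cong[OF eq, of "a # _"] in simp)
    then show "\<phi> a = \<psi> a" by (rule pc)
  qed
  then show ?thesis by blast
qed

text \<open>Cosets would move the quotient to the type of sets, and the type would grow with every
  step of a resolution. Representatives keep it fixed.\<close>

definition coset_rep :: "('a, 'u) module \<Rightarrow> 'u set \<Rightarrow> 'u \<Rightarrow> 'u" where
  "coset_rep J S x = (SOME y. y \<in> carrier J \<and> y \<ominus>\<^bsub>J\<^esub> x \<in> S)"

lemma coset_rep_eq_iff:
  assumes J: "module R J" and S: "submodule S R J" and x: "x \<in> carrier J" "y \<in> carrier J"
  shows "coset_rep J S x = coset_rep J S y \<longleftrightarrow> x \<ominus>\<^bsub>J\<^esub> y \<in> S"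
proof -
  interpret J: abelian_group J using J by (rule module_abelian_group)
  have rep: "coset_rep J S x \<in> carrier J \<and> coset_rep J S x \<ominus>\<^bsub>J\<^esub> x \<in> S" if "x \<in> carrier J" for x
    unfolding coset_rep_def using that submodule_zero[OF S] J.diff_eq_zero_iff[of x x]
    by (rule_tac someI[of _ x]) simp
  have trans: "z \<ominus>\<^bsub>J\<^esub> y \<in> S" if "z \<ominus>\<^bsub>J\<^esub> x \<in> S" "x \<ominus>\<^bsub>J\<^esub> y \<in> S" "x \<in> carrier J" "y \<in> carrier J" "z \<in>
      carrier J" for x y z
  proof -
    have "(z \<ominus>\<^bsub>J\<^esub> x) \<oplus>\<^bsub>J\<^esub> (x \<ominus>\<^bsub>J\<^esub> y) = z \<ominus>\<^bsub>J\<^esub> y"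
      using that by (simp add: a_minus_def J.a_assoc J.r_neg1)
    then show ?thesis using submodule_add[OF S that(1,2)] by simp
  qed
  have sym: "y \<ominus>\<^bsub>J\<^esub> x \<in> S" if "x \<ominus>\<^bsub>J\<^esub> y \<in> S" "x \<in> carrier J" "y \<in> carrier J" for x y
    using submodule_uminus[OF S that(1)] that(2,3) by (simp add: a_minus_def J.minus_add J.a_comm)
  show ?thesis
  proof
    assume "coset_rep J S x = coset_rep J S y"
    then have r: "coset_rep J S x \<in> carrier J" "coset_rep J S x \<ominus>\<^bsub>J\<^esub> x \<in> S" "coset_rep J S x \<ominus>\<^bsub>J\<^esub> y \<in> S"
      using rep[OF x(1)] rep[OF x(2)] by auto
    show "x \<ominus>\<^bsub>J\<^esub> y \<in> S" by (rule trans[OF sym[OF r(2,1) x(1)] r(3) r(1) x(2,1)])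
  next
    assume "x \<ominus>\<^bsub>J\<^esub> y \<in> S"
    then have "(z \<in> carrier J \<and> z \<ominus>\<^bsub>J\<^esub> x \<in> S) = (z \<in> carrier J \<and> z \<ominus>\<^bsub>J\<^esub> y \<in> S)" for z
      using trans[OF _ \<open>x \<ominus>\<^bsub>J\<^esub> y \<in> S\<close> x] trans[OF _ sym[OF \<open>x \<ominus>\<^bsub>J\<^esub> y \<in> S\<close> x] x(2,1)] by blast
    then show "coset_rep J S x = coset_rep J S y" unfolding coset_rep_def by simp
  qed
qed

definition cosyzygy_map :: "('a, 'r) ring_scheme \<Rightarrow> ('a, 'u) module \<Rightarrow> 'u \<Rightarrow> 'u" where
  "cosyzygy_map R N = coset_rep (inj_hull R N) (inj_hull_emb R N ` carrier N)"

definition cosyzygy :: "('a, 'r) ring_scheme \<Rightarrow> ('a, 'u) module \<Rightarrow> ('a, 'u) module" where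
  "cosyzygy R N = push_module (inj_hull R N) (cosyzygy_map R N)"

lemma injective_moduleI:
  fixes J :: "('a, 'u) module"
  assumes J: "module R J" and ext: "\<And>P :: ('a, 'a \<times> 'u) module. module R P \<Longrightarrow> ext_into R J P"
  shows "injective_module R J"
  unfolding injective_module_def
proof (intro conjI allI impI)
  fix N P :: "('a, 'a \<times> 'u) module" and f g
  assume N: "module R N" and P: "module R P" and f: "f \<in> module_hom R N P" "inj_on f (carrier N)"
    and g: "g \<in> module_hom R N J"
  show "\<exists>h\<in>module_hom R P J. \<forall>x\<in>carrier N. h (f x) = g x"
  proof (rule ext_into_factor[OF N P J f(1) g ext[OF P]])
    interpret N: abelian_group N using N by (rule module_abelian_group)
    fix x assume "x \<in> carrier N" "f x = \<zero>\<^bsub>P\<^esub>"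
    then have "x = \<zero>\<^bsub>N\<^esub>" using f(2) hom_zero[OF N P f(1)] by (metis N.zero_closed inj_onD)
    then show "g x = \<zero>\<^bsub>J\<^esub>" using hom_zero[OF N J g] by simp
  qed
qed (rule J)

text \<open>The test modules in \<open>injective_module\<close> suffice to split the embedding of \<open>J\<close> into its hull,
    so \<open>J\<close> is a
  retract of a module that is injective with respect to all types.\<close>

lemma injective_module_ext_into:
  fixes J :: "('a, ('a, 'm) resolution_type) module" and P :: "('a, 'p) module"
  assumes J: "injective_module R J" and P: "module R P"
  shows "ext_into R J P"
proof -
  have mJ: "module R J" using J by (simp add: injective_module_def)
  note hull = inj_hull_module[OF mJ resolution_type_code] inj_hull_emb[OF mJ resolution_type_code]
    inj_hull_emb_inj[OF mJ resolution_type_code]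
  \<comment> \<open>Pairing with \<open>undefined\<close> does nothing but move \<open>J\<close> and
    its hull to the type over which the test modules of \<open>injective_module\<close>
    range.\<close>
  let ?H = "inj_hull R J" and ?p = "Pair (undefined :: 'a) :: ('a, 'm) resolution_type \<Rightarrow> _"
  have p: "inj_on ?p S" for S by (auto simp: inj_on_def)
  let ?q = "inv_into (carrier J) ?p"
  note pJ = push_inj_hom[OF mJ p] push_inj_module[OF mJ p] push_inv_hom[OF mJ p]
  note pH = push_inj_hom[OF hull(1) p] push_inj_module[OF hull(1) p]
  let ?f = "\<lambda>x. ?p (inj_hull_emb R J (?q x))"
  have f: "?f \<in> module_hom R (push_module J ?p) (push_module ?H ?p)"
    by (rule hom_comp[OF hom_comp[OF pJ(3) hull(2)] pH(1)])
  have finj: "inj_on ?f (carrier (push_module J ?p))"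
    by (rule inj_onI) (auto simp: push_module_def Let_def p inj_on_eq_iff[OF hull(3)])
  obtain h where h: "h \<in> module_hom R (push_module ?H ?p) J"
    "\<forall>x\<in>carrier (push_module J ?p). h (?f x) = ?q x"
    using J[unfolded injective_module_def] pJ(2,3) pH(2) f finj by blast
  show ?thesis
  proof (rule ext_into_retract)
    show "ext_into R ?H P" using mJ resolution_type_code P by (rule inj_hull_ext_into)
    show "(\<lambda>x. h (?p x)) \<in> module_hom R ?H J" using pH(1) h(1) by (rule hom_comp)
    show "inj_hull_emb R J \<in> module_hom R J ?H" by (rule hull(2))
    show "h (?p (inj_hull_emb R J x)) = x" if "x \<in> carrier J" for x
      using h(2) that by (auto simp: push_module_def Let_def p)
  qed
qed

text \<open>Embed, take the cokernel on the same type, repeat, and splice. It ensures that the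
  \<open>SOME\<close> in \<open>chosen_resolution\<close> has a witness.\<close>

lemma injective_resolution_exists:
  fixes X :: "('a, 'm) module"
  assumes X: "module R X"
  shows "\<exists>e (I :: nat \<Rightarrow> ('a, ('a, 'm) resolution_type) module) d. injective_resolution R X e I d"
proof -
  let ?i = "(\<lambda>x _. Inl x) :: 'm \<Rightarrow> ('a, 'm) resolution_type"
  have i: "inj_on ?i S" for S by (auto simp: inj_on_def fun_eq_iff)
  \<comment> \<open>\<open>N n\<close> is the \<open>n\<close>-th cosyzygy. It starts with a copy of
    \<open>X\<close> made of constant functions, so all of them share the resolution type.\<close>
  define N where "N = rec_nat (push_module X ?i) (\<lambda>_. cosyzygy R)"
  have N_simps: "N 0 = push_module X ?i" "N (Suc n) = cosyzygy R (N n)" for n by (simp_all add: N_def)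
  note code = resolution_type_code[where ?'a = 'a and ?'m = 'm]
  have cos: "module R (cosyzygy R Y)" "cosyzygy_map R Y \<in> module_hom R (inj_hull R Y) (cosyzygy R Y)"
    "carrier (cosyzygy R Y) = cosyzygy_map R Y ` carrier (inj_hull R Y)"
    "\<And>x. x \<in> carrier (inj_hull R Y) \<Longrightarrow>
      cosyzygy_map R Y x = \<zero>\<^bsub>cosyzygy R Y\<^esub> \<longleftrightarrow> x \<in> inj_hull_emb R Y ` carrier Y"
    if Y: "module R Y" for Y :: "('a, ('a, 'm) resolution_type) module"
  proof -
    note h = inj_hull_module[OF Y code]
    note s = submodule_image[OF Y h inj_hull_emb[OF Y code]]
    note c = coset_rep_eq_iff[OF h s]
    show "module R (cosyzygy R Y)" "cosyzygy_map R Y \<in> module_hom R (inj_hull R Y) (cosyzygy R Y)"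
      "carrier (cosyzygy R Y) = cosyzygy_map R Y ` carrier (inj_hull R Y)"
      "\<And>x. x \<in> carrier (inj_hull R Y) \<Longrightarrow>
        cosyzygy_map R Y x = \<zero>\<^bsub>cosyzygy R Y\<^esub> \<longleftrightarrow> x \<in> inj_hull_emb R Y ` carrier Y"
      unfolding cosyzygy_def cosyzygy_map_def
      using push_module_module[OF h s c] push_module_hom[OF h s c] push_module_kernel[OF h s c]
      by (simp_all add: push_module_def Let_def)
  qed
  have N: "module R (N n)" for n
    by (induction n) (simp_all add: N_simps push_inj_module[OF X i] cos)
  define I where "I n = inj_hull R (N n)" for n
  note hull = inj_hull_module[OF N code, folded I_def] inj_hull_emb[OF N code, folded I_def]
    inj_hull_emb_inj[OF N code]
  note cosN = cos(2-4)[OF N, folded N_simps I_def]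
  define d where "d n x = inj_hull_emb R (N (Suc n)) (cosyzygy_map R (N n) x)" for n x
  define e where "e x = inj_hull_emb R (push_module X ?i) (?i x)" for x
  have d: "d n \<in> module_hom R (I n) (I (Suc n))" for n
    unfolding d_def[abs_def] using cosN(1) hull(2) by (rule hom_comp)
  \<comment> \<open>The next cosyzygy is embedded injectively, so the kernel of \<open>d n\<close>
    is that of the projection. This one description gives exactness at the augmentation and in every
    later degree.\<close>
  have kd: "{x \<in> carrier (I n). d n x = \<zero>\<^bsub>I (Suc n)\<^esub>} = inj_hull_emb R (N n) ` carrier (N n)" for n
  proof -
    have "d n x = \<zero>\<^bsub>I (Suc n)\<^esub> \<longleftrightarrow> cosyzygy_map R (N n) x = \<zero>\<^bsub>N (Suc n)\<^esub>" if "x \<in> carrier (I n)" for x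
      using hom_zero[OF N hull(1) hull(2)[of "Suc n"]] inj_on_eq_iff[OF hull(3)[of "Suc n"]]
        hom_closed[OF cosN(1) that] submodule_zero[OF module.carrier_is_submodule[OF N]] unfolding
            d_def by metis
    then show ?thesis using cosN(3)[of _ n] hom_closed[OF hull(2)[of n]] by auto
  qed
  have "injective_resolution R X e I d"
    unfolding injective_resolution_def
  proof (intro conjI allI)
    show "injective_module R (I n)" for n
      using hull(1) by (rule injective_moduleI) (auto simp: I_def intro: inj_hull_ext_into[OF N code])
    show "d n \<in> module_hom R (I n) (I (Suc n))" for n by (rule d)
    show "e \<in> module_hom R X (I 0)"
      unfolding e_def[abs_def]
      by (rule hom_comp[OF push_inj_hom[OF X i] hull(2)[of 0, unfolded N_simps]])
    show "inj_on e (carrier X)"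
      using comp_inj_on[of ?i "carrier X" "inj_hull_emb R (push_module X ?i)", OF i] hull(3)[of 0]
      by (simp add: e_def[abs_def] comp_def N_simps push_module_def Let_def)
    show "e ` carrier X = {x \<in> carrier (I 0). d 0 x = \<zero>\<^bsub>I 1\<^esub>}"
      using kd[of 0] by (auto simp: e_def[abs_def] N_simps push_module_def Let_def)
    show "d n ` carrier (I n) = {x \<in> carrier (I (Suc n)). d (Suc n) x = \<zero>\<^bsub>I (Suc (Suc n))\<^esub>}" for n
      unfolding kd cosN(2) by (simp add: d_def[abs_def] image_image)
  qed
  then show ?thesis by blast
qed

lemma chosen_resolution_injective:
  fixes X :: "('a, 'm) module"
  assumes "module R X" "chosen_resolution R X = (I, d)"
  shows "\<exists>e. injective_resolution R X e I d"
proof -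
  let ?P = "\<lambda>(I :: nat \<Rightarrow> ('a, ('a, 'm) resolution_type) module, d). \<exists>e. injective_resolution R X e I d"
  have "\<exists>Id. ?P Id" using injective_resolution_exists[OF assms(1)] by (simp add: split_paired_Ex) blast
  then have "?P (chosen_resolution R X)" unfolding chosen_resolution_def by (rule someI_ex)
  then show ?thesis using assms(2) by simp
qed


section \<open>The torsion submodule with respect to an ideal\<close>

lemma ideal_power_ideal:
  assumes "cring R" "ideal \<aa> R"
  shows "ideal (\<aa> [^]\<^bsub>ideals_set R\<^esub> (n::nat)) R"
proof (induction n)
  case 0
  then show ?case using assms(1) by (simp add: ideals_set_def ring.oneideal cring.axioms)
next
  case (Suc n)
  then show ?case using assms by (simp add: ideals_set_def ring.ideal_prod_is_ideal cring.axioms)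
qed

lemma ideal_power_antimono:
  assumes R: "cring R" and a: "ideal \<aa> R" and "n \<le> (m::nat)"
  shows "\<aa> [^]\<^bsub>ideals_set R\<^esub> m \<subseteq> \<aa> [^]\<^bsub>ideals_set R\<^esub> n"
proof (rule lift_Suc_antimono_le[OF _ assms(3)])
  fix n
  have "\<aa> [^]\<^bsub>ideals_set R\<^esub> Suc n = ideal_prod R (\<aa> [^]\<^bsub>ideals_set R\<^esub> n) \<aa>" by (simp add: ideals_set_def)
  then show "\<aa> [^]\<^bsub>ideals_set R\<^esub> Suc n \<subseteq> \<aa> [^]\<^bsub>ideals_set R\<^esub> n"
    using ring.ideal_prod_inter[OF cring.axioms(1)[OF R] ideal_power_ideal[OF R a, of n] a] by simp
qed

lemma torsion_subset: "x \<in> carrier (torsion R \<aa> M) \<Longrightarrow> x \<in> carrier M"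
  by (simp add: torsion_def)

lemma torsion_common_power:
  assumes R: "cring R" and a: "ideal \<aa> R"
    and x: "x \<in> carrier (torsion R \<aa> M)" and y: "y \<in> carrier (torsion R \<aa> N)"
  shows "\<exists>n::nat. (\<forall>a\<in>\<aa> [^]\<^bsub>ideals_set R\<^esub> n. a \<odot>\<^bsub>M\<^esub> x = \<zero>\<^bsub>M\<^esub> \<and> a \<odot>\<^bsub>N\<^esub> y = \<zero>\<^bsub>N\<^esub>)"
proof -
  obtain n m :: nat where nm: "\<forall>a\<in>\<aa> [^]\<^bsub>ideals_set R\<^esub> n. a \<odot>\<^bsub>M\<^esub> x = \<zero>\<^bsub>M\<^esub>"
    "\<forall>a\<in>\<aa> [^]\<^bsub>ideals_set R\<^esub> m. a \<odot>\<^bsub>N\<^esub> y = \<zero>\<^bsub>N\<^esub>"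
    using x y by (auto simp: torsion_def)
  show ?thesis
    using nm ideal_power_antimono[OF R a max.cobounded1[of n m]]
      ideal_power_antimono[OF R a max.cobounded2[of m n]] by (intro exI[of _ "max n m"]) blast
qed

lemma torsion_hom:
  assumes M: "module R M" and N: "module R N" and a: "ideal \<aa> R" and f: "f \<in> module_hom R M N"
    and x: "x \<in> carrier (torsion R \<aa> M)"
  shows "f x \<in> carrier (torsion R \<aa> N)"
proof -
  obtain n :: nat where n: "\<forall>a\<in>\<aa> [^]\<^bsub>ideals_set R\<^esub> n. a \<odot>\<^bsub>M\<^esub> x = \<zero>\<^bsub>M\<^esub>" and xM: "x \<in> carrier M"
    using x by (auto simp: torsion_def)
  have "a \<in> carrier R" if "a \<in> \<aa> [^]\<^bsub>ideals_set R\<^esub> n" for a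
    using ideal_power_ideal[OF module_cring[OF M] a, of n] that
    by (meson additive_subgroup.a_Hcarr ideal.axioms(1))
  then have "\<forall>a\<in>\<aa> [^]\<^bsub>ideals_set R\<^esub> n. a \<odot>\<^bsub>N\<^esub> f x = \<zero>\<^bsub>N\<^esub>"
    using n xM hom_zero[OF M N f] by (simp add: hom_smult[OF f, symmetric])
  then show ?thesis using hom_closed[OF f xM] by (auto simp: torsion_def)
qed

lemma torsion_submodule:
  assumes M: "module R M" and a: "ideal \<aa> R"
  shows "submodule (carrier (torsion R \<aa> M)) R M"
proof -
  interpret M': abelian_group M using M by (rule module_abelian_group)
  interpret M: module R M by (rule M)
  have pc: "b \<in> carrier R" if "b \<in> \<aa> [^]\<^bsub>ideals_set R\<^esub> (n::nat)" for b n
    using ideal_power_ideal[OF module_cring[OF M] a, of n] that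
    by (meson additive_subgroup.a_Hcarr ideal.axioms(1))
  show ?thesis
  proof (rule M.submoduleI)
    show "\<zero>\<^bsub>M\<^esub> \<in> carrier (torsion R \<aa> M)" using pc by (auto simp: torsion_def)
  next
    fix x assume x: "x \<in> carrier (torsion R \<aa> M)"
    show "\<ominus>\<^bsub>M\<^esub> x \<in> carrier (torsion R \<aa> M)"
    proof (rule torsion_hom[OF M M a _ x])
      show "(\<lambda>x. \<ominus>\<^bsub>M\<^esub> x) \<in> module_hom R M M"
        by (rule module_homI) (auto simp: M'.minus_add M.smult_r_minus)
    qed
    show "b \<odot>\<^bsub>M\<^esub> x \<in> carrier (torsion R \<aa> M)" if "b \<in> carrier R" for b
      using that by (intro torsion_hom[OF M M a _ x] module_homI)
        (auto simp: M.smult_r_distr M.smult_assoc1[symmetric] M.R.m_comm)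
    fix y assume y: "y \<in> carrier (torsion R \<aa> M)"
    obtain n :: nat where n: "\<forall>a\<in>\<aa> [^]\<^bsub>ideals_set R\<^esub> n. a \<odot>\<^bsub>M\<^esub> x = \<zero>\<^bsub>M\<^esub> \<and> a \<odot>\<^bsub>M\<^esub> y = \<zero>\<^bsub>M\<^esub>"
      using torsion_common_power[OF module_cring[OF M] a x y] by blast
    then show "x \<oplus>\<^bsub>M\<^esub> y \<in> carrier (torsion R \<aa> M)"
      using torsion_subset[OF x] torsion_subset[OF y] pc
      by (auto simp: torsion_def M.smult_r_distr intro!: exI[of _ n])
  qed (auto dest: torsion_subset)
qed

text \<open>The \<open>i\<close>-th cohomology of the torsion complex is zero. Phrased with
  elements, this can be compared between resolutions on different types without handling
  quotients.\<close>

definition vanishing :: "('a, 'r) ring_scheme \<Rightarrow> 'a set \<Rightarrow> (nat \<Rightarrow> ('a, 'u) module) \<Rightarrow> (nat \<Rightarrow> 'u \<Rightarrow> 'u)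
    \<Rightarrow> nat \<Rightarrow> bool" where
  "vanishing R \<aa> I d i \<longleftrightarrow> (\<forall>x\<in>carrier (torsion R \<aa> (I i)). d i x = \<zero>\<^bsub>I (Suc i)\<^esub> \<longrightarrow>
    (case i of 0 \<Rightarrow> x = \<zero>\<^bsub>I 0\<^esub> | Suc k \<Rightarrow> x \<in> d k ` carrier (torsion R \<aa> (I k))))"

abbreviation (input) lc_zero :: "('a, 'r) ring_scheme \<Rightarrow> 'a set \<Rightarrow> int \<Rightarrow> ('a, 'm) module \<Rightarrow> bool" where
  "lc_zero R \<aa> i X \<equiv> zero_module (local_cohomology R \<aa> i X)"

section \<open>Vanishing of local cohomology in terms of elements\<close>

lemma zero_module_quot:
  assumes Q: "module R Q" and N: "submodule N R Q"
  shows "zero_module (quot_module Q N) \<longleftrightarrow> carrier Q \<subseteq> N"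
proof -
  have z: "\<zero>\<^bsub>Q\<^esub> \<in> carrier Q" using submodule_zero[OF module.carrier_is_submodule[OF Q]] .
  have "zero_module (quot_module Q N) \<longleftrightarrow> (\<forall>x\<in>carrier Q. N +>\<^bsub>Q\<^esub> x = \<zero>\<^bsub>quot_module Q N\<^esub>)"
    unfolding zero_module_def quot_module_carrier[OF Q N] using z by blast
  then show ?thesis using quot_module_kernel[OF Q N] by blast
qed

lemma submodule_restrict:
  assumes M: "module R M" and H: "submodule H R M" and N: "submodule N R M" "N \<subseteq> H"
  shows "submodule N R (M\<lparr>carrier := H\<rparr>)"
  using submodule_module[OF M N(1)] N(2)
  by (intro module.module_incl_imp_submodule[OF submodule_module[OF M H]]) auto

lemma submodule_Int:
  assumes M: "module R M" and H: "submodule H R M" and N: "submodule N R M"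
  shows "submodule (H \<inter> N) R M"
  using submodule_subset[OF H] submodule_zero[OF H] submodule_zero[OF N] submodule_add[OF H]
      submodule_add[OF N]
    submodule_uminus[OF H] submodule_uminus[OF N] submodule_smult[OF H] submodule_smult[OF N]
  by (intro module.submoduleI[OF M]) auto

lemma submodule_image_sub:
  assumes M: "module R M" and N: "module R N" and f: "f \<in> module_hom R M N" and H: "submodule H R M"
  shows "submodule (f ` H) R N"
proof -
  have "f \<in> module_hom R (M\<lparr>carrier := H\<rparr>) N"
    using f submodule_subset[OF H] by (auto simp: module_hom_def)
  from submodule_image[OF submodule_module[OF M H] N this] show ?thesis by simp
qed

lemma local_cohomology_zero_iff:
  fixes X :: "('a, 'm) module"
  assumes X: "module R X" and a: "ideal \<aa> R" and ch: "chosen_resolution R X = (I, d)"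
  shows "lc_zero R \<aa> (int i) X \<longleftrightarrow> vanishing R \<aa> I d i"
proof -
  obtain e where res: "injective_resolution R X e I d" using chosen_resolution_injective[OF X ch]
      by blast
  have I: "module R (I n)" and d: "d n \<in> module_hom R (I n) (I (Suc n))"
    and dd: "d n ` carrier (I n) = {x \<in> carrier (I (Suc n)). d (Suc n) x = \<zero>\<^bsub>I (Suc (Suc n))\<^esub>}" for n
    using res by (auto simp: injective_resolution_def injective_module_def)
  let ?T = "\<lambda>n. carrier (torsion R \<aa> (I n))"
  define K where "K = {x \<in> ?T i. d i x = \<zero>\<^bsub>I (Suc i)\<^esub>}"
  define N where "N = (case i of 0 \<Rightarrow> {\<zero>\<^bsub>I 0\<^esub>} | Suc k \<Rightarrow> d k ` ?T k)"
  have "K = ?T i \<inter> {x \<in> carrier (I i). d i x = \<zero>\<^bsub>I (Suc i)\<^esub>}"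
    by (auto simp: K_def torsion_def)
  then have K: "submodule K R (I i)"
    using submodule_Int[OF I torsion_submodule[OF I a] submodule_kernel[OF I I d]] by simp
  have N: "submodule N R (I i)" "N \<subseteq> K"
  proof -
    show "submodule N R (I i)"
    proof (cases i)
      case (Suc k)
      then show ?thesis using submodule_image_sub[OF I I d torsion_submodule[OF I a]] by (simp
          add: N_def)
    qed (simp add: N_def submodule_zeroset[OF I])
    show "N \<subseteq> K"
    proof (cases i)
      case 0
      then show ?thesis using submodule_zero[OF K] by (simp add: N_def)
    next
      case (Suc k)
      have "d k x \<in> K" if "x \<in> ?T k" for x
        using torsion_hom[OF I I a d that] dd[of k] torsion_subset[OF that] Suc by (auto simp: K_def)
      then show ?thesis using Suc by (auto simp: N_def)
    qed
  qed
  have "local_cohomology R \<aa> (int i) X = quot_module ((I i)\<lparr>carrier := K\<rparr>) N"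
    by (simp add: local_cohomology_def ch cohomology_def K_def N_def torsion_def cong: nat.case_cong)
  then show ?thesis
    using zero_module_quot[OF submodule_module[OF I K] submodule_restrict[OF I K N]]
    by (auto simp: vanishing_def K_def N_def subset_iff split: nat.splits)
qed

text \<open>Supplies degree \<open>-1\<close>, so that the long exact sequence can be stated with
  \<open>int i - 1\<close> at \<open>i = 0\<close> as well.\<close>

lemma local_cohomology_neg:
  fixes X :: "('a, 'm) module"
  assumes X: "module R X" and "i < 0"
  shows "lc_zero R \<aa> i X"
proof -
  obtain I d where ch: "chosen_resolution R X = (I, d)" by force
  obtain e where res: "injective_resolution R X e I d" using chosen_resolution_injective[OF X ch]
      by blast
  have I: "module R (I 0)" using res by (auto simp: injective_resolution_def injective_module_def)
  note s = submodule_zeroset[OF I]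
  have "local_cohomology R \<aa> i X = quot_module ((I 0)\<lparr>carrier := {\<zero>\<^bsub>I 0\<^esub>}\<rparr>) {\<zero>\<^bsub>I 0\<^esub>}"
    using assms(2) by (simp add: local_cohomology_def ch)
  then show ?thesis using zero_module_quot[OF submodule_module[OF I s] submodule_restrict[OF I s
      s]] by simp
qed

section \<open>Comparison of resolutions and the long exact sequence\<close>

text \<open>Records exactness without injectivity, since \<open>injective_module\<close> is bound to
  one type of test modules. Injectivity enters later as \<open>ext_into\<close>, for just those
  pairs of modules between which maps must be extended.\<close>

definition resolves ::
    "('a, 'r) ring_scheme \<Rightarrow> ('a, 'm) module \<Rightarrow> ('m \<Rightarrow> 'u) \<Rightarrow> (nat \<Rightarrow> ('a, 'u) module) \<Rightarrow> (nat \<Rightarrow> 'u \<Rightarrow>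
        'u) \<Rightarrow> bool" where
  "resolves R X e I d \<longleftrightarrow>
    (\<forall>n. module R (I n) \<and> d n \<in> module_hom R (I n) (I (Suc n))) \<and>
    e \<in> module_hom R X (I 0) \<and> inj_on e (carrier X) \<and>
    e ` carrier X = {x \<in> carrier (I 0). d 0 x = \<zero>\<^bsub>I (Suc 0)\<^esub>} \<and>
    (\<forall>n. d n ` carrier (I n) = {x \<in> carrier (I (Suc n)). d (Suc n) x = \<zero>\<^bsub>I (Suc (Suc n))\<^esub>})"

lemma injective_resolution_resolves: "injective_resolution R X e I d \<Longrightarrow> resolves R X e I d"
  by (auto simp: injective_resolution_def resolves_def injective_module_def)

lemma resolvesD:
  assumes "resolves R X e I d"
  shows "module R (I n)" "d n \<in> module_hom R (I n) (I (Suc n))" "e \<in> module_hom R X (I 0)"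
    "inj_on e (carrier X)"
    "x \<in> carrier X \<Longrightarrow> d 0 (e x) = \<zero>\<^bsub>I (Suc 0)\<^esub>"
    "y \<in> carrier (I 0) \<Longrightarrow> d 0 y = \<zero>\<^bsub>I (Suc 0)\<^esub> \<Longrightarrow> \<exists>x\<in>carrier X. y = e x"
    "z \<in> carrier (I n) \<Longrightarrow> d (Suc n) (d n z) = \<zero>\<^bsub>I (Suc (Suc n))\<^esub>"
    "w \<in> carrier (I (Suc n)) \<Longrightarrow> d (Suc n) w = \<zero>\<^bsub>I (Suc (Suc n))\<^esub> \<Longrightarrow> \<exists>z\<in>carrier (I n). w = d n z"
proof -
  have "d n ` carrier (I n) = {x \<in> carrier (I (Suc n)). d (Suc n) x = \<zero>\<^bsub>I (Suc (Suc n))\<^esub>}" for n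
    using assms unfolding resolves_def by blast
  then show "z \<in> carrier (I n) \<Longrightarrow> d (Suc n) (d n z) = \<zero>\<^bsub>I (Suc (Suc n))\<^esub>"
    "w \<in> carrier (I (Suc n)) \<Longrightarrow> d (Suc n) w = \<zero>\<^bsub>I (Suc (Suc n))\<^esub> \<Longrightarrow> \<exists>z\<in>carrier (I n). w = d n z"
    by blast+
qed (use assms in \<open>auto simp: resolves_def set_eq_iff\<close>)

lemma chain_map_exists:
  assumes X: "module R X" and I: "resolves R X e I d" and J: "resolves R X e' J d'"
    and ext: "\<And>n. ext_into R (J n) (I n)"
  obtains f where "\<And>n. f n \<in> module_hom R (I n) (J n)"
    "\<And>n x. x \<in> carrier (I n) \<Longrightarrow> f (Suc n) (d n x) = d' n (f n x)"
    "\<And>x. x \<in> carrier X \<Longrightarrow> f 0 (e x) = e' x"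
proof -
  note ID = resolvesD[OF I] and JD = resolvesD[OF J]
  \<comment> \<open>The middle clause makes \<open>d' n\<close> after \<open>f\<close> vanish on the
    kernel of \<open>d n\<close>, which is what the next map needs in order to factor.\<close>
  let ?P = "\<lambda>n f. f \<in> module_hom R (I n) (J n) \<and>
    (\<forall>x\<in>carrier (I n). d n x = \<zero>\<^bsub>I (Suc n)\<^esub> \<longrightarrow> d' n (f x) = \<zero>\<^bsub>J (Suc n)\<^esub>) \<and>
    (n = 0 \<longrightarrow> (\<forall>x\<in>carrier X. f (e x) = e' x))"
  let ?Q = "\<lambda>n f g. \<forall>x\<in>carrier (I n). g (d n x) = d' n (f x)"
  have "\<exists>f. \<forall>n. ?P n (f n) \<and> ?Q n (f n) (f (Suc n))"
  proof (rule dependent_nat_choice)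
    have "\<exists>f\<in>module_hom R (I 0) (J 0). \<forall>x\<in>carrier X. f (e x) = e' x"
    proof (rule ext_into_factor[OF X ID(1) JD(1) ID(3) JD(3) ext])
      fix x assume x: "x \<in> carrier X" "e x = \<zero>\<^bsub>I 0\<^esub>"
      have "x = \<zero>\<^bsub>X\<^esub>"
        using x hom_zero[OF X ID(1,3)] inj_onD[OF ID(4)] submodule_zero[OF
            module.carrier_is_submodule[OF X]]
        by metis
      then show "e' x = \<zero>\<^bsub>J 0\<^esub>" using hom_zero[OF X JD(1,3)] by simp
    qed
    then obtain f where f: "f \<in> module_hom R (I 0) (J 0)" "\<And>x. x \<in> carrier X \<Longrightarrow> f (e x) = e' x" by blast
    have "d' 0 (f x) = \<zero>\<^bsub>J (Suc 0)\<^esub>" if "x \<in> carrier (I 0)" "d 0 x = \<zero>\<^bsub>I (Suc 0)\<^esub>" for x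
      using ID(6)[OF that] f(2) JD(5) by auto
    then show "\<exists>f. ?P 0 f" using f by (intro exI[of _ f] conjI) auto
  next
    fix f n assume P: "?P n f"
    then have f: "f \<in> module_hom R (I n) (J n)" by blast
    have "\<exists>g\<in>module_hom R (I (Suc n)) (J (Suc n)). \<forall>x\<in>carrier (I n). g (d n x) = d' n (f x)"
      using P by (intro ext_into_factor[OF ID(1) ID(1) JD(1) ID(2) hom_comp[OF f JD(2)] ext]) blast
    then obtain g where g: "g \<in> module_hom R (I (Suc n)) (J (Suc n))" "\<forall>x\<in>carrier (I n). g (d n x)
        = d' n (f x)"
      by blast
    have "d' (Suc n) (g x) = \<zero>\<^bsub>J (Suc (Suc n))\<^esub>"
      if "x \<in> carrier (I (Suc n))" "d (Suc n) x = \<zero>\<^bsub>I (Suc (Suc n))\<^esub>" for x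
      using ID(8)[OF that] g(2) JD(7) hom_closed[OF f] by auto
    then show "\<exists>g. ?P (Suc n) g \<and> ?Q n f g" using g by (intro exI[of _ g] conjI) auto
  qed
  then obtain f where F: "\<forall>n. ?P n (f n) \<and> ?Q n (f n) (f (Suc n))" by (elim exE)
  show thesis
  proof (rule that)
    show "f n \<in> module_hom R (I n) (J n)" for n using F by simp
    show "f (Suc n) (d n x) = d' n (f n x)" if "x \<in> carrier (I n)" for n x using F that by simp
    show "f 0 (e x) = e' x" if "x \<in> carrier X" for x using spec[OF F, of 0] that by simp
  qed
qed

lemma null_homotopy:
  assumes X: "module R X" and I: "resolves R X e I d" and J: "resolves R Y e' J d'"
    and ext: "\<And>n. ext_into R (J n) (I (Suc n))"
    and f: "\<And>n. f n \<in> module_hom R (I n) (J n)"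
    and fd: "\<And>n x. x \<in> carrier (I n) \<Longrightarrow> f (Suc n) (d n x) = d' n (f n x)"
    and fe: "\<And>x. x \<in> carrier X \<Longrightarrow> f 0 (e x) = \<zero>\<^bsub>J 0\<^esub>"
  obtains h where "\<And>n. h n \<in> module_hom R (I (Suc n)) (J n)"
    "\<And>x. x \<in> carrier (I 0) \<Longrightarrow> h 0 (d 0 x) = f 0 x"
    "\<And>n x. x \<in> carrier (I (Suc n)) \<Longrightarrow> h (Suc n) (d (Suc n) x) = f (Suc n) x \<ominus>\<^bsub>J (Suc n)\<^esub> d' n (h n x)"
proof -
  note ID = resolvesD[OF I] and JD = resolvesD[OF J]
  \<comment> \<open>The middle clause says that \<open>f (Suc n)\<close> minus \<open>d' n\<close>
    after \<open>h\<close> kills the image of \<open>d n\<close>. By exactness this is the kernel of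
    \<open>d (Suc n)\<close>, so the next part of the homotopy exists.\<close>
  let ?P = "\<lambda>n h. h \<in> module_hom R (I (Suc n)) (J n) \<and>
    (\<forall>x\<in>carrier (I n). d' n (h (d n x)) = d' n (f n x)) \<and>
    (n = 0 \<longrightarrow> (\<forall>x\<in>carrier (I 0). h (d 0 x) = f 0 x))"
  let ?Q = "\<lambda>n h k. \<forall>x\<in>carrier (I (Suc n)). k (d (Suc n) x) = f (Suc n) x \<ominus>\<^bsub>J (Suc n)\<^esub> d' n (h x)"
  have "\<exists>h. \<forall>n. ?P n (h n) \<and> ?Q n (h n) (h (Suc n))"
  proof (rule dependent_nat_choice)
    have "\<exists>h\<in>module_hom R (I (Suc 0)) (J 0). \<forall>x\<in>carrier (I 0). h (d 0 x) = f 0 x"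
      using ID(6) fe by (intro ext_into_factor[OF ID(1) ID(1) JD(1) ID(2) f ext]) metis
    then show "\<exists>h. ?P 0 h" by auto
  next
    fix h n assume P: "?P n h"
    then have h: "h \<in> module_hom R (I (Suc n)) (J n)" by blast
    let ?g = "\<lambda>x. f (Suc n) x \<ominus>\<^bsub>J (Suc n)\<^esub> d' n (h x)"
    interpret J: abelian_group "J (Suc n)" by (rule module_abelian_group[OF JD(1)])
    interpret J2: abelian_group "J (Suc (Suc n))" by (rule module_abelian_group[OF JD(1)])
    have g: "?g \<in> module_hom R (I (Suc n)) (J (Suc n))"
      by (rule hom_diff[OF ID(1) JD(1) f hom_comp[OF h JD(2)]])
    have "\<exists>k\<in>module_hom R (I (Suc (Suc n))) (J (Suc n)). \<forall>x\<in>carrier (I (Suc n)). k (d (Suc n) x) = ?g x"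
    proof (rule ext_into_factor[OF ID(1) ID(1) JD(1) ID(2) g ext])
      fix x assume "x \<in> carrier (I (Suc n))" "d (Suc n) x = \<zero>\<^bsub>I (Suc (Suc n))\<^esub>"
      then obtain z where "z \<in> carrier (I n)" "x = d n z" using ID(8) by blast
      then show "?g x = \<zero>\<^bsub>J (Suc n)\<^esub>"
        using P fd hom_closed[OF JD(2)] hom_closed[OF f] by (simp add: J.diff_eq_zero_iff)
    qed
    then obtain k where k: "k \<in> module_hom R (I (Suc (Suc n))) (J (Suc n))"
      "\<forall>x\<in>carrier (I (Suc n)). k (d (Suc n) x) = ?g x" by blast
    have "d' (Suc n) (k (d (Suc n) x)) = d' (Suc n) (f (Suc n) x)" if x: "x \<in> carrier (I (Suc n))" for x
      using k(2) x JD(7)[OF hom_closed[OF h x]] hom_closed[OF f x] hom_closed[OF JD(2)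
          hom_closed[OF h x]]
        hom_closed[OF JD(2) hom_closed[OF f x]]
      by (simp add: hom_minus[OF JD(1) JD(1) JD(2)] J2.diff_zero)
    then show "\<exists>k. ?P (Suc n) k \<and> ?Q n h k" using k by (intro exI[of _ k] conjI) auto
  qed
  then obtain h where H: "\<forall>n. ?P n (h n) \<and> ?Q n (h n) (h (Suc n))" by (elim exE)
  show thesis
  proof (rule that)
    show "h n \<in> module_hom R (I (Suc n)) (J n)" for n using H by simp
    show "h 0 (d 0 x) = f 0 x" if "x \<in> carrier (I 0)" for x using spec[OF H, of 0] that by simp
    show "h (Suc n) (d (Suc n) x) = f (Suc n) x \<ominus>\<^bsub>J (Suc n)\<^esub> d' n (h n x)"
      if "x \<in> carrier (I (Suc n))" for n x using H that by simp
  qed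
qed

text \<open>Linear maps preserve torsion, so the comparison maps and the homotopy restrict to the
  torsion complexes. The identity on the cohomology of \<open>J\<close> then factors through that of
  \<open>I\<close>.\<close>

lemma vanishing_transfer:
  assumes X: "module R X" and a: "ideal \<aa> R"
    and I: "resolves R X e I d" and J: "resolves R X e' J d'"
    and ext: "\<And>n. ext_into R (J n) (I n)" "\<And>n. ext_into R (I n) (J n)" "\<And>n. ext_into R (J n) (J (Suc n))"
    and van: "vanishing R \<aa> I d i"
  shows "vanishing R \<aa> J d' i"
proof -
  note ID = resolvesD[OF I] and JD = resolvesD[OF J]
  obtain g where g: "\<And>n. g n \<in> module_hom R (I n) (J n)"
    "\<And>n x. x \<in> carrier (I n) \<Longrightarrow> g (Suc n) (d n x) = d' n (g n x)"
    "\<And>x. x \<in> carrier X \<Longrightarrow> g 0 (e x) = e' x"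
    using chain_map_exists[OF X I J ext(1)] by blast
  obtain f where f: "\<And>n. f n \<in> module_hom R (J n) (I n)"
    "\<And>n x. x \<in> carrier (J n) \<Longrightarrow> f (Suc n) (d' n x) = d n (f n x)"
    "\<And>x. x \<in> carrier X \<Longrightarrow> f 0 (e' x) = e x"
    using chain_map_exists[OF X J I ext(2)] by blast
  have J': "abelian_group (J n)" for n by (rule module_abelian_group[OF JD(1)])
  have idh: "(\<lambda>x. x) \<in> module_hom R (J n) (J n)" for n by (rule module_homI) auto
  \<comment> \<open>The difference between the composite of the two comparison maps and the identity
    is a chain map that vanishes on the augmentation, hence null homotopic.\<close>
  let ?k = "\<lambda>n x. g n (f n x) \<ominus>\<^bsub>J n\<^esub> x"
  have k: "?k n \<in> module_hom R (J n) (J n)" for n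
    by (rule hom_diff[OF JD(1) JD(1) hom_comp[OF f(1) g(1)] idh])
  have kd: "?k (Suc n) (d' n x) = d' n (?k n x)" if "x \<in> carrier (J n)" for n x
    using that hom_closed[OF f(1) that] hom_closed[OF g(1) hom_closed[OF f(1) that]]
    by (simp add: f g hom_minus[OF JD(1) JD(1) JD(2)])
  have ke: "?k 0 (e' x) = \<zero>\<^bsub>J 0\<^esub>" if "x \<in> carrier X" for x
    using that hom_closed[OF JD(3) that] by (simp add: f g abelian_group.diff_eq_zero_iff[OF J'])
  obtain h where h: "\<And>n. h n \<in> module_hom R (J (Suc n)) (J n)"
    "\<And>x. x \<in> carrier (J 0) \<Longrightarrow> h 0 (d' 0 x) = ?k 0 x"
    "\<And>n x. x \<in> carrier (J (Suc n)) \<Longrightarrow> h (Suc n) (d' (Suc n) x) = ?k (Suc n) x \<ominus>\<^bsub>J (Suc n)\<^esub> d' n (h n x)"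
    by (rule null_homotopy[OF X J J ext(3), of ?k])
      (rule k, rule kd, assumption, rule ke, assumption, rule that, assumption+)
  note T = torsion_hom[OF _ _ a]
  let ?TI = "\<lambda>n. carrier (torsion R \<aa> (I n))" and ?TJ = "\<lambda>n. carrier (torsion R \<aa> (J n))"
  show ?thesis unfolding vanishing_def
  proof (intro ballI impI)
    fix x assume x: "x \<in> ?TJ i" "d' i x = \<zero>\<^bsub>J (Suc i)\<^esub>"
    have xJ: "x \<in> carrier (J i)" using x(1) by (rule torsion_subset)
    have fx: "f i x \<in> ?TI i" "d i (f i x) = \<zero>\<^bsub>I (Suc i)\<^esub>"
      using T[OF JD(1) ID(1) f(1) x(1)] f(2)[OF xJ] x(2) hom_zero[OF JD(1) ID(1) f(1)] by auto
    show "case i of 0 \<Rightarrow> x = \<zero>\<^bsub>J 0\<^esub> | Suc k \<Rightarrow> x \<in> d' k ` ?TJ k"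
    proof (cases i)
      case 0
      have "f 0 x = \<zero>\<^bsub>I 0\<^esub>" using van fx 0 by (auto simp: vanishing_def)
      then have "g 0 (f 0 x) = \<zero>\<^bsub>J 0\<^esub>" using hom_zero[OF ID(1) JD(1) g(1)] by simp
      moreover have "?k 0 x = \<zero>\<^bsub>J 0\<^esub>" using h(2)[of x] x xJ 0 hom_zero[OF JD(1) JD(1) h(1)] by simp
      ultimately show ?thesis
        using 0 xJ abelian_group.diff_eq_zero_iff[OF J', of "\<zero>\<^bsub>J 0\<^esub>" 0 x]
          submodule_zero[OF module.carrier_is_submodule[OF JD(1)]] by auto
    next
      case (Suc k)
      interpret Jk: abelian_group "J k" by (rule J')
      interpret Ji: abelian_group "J (Suc k)" by (rule J')
      have xJ': "x \<in> carrier (J (Suc k))" using xJ Suc by simp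
      obtain y where y: "y \<in> ?TI k" "f (Suc k) x = d k y"
        using van fx Suc by (auto simp: vanishing_def)
      have yI: "y \<in> carrier (I k)" using y(1) by (rule torsion_subset)
      have hx: "h k x \<in> ?TJ k" using T[OF JD(1) JD(1) h(1)] x(1) Suc by blast
      have gy: "g k y \<in> ?TJ k" using T[OF ID(1) JD(1) g(1)] y(1) by blast
      have c: "h k x \<in> carrier (J k)" "g k y \<in> carrier (J k)" "d' k (h k x) \<in> carrier (J (Suc k))"
        "d' k (g k y) \<in> carrier (J (Suc k))"
        using torsion_subset[OF hx] torsion_subset[OF gy] hom_closed[OF JD(2)] by auto
      \<comment> \<open>On a cocycle the term with \<open>h (Suc k)\<close> drops out, leaving
        \<open>g (f x) - x = d' (h x)\<close>. With \<open>f x = d y\<close> this is solved for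
        \<open>x\<close> as \<open>d' (g y - h x)\<close>.\<close>
      have "?k (Suc k) x \<ominus>\<^bsub>J (Suc k)\<^esub> d' k (h k x) = \<zero>\<^bsub>J (Suc k)\<^esub>"
        using h(3)[OF xJ'] x(2) Suc hom_zero[OF JD(1) JD(1) h(1)] by simp
      then have "d' k (g k y) \<ominus>\<^bsub>J (Suc k)\<^esub> x = d' k (h k x)"
        using c xJ' by (simp add: y(2) g(2)[OF yI] Ji.diff_eq_zero_iff)
      then have "d' k (g k y) = d' k (h k x) \<oplus>\<^bsub>J (Suc k)\<^esub> x"
        using c xJ' Ji.diff_add_eq[of "d' k (g k y)" x] by simp
      then have "x = d' k (g k y) \<ominus>\<^bsub>J (Suc k)\<^esub> d' k (h k x)"
        using c xJ' by (simp add: a_minus_def Ji.a_ac Ji.r_neg1 Ji.r_neg2 Ji.r_neg)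
      also have "\<dots> = d' k (g k y \<ominus>\<^bsub>J k\<^esub> h k x)" using c by (simp add: hom_minus[OF JD(1) JD(1) JD(2)])
      finally show ?thesis
        using Suc gy submodule_add[OF torsion_submodule[OF JD(1) a] gy
            submodule_uminus[OF torsion_submodule[OF JD(1) a] hx]] by (auto simp: a_minus_def)
    qed
  qed
qed

section \<open>Products, the horseshoe resolution and the long exact sequence\<close>

definition prod_module :: "('a, 'x) module \<Rightarrow> ('a, 'y) module \<Rightarrow> ('a, 'x \<times> 'y) module" where
  "prod_module X Y = \<lparr>carrier = carrier X \<times> carrier Y, monoid.mult = undefined, one = undefined,
     zero = (\<zero>\<^bsub>X\<^esub>, \<zero>\<^bsub>Y\<^esub>), add = (\<lambda>(x, y) (x', y'). (x \<oplus>\<^bsub>X\<^esub> x', y \<oplus>\<^bsub>Y\<^esub> y')),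
     smult = (\<lambda>a (x, y). (a \<odot>\<^bsub>X\<^esub> x, a \<odot>\<^bsub>Y\<^esub> y))\<rparr>"

lemma prod_module_simps:
  "carrier (prod_module X Y) = carrier X \<times> carrier Y"
  "\<zero>\<^bsub>prod_module X Y\<^esub> = (\<zero>\<^bsub>X\<^esub>, \<zero>\<^bsub>Y\<^esub>)"
  "(x, y) \<oplus>\<^bsub>prod_module X Y\<^esub> (x', y') = (x \<oplus>\<^bsub>X\<^esub> x', y \<oplus>\<^bsub>Y\<^esub> y')"
  "a \<odot>\<^bsub>prod_module X Y\<^esub> (x, y) = (a \<odot>\<^bsub>X\<^esub> x, a \<odot>\<^bsub>Y\<^esub> y)"
  by (simp_all add: prod_module_def)

lemma prod_module_module:
  assumes X: "module R X" and Y: "module R Y"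
  shows "module R (prod_module X Y)"
proof -
  interpret X': abelian_group X using X by (rule module_abelian_group)
  interpret Y': abelian_group Y using Y by (rule module_abelian_group)
  interpret X: module R X by (rule X)
  interpret Y: module R Y by (rule Y)
  show ?thesis
  proof (rule moduleI)
    show "abelian_group (prod_module X Y)"
    proof (rule abelian_groupI)
      fix z assume "z \<in> carrier (prod_module X Y)"
      then show "\<exists>w\<in>carrier (prod_module X Y). w \<oplus>\<^bsub>prod_module X Y\<^esub> z = \<zero>\<^bsub>prod_module X Y\<^esub>"
        by (intro bexI[of _ "(\<ominus>\<^bsub>X\<^esub> fst z, \<ominus>\<^bsub>Y\<^esub> snd z)"])
          (auto simp: prod_module_simps X'.l_neg Y'.l_neg)
    qed (auto simp: prod_module_simps X'.a_ac Y'.a_ac)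
  qed (auto simp: prod_module_simps module_cring[OF X] X.smult_l_distr X.smult_r_distr X.smult_assoc1
      Y.smult_l_distr Y.smult_r_distr Y.smult_assoc1)
qed

lemma prod_module_ext_into:
  assumes J: "ext_into R J P" and K: "ext_into R K P"
  shows "ext_into R (prod_module J K) P"
  unfolding ext_into_def
proof (intro allI impI)
  fix N g assume N: "submodule N R P" and g: "g \<in> module_hom R (P\<lparr>carrier := N\<rparr>) (prod_module J K)"
  have fs: "fst \<in> module_hom R (prod_module J K) J" "snd \<in> module_hom R (prod_module J K) K"
    by (auto simp: module_hom_def prod_module_simps)
  obtain h where h: "h \<in> module_hom R P J" "\<forall>x\<in>N. h x = fst (g x)"
    using J[unfolded ext_into_def, rule_format, OF N hom_comp[OF g fs(1)]] by blast
  obtain k where k: "k \<in> module_hom R P K" "\<forall>x\<in>N. k x = snd (g x)"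
    using K[unfolded ext_into_def, rule_format, OF N hom_comp[OF g fs(2)]] by blast
  have "(\<lambda>x. (h x, k x)) \<in> module_hom R P (prod_module J K)"
    using h(1) k(1) by (auto simp: module_hom_def prod_module_simps)
  then show "\<exists>h\<in>module_hom R P (prod_module J K). \<forall>x\<in>N. h x = g x"
    using h(2) k(2) by (intro bexI[of _ "\<lambda>x. (h x, k x)"]) auto
qed

lemma torsion_prod:
  assumes X: "module R X" and Y: "module R Y" and a: "ideal \<aa> R"
  shows "(x, y) \<in> carrier (torsion R \<aa> (prod_module X Y)) \<longleftrightarrow>
    x \<in> carrier (torsion R \<aa> X) \<and> y \<in> carrier (torsion R \<aa> Y)"
proof
  assume "x \<in> carrier (torsion R \<aa> X) \<and> y \<in> carrier (torsion R \<aa> Y)"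
  then show "(x, y) \<in> carrier (torsion R \<aa> (prod_module X Y))"
    using torsion_common_power[OF module_cring[OF X] a, of x X y Y]
    by (auto simp: torsion_def prod_module_simps)
qed (auto simp: torsion_def prod_module_simps)

locale short_exact =
  fixes R :: "('a, 'r) ring_scheme" and X :: "('a, 'x) module" and Y :: "('a, 'y) module"
    and W :: "('a, 'w) module" and \<iota> \<pi>
  assumes X: "module R X" and Y: "module R Y" and W: "module R W"
    and \<iota>: "\<iota> \<in> module_hom R X Y" and \<iota>_inj: "\<And>x. x \<in> carrier X \<Longrightarrow> \<iota> x = \<zero>\<^bsub>Y\<^esub> \<Longrightarrow> x = \<zero>\<^bsub>X\<^esub>"
    and \<pi>: "\<pi> \<in> module_hom R Y W" and \<pi>_surj: "\<And>w. w \<in> carrier W \<Longrightarrow> \<exists>y\<in>carrier Y. w = \<pi> y"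
    and \<pi>\<iota>: "\<And>x. x \<in> carrier X \<Longrightarrow> \<pi> (\<iota> x) = \<zero>\<^bsub>W\<^esub>"
    and exact: "\<And>y. y \<in> carrier Y \<Longrightarrow> \<pi> y = \<zero>\<^bsub>W\<^esub> \<Longrightarrow> \<exists>x\<in>carrier X. y = \<iota> x"
begin

text \<open>The twist \<open>t\<close> makes the middle resolution the extension of \<open>J\<close> by \<open>I\<close>; it anticommutes with the
  differentials.\<close>

lemma horseshoe:
  assumes I: "resolves R X e I d" and J: "resolves R W e' J d'"
    and ext: "ext_into R (I 0) Y" "\<And>n. ext_into R (I (Suc n)) (J n)"
  obtains t \<epsilon> where "\<And>n. t n \<in> module_hom R (J n) (I (Suc n))"
    "resolves R Y \<epsilon> (\<lambda>n. prod_module (I n) (J n)) (\<lambda>n (a, b). (d n a \<oplus>\<^bsub>I (Suc n)\<^esub> t n b, d' n b))"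
proof -
  note ID = resolvesD[OF I] and JD = resolvesD[OF J]
  have I': "abelian_group (I n)" and J': "abelian_group (J n)" for n
    using module_abelian_group ID(1) JD(1) by blast+
  interpret I0: abelian_group "I 0" by (rule I')
  interpret I1: abelian_group "I (Suc 0)" by (rule I')
  interpret X': abelian_group X by (rule module_abelian_group[OF X])
  interpret W': abelian_group W by (rule module_abelian_group[OF W])
  interpret Y': abelian_group Y by (rule module_abelian_group[OF Y])
  \<comment> \<open>The first component of the new augmentation: the embedding of \<open>X\<close>,
    extended along \<open>\<iota>\<close>.\<close>
  have "\<exists>\<sigma>\<in>module_hom R Y (I 0). \<forall>x\<in>carrier X. \<sigma> (\<iota> x) = e x"
    using \<iota>_inj hom_zero[OF X ID(1) ID(3)]
    by (intro ext_into_factor[OF X Y ID(1) \<iota> ID(3) ext(1)]) metis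
  then obtain \<sigma> where \<sigma>: "\<sigma> \<in> module_hom R Y (I 0)" "\<And>x. x \<in> carrier X \<Longrightarrow> \<sigma> (\<iota> x) = e x" by blast
  have e\<pi>: "(\<lambda>y. e' (\<pi> y)) \<in> module_hom R Y (J 0)" by (rule hom_comp[OF \<pi> JD(3)])
  have e\<pi>_ker: "\<pi> y = \<zero>\<^bsub>W\<^esub>" if "y \<in> carrier Y" "e' (\<pi> y) = \<zero>\<^bsub>J 0\<^esub>" for y
    using that hom_zero[OF W JD(1) JD(3)] inj_onD[OF JD(4)] hom_closed[OF \<pi>] by (metis W'.zero_closed)
  \<comment> \<open>The sign at \<open>n = 0\<close> places the augmentation of \<open>Y\<close> in
    the kernel of the first differential. The clause about cocycles allows the next twist to be
    defined by anticommutation on the image of \<open>d' n\<close>.\<close>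
  let ?P = "\<lambda>n t. t \<in> module_hom R (J n) (I (Suc n)) \<and>
    (\<forall>b\<in>carrier (J n). d' n b = \<zero>\<^bsub>J (Suc n)\<^esub> \<longrightarrow> d (Suc n) (t b) = \<zero>\<^bsub>I (Suc (Suc n))\<^esub>) \<and>
    (n = 0 \<longrightarrow> (\<forall>y\<in>carrier Y. t (e' (\<pi> y)) = \<ominus>\<^bsub>I (Suc 0)\<^esub> d 0 (\<sigma> y)))"
  let ?Q = "\<lambda>n t u. \<forall>b\<in>carrier (J n). u (d' n b) = \<ominus>\<^bsub>I (Suc (Suc n))\<^esub> d (Suc n) (t b)"
  have neg0: "\<ominus>\<^bsub>I n\<^esub> \<zero>\<^bsub>I n\<^esub> = \<zero>\<^bsub>I n\<^esub>" for n by (rule abelian_group.neg_zero[OF I'])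
  have "\<exists>t. \<forall>n. ?P n (t n) \<and> ?Q n (t n) (t (Suc n))"
  proof (rule dependent_nat_choice)
    have "\<exists>t\<in>module_hom R (J 0) (I (Suc 0)). \<forall>y\<in>carrier Y. t (e' (\<pi> y)) = \<ominus>\<^bsub>I (Suc 0)\<^esub> d 0 (\<sigma> y)"
    proof (rule ext_into_factor[OF Y JD(1) ID(1) e\<pi> hom_neg[OF Y ID(1) hom_comp[OF \<sigma>(1) ID(2)]] ext(2)])
      fix y assume "y \<in> carrier Y" "e' (\<pi> y) = \<zero>\<^bsub>J 0\<^esub>"
      then obtain x where "x \<in> carrier X" "y = \<iota> x" using e\<pi>_ker exact by blast
      then show "\<ominus>\<^bsub>I (Suc 0)\<^esub> d 0 (\<sigma> y) = \<zero>\<^bsub>I (Suc 0)\<^esub>" using \<sigma>(2) ID(5) neg0 by simp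
    qed
    then obtain t where t: "t \<in> module_hom R (J 0) (I (Suc 0))"
      "\<And>y. y \<in> carrier Y \<Longrightarrow> t (e' (\<pi> y)) = \<ominus>\<^bsub>I (Suc 0)\<^esub> d 0 (\<sigma> y)" by blast
    have "d (Suc 0) (t b) = \<zero>\<^bsub>I (Suc (Suc 0))\<^esub>" if b: "b \<in> carrier (J 0)" "d' 0 b = \<zero>\<^bsub>J (Suc 0)\<^esub>" for b
    proof -
      obtain w where w: "w \<in> carrier W" "b = e' w" using JD(6)[OF b] by blast
      obtain y where y: "y \<in> carrier Y" "w = \<pi> y" using \<pi>_surj[OF w(1)] by blast
      show ?thesis
        using w y t(2) ID(7)[OF hom_closed[OF \<sigma>(1) y(1)]] hom_closed[OF ID(2) hom_closed[OF \<sigma>(1) y(1)]]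
        by (simp add: hom_uminus[OF ID(1) ID(1) ID(2)] neg0)
    qed
    then show "\<exists>t. ?P 0 t" using t by (intro exI[of _ t] conjI) auto
  next
    fix t n assume P: "?P n t"
    then have t: "t \<in> module_hom R (J n) (I (Suc n))" by blast
    have "\<exists>u\<in>module_hom R (J (Suc n)) (I (Suc (Suc n))). \<forall>b\<in>carrier (J n). u (d' n b) = \<ominus>\<^bsub>I (Suc
        (Suc n))\<^esub> d (Suc n) (t b)"
      using P neg0
      by (intro ext_into_factor[OF JD(1) JD(1) ID(1) JD(2) hom_neg[OF JD(1) ID(1) hom_comp[OF t
          ID(2)]] ext(2)]) simp
    then obtain u where u: "u \<in> module_hom R (J (Suc n)) (I (Suc (Suc n)))"
      "\<forall>b\<in>carrier (J n). u (d' n b) = \<ominus>\<^bsub>I (Suc (Suc n))\<^esub> d (Suc n) (t b)" by blast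
    have "d (Suc (Suc n)) (u b) = \<zero>\<^bsub>I (Suc (Suc (Suc n)))\<^esub>"
      if b: "b \<in> carrier (J (Suc n))" "d' (Suc n) b = \<zero>\<^bsub>J (Suc (Suc n))\<^esub>" for b
    proof -
      obtain b' where b': "b' \<in> carrier (J n)" "b = d' n b'" using JD(8)[OF b] by blast
      show ?thesis
        using b' u(2) ID(7)[OF hom_closed[OF t b'(1)]] hom_closed[OF ID(2) hom_closed[OF t b'(1)]]
        by (simp add: hom_uminus[OF ID(1) ID(1) ID(2)] neg0)
    qed
    then show "\<exists>u. ?P (Suc n) u \<and> ?Q n t u" using u by (intro exI[of _ u] conjI) auto
  qed
  then obtain t where T: "\<forall>n. ?P n (t n) \<and> ?Q n (t n) (t (Suc n))" by (elim exE)
  have t: "t n \<in> module_hom R (J n) (I (Suc n))"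
    "y \<in> carrier Y \<Longrightarrow> t 0 (e' (\<pi> y)) = \<ominus>\<^bsub>I (Suc 0)\<^esub> d 0 (\<sigma> y)"
    "b \<in> carrier (J n) \<Longrightarrow> t (Suc n) (d' n b) = \<ominus>\<^bsub>I (Suc (Suc n))\<^esub> d (Suc n) (t n b)" for n y b
    using T spec[OF T, of 0] by simp_all
  let ?K = "\<lambda>n. prod_module (I n) (J n)"
  let ?D = "\<lambda>n (a, b). (d n a \<oplus>\<^bsub>I (Suc n)\<^esub> t n b, d' n b)"
  let ?\<epsilon> = "\<lambda>y. (\<sigma> y, e' (\<pi> y))"
  note K = prod_module_module[OF ID(1) JD(1)]
  note c = hom_closed[OF ID(2)] hom_closed[OF JD(2)] hom_closed[OF t(1)]
  have D: "?D n \<in> module_hom R (?K n) (?K (Suc n))" for n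
  proof -
    interpret In: abelian_group "I (Suc n)" by (rule I')
    interpret Im: module R "I (Suc n)" by (rule ID(1))
    show ?thesis
      by (rule module_homI) (auto simp: prod_module_simps c hom_add[OF ID(2)] hom_add[OF JD(2)]
          hom_add[OF t(1)]
        hom_smult[OF ID(2)] hom_smult[OF JD(2)] hom_smult[OF t(1)] In.a_ac Im.smult_r_distr)
  qed
  have \<epsilon>: "?\<epsilon> \<in> module_hom R Y (?K 0)"
    using \<sigma>(1) e\<pi> by (auto simp: module_hom_def prod_module_simps)
  have "resolves R Y ?\<epsilon> ?K ?D"
    unfolding resolves_def
  proof (intro conjI allI)
    show "inj_on ?\<epsilon> (carrier Y)"
    proof (rule hom_inj_onI[OF Y K \<epsilon>])
      fix y assume y: "y \<in> carrier Y" "?\<epsilon> y = \<zero>\<^bsub>?K 0\<^esub>"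
      then obtain x where x: "x \<in> carrier X" "y = \<iota> x" using e\<pi>_ker exact by (auto simp:
          prod_module_simps)
      then have "e x = \<zero>\<^bsub>I 0\<^esub>" using y \<sigma>(2) by (simp add: prod_module_simps)
      then have "x = \<zero>\<^bsub>X\<^esub>" using x hom_zero[OF X ID(1) ID(3)] inj_onD[OF ID(4)] by (metis X'.zero_closed)
      then show "y = \<zero>\<^bsub>Y\<^esub>" using x hom_zero[OF X Y \<iota>] by simp
    qed
    show "?\<epsilon> ` carrier Y = {x \<in> carrier (?K 0). ?D 0 x = \<zero>\<^bsub>?K (Suc 0)\<^esub>}"
    proof (intro equalityI subsetI)
      fix z assume "z \<in> ?\<epsilon> ` carrier Y"
      then obtain y where "y \<in> carrier Y" "z = ?\<epsilon> y" by blast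
      then show "z \<in> {x \<in> carrier (?K 0). ?D 0 x = \<zero>\<^bsub>?K (Suc 0)\<^esub>}"
        using hom_closed[OF \<epsilon>] t(2) c(1)[OF hom_closed[OF \<sigma>(1)]] JD(5) hom_closed[OF \<pi>]
        by (auto simp: prod_module_simps I1.r_neg)
    next
      fix z assume "z \<in> {x \<in> carrier (?K 0). ?D 0 x = \<zero>\<^bsub>?K (Suc 0)\<^esub>}"
      then obtain a b where z: "z = (a, b)" "a \<in> carrier (I 0)" "b \<in> carrier (J 0)"
        "d 0 a \<oplus>\<^bsub>I (Suc 0)\<^esub> t 0 b = \<zero>\<^bsub>I (Suc 0)\<^esub>" "d' 0 b = \<zero>\<^bsub>J (Suc 0)\<^esub>"
        by (auto simp: prod_module_simps)
      obtain w where w: "w \<in> carrier W" "b = e' w" using JD(6) z by blast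
      obtain y where y: "y \<in> carrier Y" "w = \<pi> y" using \<pi>_surj[OF w(1)] by blast
      have \<sigma>y: "\<sigma> y \<in> carrier (I 0)" by (rule hom_closed[OF \<sigma>(1) y(1)])
      \<comment> \<open>Once the second component is lifted to \<open>y\<close>, the first differs
        from \<open>\<sigma> y\<close> by a cocycle, hence by an element coming from
        \<open>X\<close>, which corrects \<open>y\<close>.\<close>
      have "d 0 (a \<ominus>\<^bsub>I 0\<^esub> \<sigma> y) = \<zero>\<^bsub>I (Suc 0)\<^esub>"
        using z(4) t(2)[OF y(1)] w y unfolding hom_minus[OF ID(1) ID(1) ID(2) z(2) \<sigma>y] by (simp
            add: a_minus_def)
      then obtain x where x: "x \<in> carrier X" "a \<ominus>\<^bsub>I 0\<^esub> \<sigma> y = e x" using ID(6) z \<sigma>y by blast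
      have \<iota>x: "\<iota> x \<in> carrier Y" by (rule hom_closed[OF \<iota> x(1)])
      have "a = e x \<oplus>\<^bsub>I 0\<^esub> \<sigma> y" using I0.diff_add_eq[OF z(2) \<sigma>y] x(2) by simp
      then have "\<sigma> (\<iota> x \<oplus>\<^bsub>Y\<^esub> y) = a" using x y \<iota>x by (simp add: hom_add[OF \<sigma>(1)] \<sigma>(2))
      moreover have "e' (\<pi> (\<iota> x \<oplus>\<^bsub>Y\<^esub> y)) = b"
        using x y \<iota>x w hom_closed[OF \<pi>] by (simp add: hom_add[OF \<pi>] \<pi>\<iota>)
      ultimately show "z \<in> ?\<epsilon> ` carrier Y" using z(1) \<iota>x y(1) by (intro image_eqI[of _ _ "\<iota> x \<oplus>\<^bsub>Y\<^esub>
          y"]) auto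
    qed
    fix n
    interpret In: abelian_group "I (Suc n)" by (rule I')
    interpret I2: abelian_group "I (Suc (Suc n))" by (rule I')
    show "?D n ` carrier (?K n) = {x \<in> carrier (?K (Suc n)). ?D (Suc n) x = \<zero>\<^bsub>?K (Suc (Suc n))\<^esub>}"
    proof (intro equalityI subsetI)
      fix z assume "z \<in> ?D n ` carrier (?K n)"
      then obtain a b where "a \<in> carrier (I n)" "b \<in> carrier (J n)" "z = (d n a \<oplus>\<^bsub>I (Suc n)\<^esub> t n b,
          d' n b)"
        by (auto simp: prod_module_simps)
      then show "z \<in> {x \<in> carrier (?K (Suc n)). ?D (Suc n) x = \<zero>\<^bsub>?K (Suc (Suc n))\<^esub>}"
        by (simp add: prod_module_simps c JD(7) hom_add[OF ID(2)] ID(7) t(3) I2.r_neg)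
    next
      fix z assume "z \<in> {x \<in> carrier (?K (Suc n)). ?D (Suc n) x = \<zero>\<^bsub>?K (Suc (Suc n))\<^esub>}"
      then obtain a b where z: "z = (a, b)" "a \<in> carrier (I (Suc n))" "b \<in> carrier (J (Suc n))"
        "d (Suc n) a \<oplus>\<^bsub>I (Suc (Suc n))\<^esub> t (Suc n) b = \<zero>\<^bsub>I (Suc (Suc n))\<^esub>" "d' (Suc n) b = \<zero>\<^bsub>J (Suc (Suc n))\<^esub>"
        by (auto simp: prod_module_simps)
      obtain b' where b': "b' \<in> carrier (J n)" "b = d' n b'" using JD(8) z by blast
      \<comment> \<open>Subtracting \<open>t n b'\<close> turns the first component into a cocycle
        of \<open>I\<close>, where exactness is known.\<close>
      have "d (Suc n) (a \<ominus>\<^bsub>I (Suc n)\<^esub> t n b') = \<zero>\<^bsub>I (Suc (Suc n))\<^esub>"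
        using z(4) b' t(3)[OF b'(1)] unfolding hom_minus[OF ID(1) ID(1) ID(2) z(2) c(3)[OF b'(1)]]
            by (simp add: a_minus_def)
      then obtain a' where a': "a' \<in> carrier (I n)" "a \<ominus>\<^bsub>I (Suc n)\<^esub> t n b' = d n a'"
        using ID(8) z c(3)[OF b'(1)] by blast
      have "a = d n a' \<oplus>\<^bsub>I (Suc n)\<^esub> t n b'" using In.diff_add_eq[OF z(2) c(3)[OF b'(1)]] a'(2) by simp
      then show "z \<in> ?D n ` carrier (?K n)"
        using z(1) a'(1) b' by (intro image_eqI[of _ _ "(a', b')"]) (auto simp: prod_module_simps)
    qed
  qed (use K D \<epsilon> in auto)
  then show thesis using that t(1) by blast
qed


text \<open>Torsion commutes with products, so the torsion complex of the horseshoe is an extension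
  of that of \<open>J\<close> by that of \<open>I\<close>. Each part chases one element through
  \<open>H^i X -> H^i Y -> H^i W -> H^(i+1) X\<close>, whose connecting map is induced by
  \<open>t\<close>.\<close>

lemma long_exact_vanishing:
  assumes a: "ideal \<aa> R"
  shows "lc_zero R \<aa> (int i) X \<Longrightarrow> lc_zero R \<aa> (int i) W \<Longrightarrow>
      lc_zero R \<aa> (int i) Y"
    and "lc_zero R \<aa> (int i - 1) W \<Longrightarrow> lc_zero R \<aa> (int i) Y \<Longrightarrow>
      lc_zero R \<aa> (int i) X"
    and "lc_zero R \<aa> (int i) Y \<Longrightarrow> lc_zero R \<aa> (int i + 1) X \<Longrightarrow>
      lc_zero R \<aa> (int i) W"
proof -
  obtain I d where chX: "chosen_resolution R X = (I, d)" by force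
  obtain L \<delta> where chY: "chosen_resolution R Y = (L, \<delta>)" by force
  obtain J d' where chW: "chosen_resolution R W = (J, d')" by force
  obtain e where injI: "injective_resolution R X e I d" using chosen_resolution_injective[OF X
      chX] by blast
  obtain e'' where injL: "injective_resolution R Y e'' L \<delta>" using chosen_resolution_injective[OF Y
      chY] by blast
  obtain e' where injJ: "injective_resolution R W e' J d'" using chosen_resolution_injective[OF W
      chW] by blast
  have I: "resolves R X e I d" and L: "resolves R Y e'' L \<delta>" and J: "resolves R W e' J d'"
    using injI injL injJ by (auto intro: injective_resolution_resolves)
  note ID = resolvesD[OF I] and JD = resolvesD[OF J] and LD = resolvesD[OF L]
  have iI: "injective_module R (I n)" and iL: "injective_module R (L n)" and iJ: "injective_module
      R (J n)" for n
    using injI injL injJ by (auto simp: injective_resolution_def)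
  obtain t \<epsilon> where t: "\<And>n. t n \<in> module_hom R (J n) (I (Suc n))"
    and tot: "resolves R Y \<epsilon> (\<lambda>n. prod_module (I n) (J n)) (\<lambda>n (a, b). (d n a \<oplus>\<^bsub>I (Suc n)\<^esub> t n b, d' n b))"
    by (rule horseshoe[OF I J injective_module_ext_into[OF iI Y] injective_module_ext_into[OF iI
        JD(1)]]) (rule that)
  let ?K = "\<lambda>n. prod_module (I n) (J n)"
  let ?TI = "\<lambda>n. carrier (torsion R \<aa> (I n))" and ?TJ = "\<lambda>n. carrier (torsion R \<aa> (J n))"
    and ?TK = "\<lambda>n. carrier (torsion R \<aa> (?K n))"
  let ?D = "\<lambda>n (a, b). (d n a \<oplus>\<^bsub>I (Suc n)\<^esub> t n b, d' n b)"
  note K = resolvesD(1)[OF tot]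
  note totD = resolvesD(7)[OF tot]
  have extK2: "ext_into R (?K n) (?K m)" for n m
    by (intro prod_module_ext_into injective_module_ext_into iI iJ K)
  have extK1: "ext_into R (?K n) (L m)" for n m
    by (intro prod_module_ext_into injective_module_ext_into iI iJ LD(1))
  \<comment> \<open>The chosen resolution of \<open>Y\<close> is unrelated to those of
    \<open>X\<close> and \<open>W\<close>; the comparison replaces it by the horseshoe.\<close>
  have YK: "lc_zero R \<aa> (int i) Y \<longleftrightarrow> vanishing R \<aa> ?K ?D i" for i
    unfolding local_cohomology_zero_iff[OF Y a chY]
    using vanishing_transfer[OF Y a L tot extK1 injective_module_ext_into[OF iL K] extK2]
      vanishing_transfer[OF Y a tot L injective_module_ext_into[OF iL K] extK1
          injective_module_ext_into[OF iL LD(1)]]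
    by blast
  note vX = local_cohomology_zero_iff[OF X a chX] and vW = local_cohomology_zero_iff[OF W a chW]
  have T: "(u, v) \<in> ?TK n \<longleftrightarrow>
      u \<in> ?TI n \<and> v \<in> ?TJ n" for u v n
    by (rule torsion_prod[OF ID(1) JD(1) a])
  have I': "abelian_group (I n)" for n by (rule module_abelian_group[OF ID(1)])
  have zI: "\<zero>\<^bsub>I n\<^esub> \<in> ?TI n" and zJ: "\<zero>\<^bsub>J n\<^esub> \<in> ?TJ n" for n
    using submodule_zero[OF torsion_submodule[OF ID(1) a]] submodule_zero[OF torsion_submodule[OF
        JD(1) a]] by auto
  note dz = hom_zero[OF ID(1) ID(1) ID(2)] hom_zero[OF JD(1) JD(1) JD(2)] hom_zero[OF JD(1) ID(1) t]
  note Tt = torsion_hom[OF JD(1) ID(1) a t] and Td = torsion_hom[OF ID(1) ID(1) a ID(2)]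
    and Td' = torsion_hom[OF JD(1) JD(1) a JD(2)]
  note sub = torsion_subset
  \<comment> \<open>The first component of the square of the differential at
    \<open>(\<zero>, b)\<close>.\<close>
  have td: "d (Suc n) (t n b) \<oplus>\<^bsub>I (Suc (Suc n))\<^esub> t (Suc n) (d' n b) = \<zero>\<^bsub>I (Suc (Suc n))\<^esub>" if b: "b \<in>
      carrier (J n)" for n b
  proof -
    interpret In: abelian_group "I (Suc n)" by (rule I')
    interpret J0: abelian_group "I n" by (rule I')
    have "?D (Suc n) (?D n (\<zero>\<^bsub>I n\<^esub>, b)) = \<zero>\<^bsub>?K (Suc (Suc n))\<^esub>"
      using totD[of "(\<zero>\<^bsub>I n\<^esub>, b)" n] b by (simp add: prod_module_simps)
    then show ?thesis using b hom_closed[OF t b] by (simp add: prod_module_simps dz)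
  qed
  show "lc_zero R \<aa> (int i) Y"
    if "lc_zero R \<aa> (int i) X" "lc_zero R \<aa> (int i) W"
    unfolding YK vanishing_def
  proof (intro ballI impI)
    have vanX: "vanishing R \<aa> I d i" and vanW: "vanishing R \<aa> J d' i" using that vX vW by auto
    fix z assume z: "z \<in> ?TK i" "?D i z = \<zero>\<^bsub>?K (Suc i)\<^esub>"
    obtain u v where uv: "z = (u, v)" by force
    have uT: "u \<in> ?TI i" and vT: "v \<in> ?TJ i" using z uv T by auto
    have eq: "d i u \<oplus>\<^bsub>I (Suc i)\<^esub> t i v = \<zero>\<^bsub>I (Suc i)\<^esub>" "d' i v = \<zero>\<^bsub>J (Suc i)\<^esub>"
      using z uv by (auto simp: prod_module_simps)
    interpret Is: abelian_group "I (Suc i)" by (rule I')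
    show "case i of 0 \<Rightarrow> z = \<zero>\<^bsub>?K 0\<^esub> | Suc k \<Rightarrow> z \<in> ?D k ` ?TK k"
    proof (cases i)
      case 0
      have v: "v = \<zero>\<^bsub>J i\<^esub>" using vanW vT eq(2) 0 by (auto simp: vanishing_def)
      then have "d i u = \<zero>\<^bsub>I (Suc i)\<^esub>"
        using eq(1) dz(3)[of i] Is.r_zero[OF hom_closed[OF ID(2) sub[OF uT]]] by simp
      then have "u = \<zero>\<^bsub>I 0\<^esub>" using vanX uT 0 by (auto simp: vanishing_def)
      then show ?thesis using 0 uv v by (simp add: prod_module_simps)
    next
      case (Suc k)
      interpret Ii: abelian_group "I (Suc k)" by (rule I')
      obtain v' where v': "v' \<in> ?TJ k" "v = d' k v'"
        using vanW vT eq(2) Suc by (auto simp: vanishing_def)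
      have tv: "t k v' \<in> ?TI (Suc k)" by (rule Tt[OF v'(1)])
      have uT': "u \<in> ?TI (Suc k)" using uT Suc by simp
      have dif: "u \<ominus>\<^bsub>I (Suc k)\<^esub> t k v' \<in> ?TI (Suc k)"
        unfolding a_minus_def
        by (intro submodule_add[OF torsion_submodule[OF ID(1) a]] submodule_uminus[OF
            torsion_submodule[OF ID(1) a]] uT' tv)
      interpret Is2: abelian_group "I (Suc (Suc k))" by (rule I')
      have c: "d (Suc k) u \<in> carrier (I (Suc (Suc k)))" "d (Suc k) (t k v') \<in> carrier (I (Suc (Suc k)))"
        "t (Suc k) v \<in> carrier (I (Suc (Suc k)))"
        using hom_closed[OF ID(2) sub[OF uT']] hom_closed[OF ID(2) sub[OF tv]] hom_closed[OF t
            sub[OF vT]] Suc by auto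
      \<comment> \<open>Both \<open>d u\<close> and \<open>d (t v')\<close> equal the negative of
        \<open>t v\<close>, one by the cocycle equation and one by anticommutation. So their
        difference comes from a cocycle of \<open>I\<close>.\<close>
      have "\<ominus>\<^bsub>I (Suc (Suc k))\<^esub> t (Suc k) v = d (Suc k) u"
        using eq(1) Suc c by (intro Is2.minus_equality) auto
      moreover have "\<ominus>\<^bsub>I (Suc (Suc k))\<^esub> t (Suc k) v = d (Suc k) (t k v')"
        using td[OF sub[OF v'(1)]] v'(2) c by (intro Is2.minus_equality) auto
      ultimately have "d (Suc k) u = d (Suc k) (t k v')" by simp
      then have "d (Suc k) (u \<ominus>\<^bsub>I (Suc k)\<^esub> t k v') = \<zero>\<^bsub>I (Suc (Suc k))\<^esub>"
        using c unfolding hom_minus[OF ID(1) ID(1) ID(2) sub[OF uT'] sub[OF tv]] by (simp add: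
            Is2.diff_eq_zero_iff)
      then obtain u' where u': "u' \<in> ?TI k" "u \<ominus>\<^bsub>I (Suc k)\<^esub> t k v' = d k u'"
        using vanX dif Suc by (auto simp: vanishing_def)
      have "u = d k u' \<oplus>\<^bsub>I (Suc k)\<^esub> t k v'" using Ii.diff_add_eq[OF sub[OF uT'] sub[OF tv]] u'(2) by simp
      then have "z = ?D k (u', v')" using uv v'(2) by simp
      then show ?thesis using Suc u'(1) v'(1) T by (auto intro!: image_eqI[of _ _ "(u', v')"])
    qed
  qed
  show "lc_zero R \<aa> (int i) X"
    if W1: "lc_zero R \<aa> (int i - 1) W" and Y1: "lc_zero R \<aa> (int i) Y"
    unfolding vX vanishing_def
  proof (intro ballI impI)
    have vanY: "vanishing R \<aa> ?K ?D i" using Y1 YK by simp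
    fix u assume u: "u \<in> ?TI i" "d i u = \<zero>\<^bsub>I (Suc i)\<^esub>"
    interpret Is: abelian_group "I (Suc i)" by (rule I')
    \<comment> \<open>The image of \<open>u\<close> in the horseshoe. If it bounds there, its zero
      second component makes the second entry \<open>v'\<close> of a preimage a cocycle of degree
      \<open>i - 1\<close>.\<close>
    have z: "(u, \<zero>\<^bsub>J i\<^esub>) \<in> ?TK i" "?D i (u, \<zero>\<^bsub>J i\<^esub>) = \<zero>\<^bsub>?K (Suc i)\<^esub>"
      using u zJ T by (auto simp: prod_module_simps dz)
    show "case i of 0 \<Rightarrow> u = \<zero>\<^bsub>I 0\<^esub> | Suc k \<Rightarrow> u \<in> d k ` ?TI k"
    proof (cases i)
      case 0
      then show ?thesis using vanY z by (auto simp: vanishing_def prod_module_simps)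
    next
      case (Suc k)
      then have "(u, \<zero>\<^bsub>J i\<^esub>) \<in> ?D k ` ?TK k"
        using vanY z by (auto simp: vanishing_def)
      then obtain p where p: "p \<in> ?TK k" "(u, \<zero>\<^bsub>J i\<^esub>) = ?D k p" by blast
      obtain u' v' where p': "p = (u', v')" by force
      then have u': "u' \<in> ?TI k" and v': "v' \<in> ?TJ k"
        and ueq: "u = d k u' \<oplus>\<^bsub>I (Suc k)\<^esub> t k v'" "d' k v' = \<zero>\<^bsub>J (Suc k)\<^esub>"
        using p T Suc by auto
      have vanW: "vanishing R \<aa> J d' k" using W1 vW[of k] Suc by simp
      interpret Ik: abelian_group "I (Suc k)" by (rule I')
      show ?thesis
      proof (cases k)
        case 0
        have "v' = \<zero>\<^bsub>J k\<^esub>" using vanW v' ueq(2) 0 by (auto simp: vanishing_def)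
        then show ?thesis using Suc u' ueq(1) hom_closed[OF ID(2) sub[OF u']] by (auto simp: dz)
      next
        case (Suc l)
        \<comment> \<open>Here \<open>u = d u' + t v'\<close>. Writing \<open>v' = d' w\<close>
          turns the second summand into \<open>- d (t w)\<close>, so that \<open>u\<close> bounds
          within \<open>I\<close>.\<close>
        obtain w where w: "w \<in> ?TJ l" "v' = d' l w"
          using vanW v' ueq(2) Suc by (auto simp: vanishing_def)
        interpret Il: abelian_group "I k" by (rule I')
        have tw: "t l w \<in> ?TI k" using Tt[OF w(1)] Suc by simp
        have c: "d k (t l w) \<in> carrier (I (Suc k))" "t k v' \<in> carrier (I (Suc k))" "d k u' \<in>
            carrier (I (Suc k))"
          using hom_closed[OF ID(2) sub[OF tw]] hom_closed[OF t sub[OF v']] hom_closed[OF ID(2)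
              sub[OF u']] by auto
        have "d k (t l w) \<oplus>\<^bsub>I (Suc k)\<^esub> t k v' = \<zero>\<^bsub>I (Suc k)\<^esub>" using td[OF sub[OF w(1)]] w(2) Suc by simp
        then have "t k v' = \<ominus>\<^bsub>I (Suc k)\<^esub> d k (t l w)" using c by (metis Ik.a_comm Ik.minus_equality)
        then have "u = d k (u' \<ominus>\<^bsub>I k\<^esub> t l w)"
          unfolding hom_minus[OF ID(1) ID(1) ID(2) sub[OF u'] sub[OF tw]] using ueq(1) by (simp
              add: a_minus_def)
        moreover have "u' \<ominus>\<^bsub>I k\<^esub> t l w \<in> ?TI k"
          unfolding a_minus_def
          by (intro submodule_add[OF torsion_submodule[OF ID(1) a]] submodule_uminus[OF
              torsion_submodule[OF ID(1) a]] u' tw)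
        ultimately show ?thesis using \<open>i = Suc k\<close> by simp
      qed
    qed
  qed
  show "lc_zero R \<aa> (int i) W"
    if Y1: "lc_zero R \<aa> (int i) Y" and X1: "lc_zero R \<aa> (int i + 1) X"
    unfolding vW vanishing_def
  proof (intro ballI impI)
    have vanY: "vanishing R \<aa> ?K ?D i" using Y1 YK by simp
    have vanX: "vanishing R \<aa> I d (Suc i)" using X1 vX[of "Suc i"] by (simp add: add.commute)
    fix v assume v: "v \<in> ?TJ i" "d' i v = \<zero>\<^bsub>J (Suc i)\<^esub>"
    interpret Is: abelian_group "I (Suc i)" by (rule I')
    interpret Iss: abelian_group "I (Suc (Suc i))" by (rule I')
    have tv: "t i v \<in> ?TI (Suc i)" by (rule Tt[OF v(1)])
    \<comment> \<open>The connecting map sends the class of \<open>v\<close> to that of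
      \<open>t v\<close>. As \<open>t v = d u\<close>, the pair \<open>(-u, v)\<close> is a cocycle
      of the horseshoe lifting \<open>v\<close>.\<close>
    have "d (Suc i) (t i v) = \<zero>\<^bsub>I (Suc (Suc i))\<^esub>"
      using td[OF sub[OF v(1)]] v(2) hom_closed[OF ID(2) sub[OF tv]] by (simp add: dz)
    then obtain u where u: "u \<in> ?TI i" "t i v = d i u"
      using vanX tv by (auto simp: vanishing_def)
    have nu: "\<ominus>\<^bsub>I i\<^esub> u \<in> ?TI i" by (rule submodule_uminus[OF torsion_submodule[OF ID(1) a] u(1)])
    have z: "(\<ominus>\<^bsub>I i\<^esub> u, v) \<in> ?TK i" "?D i (\<ominus>\<^bsub>I i\<^esub> u, v) = \<zero>\<^bsub>?K (Suc i)\<^esub>"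
      using nu v T u(2) hom_closed[OF ID(2) sub[OF u(1)]]
      by (auto simp: prod_module_simps hom_uminus[OF ID(1) ID(1) ID(2) sub[OF u(1)]] Is.l_neg)
    show "case i of 0 \<Rightarrow> v = \<zero>\<^bsub>J 0\<^esub> | Suc k \<Rightarrow> v \<in> d' k ` ?TJ k"
    proof (cases i)
      case 0
      then show ?thesis using vanY z by (auto simp: vanishing_def prod_module_simps)
    next
      case (Suc k)
      then have "(\<ominus>\<^bsub>I i\<^esub> u, v) \<in> ?D k ` ?TK k"
        using vanY z by (auto simp: vanishing_def)
      then obtain u' v' where "(u', v') \<in> ?TK k" "v = d' k v'" by auto
      then show ?thesis using Suc T by auto
    qed
  qed
qed

end

section \<open>Depth and complexes with acyclic terms\<close>

lemma depth_ge_iff: "D \<le> depth R \<aa> V \<longleftrightarrow> (\<forall>i. enat i < D \<longrightarrow> lc_zero R \<aa> (int i) V)"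
  unfolding depth_def le_Inf_iff by (auto simp: not_le[symmetric])

section \<open>Finite powers of a module\<close>

definition fun_module :: "'s set \<Rightarrow> ('a, 'm) module \<Rightarrow> ('a, 's \<Rightarrow> 'm) module" where
  "fun_module S M =
    \<lparr>carrier = S \<rightarrow>\<^sub>E carrier M, monoid.mult = undefined, one = undefined,
     zero = (\<lambda>s\<in>S. \<zero>\<^bsub>M\<^esub>), add = (\<lambda>\<phi> \<psi>. \<lambda>s\<in>S. \<phi> s \<oplus>\<^bsub>M\<^esub> \<psi> s), smult = (\<lambda>a \<phi>. \<lambda>s\<in>S. a \<odot>\<^bsub>M\<^esub> \<phi> s)\<rparr>"

lemma fun_module_simps:
  "carrier (fun_module S M) = S \<rightarrow>\<^sub>E carrier M"
  "\<zero>\<^bsub>fun_module S M\<^esub> = (\<lambda>s\<in>S. \<zero>\<^bsub>M\<^esub>)"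
  "\<phi> \<oplus>\<^bsub>fun_module S M\<^esub> \<psi> = (\<lambda>s\<in>S. \<phi> s \<oplus>\<^bsub>M\<^esub> \<psi> s)"
  "a \<odot>\<^bsub>fun_module S M\<^esub> \<phi> = (\<lambda>s\<in>S. a \<odot>\<^bsub>M\<^esub> \<phi> s)"
  by (simp_all add: fun_module_def)

lemma fun_module_closed: "\<phi> \<in> carrier (fun_module S M) \<Longrightarrow> s \<in> S \<Longrightarrow> \<phi> s \<in> carrier M"
  by (auto simp: fun_module_simps)

lemma fun_module_module:
  assumes M: "module R M"
  shows "module R (fun_module S M)"
proof -
  interpret M': abelian_group M using M by (rule module_abelian_group)
  interpret M: module R M by (rule M)
  note cl = fun_module_closed[of _ S M]
  have mem: "\<zero>\<^bsub>fun_module S M\<^esub> \<in> carrier (fun_module S M)"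
    "\<phi> \<in> carrier (fun_module S M) \<Longrightarrow> \<psi> \<in> carrier (fun_module S M) \<Longrightarrow>
      \<phi> \<oplus>\<^bsub>fun_module S M\<^esub> \<psi> \<in> carrier (fun_module S M)"
    "\<phi> \<in> carrier (fun_module S M) \<Longrightarrow> a \<in> carrier R \<Longrightarrow>
      a \<odot>\<^bsub>fun_module S M\<^esub> \<phi> \<in> carrier (fun_module S M)"
    "\<phi> \<in> carrier (fun_module S M) \<Longrightarrow> (\<lambda>s\<in>S. \<ominus>\<^bsub>M\<^esub> \<phi> s) \<in> carrier (fun_module S M)" for \<phi> \<psi> a
    by (auto simp: fun_module_simps)
  note eqs = fun_module_simps(2-4) restrict_def
  have ar: "\<phi> s = undefined" if "\<phi> \<in> carrier (fun_module S M)" "s \<notin> S" for \<phi> s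
    using that by (auto simp: fun_module_simps PiE_def extensional_def)
  show ?thesis
  proof (rule moduleI)
    show "abelian_group (fun_module S M)"
    proof (rule abelian_groupI)
      fix \<phi> assume \<phi>: "\<phi> \<in> carrier (fun_module S M)"
      have "(\<lambda>s\<in>S. \<ominus>\<^bsub>M\<^esub> \<phi> s) \<oplus>\<^bsub>fun_module S M\<^esub> \<phi> = \<zero>\<^bsub>fun_module S M\<^esub>"
        by (rule ext) (insert \<phi>, auto simp: eqs M'.l_neg cl)
      then show "\<exists>\<psi>\<in>carrier (fun_module S M). \<psi> \<oplus>\<^bsub>fun_module S M\<^esub> \<phi> = \<zero>\<^bsub>fun_module S M\<^esub>"
        using mem(4)[OF \<phi>] by blast
      show "\<zero>\<^bsub>fun_module S M\<^esub> \<oplus>\<^bsub>fun_module S M\<^esub> \<phi> = \<phi>"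
        by (rule ext) (insert \<phi>, auto simp: eqs cl ar)
      fix \<psi> assume \<psi>: "\<psi> \<in> carrier (fun_module S M)"
      show "\<phi> \<oplus>\<^bsub>fun_module S M\<^esub> \<psi> = \<psi> \<oplus>\<^bsub>fun_module S M\<^esub> \<phi>"
        by (rule ext) (insert \<phi> \<psi>, auto simp: eqs cl M'.a_comm)
      fix \<xi> assume \<xi>: "\<xi> \<in> carrier (fun_module S M)"
      show "\<phi> \<oplus>\<^bsub>fun_module S M\<^esub> \<psi> \<oplus>\<^bsub>fun_module S M\<^esub> \<xi> = \<phi> \<oplus>\<^bsub>fun_module S M\<^esub> (\<psi> \<oplus>\<^bsub>fun_module S M\<^esub> \<xi>)"
        by (rule ext) (insert \<phi> \<psi> \<xi>, auto simp: eqs cl M'.a_assoc)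
    qed (use mem in auto)
  next
    fix a b \<phi> assume a: "a \<in> carrier R" "b \<in> carrier R" and \<phi>: "\<phi> \<in> carrier (fun_module S M)"
    show "(a \<oplus>\<^bsub>R\<^esub> b) \<odot>\<^bsub>fun_module S M\<^esub> \<phi> = a \<odot>\<^bsub>fun_module S M\<^esub> \<phi> \<oplus>\<^bsub>fun_module S M\<^esub> b \<odot>\<^bsub>fun_module S M\<^esub> \<phi>"
      "(a \<otimes>\<^bsub>R\<^esub> b) \<odot>\<^bsub>fun_module S M\<^esub> \<phi> = a \<odot>\<^bsub>fun_module S M\<^esub> (b \<odot>\<^bsub>fun_module S M\<^esub> \<phi>)"
      by (rule ext, insert a \<phi>, auto simp: eqs cl M.smult_l_distr M.smult_assoc1)+
  next
    fix a \<phi> \<psi> assume a: "a \<in> carrier R"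
      and \<phi>: "\<phi> \<in> carrier (fun_module S M)" and \<psi>: "\<psi> \<in> carrier (fun_module S M)"
    show "a \<odot>\<^bsub>fun_module S M\<^esub> (\<phi> \<oplus>\<^bsub>fun_module S M\<^esub> \<psi>) = a \<odot>\<^bsub>fun_module S M\<^esub> \<phi> \<oplus>\<^bsub>fun_module S M\<^esub> a
        \<odot>\<^bsub>fun_module S M\<^esub> \<psi>"
      by (rule ext) (insert a \<phi> \<psi>, auto simp: eqs cl M.smult_r_distr)
  next
    fix \<phi> assume \<phi>: "\<phi> \<in> carrier (fun_module S M)"
    show "\<one>\<^bsub>R\<^esub> \<odot>\<^bsub>fun_module S M\<^esub> \<phi> = \<phi>"
      by (rule ext) (insert \<phi>, auto simp: eqs cl ar)
  qed (use mem module_cring[OF M] in auto)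
qed

text \<open>Each further index adds an extension by one more copy of \<open>M\<close>. Vanishing is
  assumed in all degrees below \<open>D\<close> because the base case also draws on degree
  \<open>i - 1\<close>.\<close>

lemma lc_zero_fun_module:
  assumes M: "module R M" and a: "ideal \<aa> R" and S: "finite S"
    and van: "\<And>i. enat i < D \<Longrightarrow> lc_zero R \<aa> (int i) M" and i: "enat i < D"
  shows "lc_zero R \<aa> (int i) (fun_module S M)"
  using S
proof (induction S)
  interpret M': abelian_group M using M by (rule module_abelian_group)
  interpret M: module R M by (rule M)
  case empty
  \<comment> \<open>The zero module is presented as the kernel of the identity of \<open>M\<close>,
    so its vanishing too is read off the long exact sequence.\<close>
  interpret short_exact R "fun_module {} M :: (_, 's \<Rightarrow> _) module" M M "\<lambda>_. \<zero>\<^bsub>M\<^esub>" "\<lambda>x. x"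
  proof (rule short_exact.intro)
    show "(\<lambda>_. \<zero>\<^bsub>M\<^esub>) \<in> module_hom R (fun_module {} M) M" by (rule module_homI) auto
    show "(\<lambda>x. x) \<in> module_hom R M M" by (rule module_homI) auto
    show "\<exists>x\<in>carrier (fun_module {} M :: (_, 's \<Rightarrow> _) module). y = \<zero>\<^bsub>M\<^esub>" if "y = \<zero>\<^bsub>M\<^esub>" for y
      using that by (intro bexI[of _ "\<lambda>_. undefined"]) (auto simp: fun_module_simps)
    show "x = \<zero>\<^bsub>fun_module {} M\<^esub>" if "x \<in> carrier (fun_module {} M)" for x :: "'s \<Rightarrow> _"
      using that by (auto simp: fun_module_simps)
    show "\<exists>y\<in>carrier M. w = y" if "w \<in> carrier M" for w using that by blast
  qed (simp_all only: M fun_module_module[OF M])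
  have "lc_zero R \<aa> (int i - 1) M"
  proof (cases i)
    case 0
    then show ?thesis by (simp add: local_cohomology_neg[OF M])
  next
    case (Suc j)
    then have "enat j < D" by (intro le_less_trans[OF _ i]) simp
    then show ?thesis using van Suc by simp
  qed
  then show ?case using long_exact_vanishing(2)[OF a] van[OF i] by blast
next
  interpret M': abelian_group M using M by (rule module_abelian_group)
  interpret M: module R M by (rule M)
  case (insert x S)
  let ?\<iota> = "\<lambda>\<phi>. \<lambda>s\<in>insert x S. if s = x then \<zero>\<^bsub>M\<^esub> else \<phi> s"
  interpret short_exact R "fun_module S M" "fun_module (insert x S) M" M ?\<iota> "\<lambda>\<phi>. \<phi> x"
  proof (rule short_exact.intro)
    show "?\<iota> \<in> module_hom R (fun_module S M) (fun_module (insert x S) M)"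
    proof (rule module_homI)
      have closed: "?\<iota> \<phi> \<in> carrier (fun_module (insert x S) M)" if "\<phi> \<in> carrier (fun_module S M)" for \<phi>
        using that insert.hyps(2) by (auto simp: fun_module_simps)
      then show "?\<iota> \<phi> \<in> carrier (fun_module (insert x S) M)" if "\<phi> \<in> carrier (fun_module S M)" for \<phi>
        using that by blast
      show "?\<iota> (\<phi> \<oplus>\<^bsub>fun_module S M\<^esub> \<psi>) = ?\<iota> \<phi> \<oplus>\<^bsub>fun_module (insert x S) M\<^esub> ?\<iota> \<psi>" for \<phi> \<psi>
        by (auto simp: fun_module_simps fun_eq_iff)
      show "?\<iota> (a \<odot>\<^bsub>fun_module S M\<^esub> \<phi>) = a \<odot>\<^bsub>fun_module (insert x S) M\<^esub> ?\<iota> \<phi>" if "a \<in> carrier R" for a \<phi>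
        using that by (auto simp: fun_module_simps fun_eq_iff)
    qed
    show "(\<lambda>\<phi>. \<phi> x) \<in> module_hom R (fun_module (insert x S) M) M"
      by (intro module_homI) (auto simp: fun_module_simps)
    show "\<exists>y\<in>carrier (fun_module (insert x S) M). w = y x" if "w \<in> carrier M" for w
      using that by (intro bexI[of _ "\<lambda>s\<in>insert x S. w"]) (auto simp: fun_module_simps)
    show "\<phi> = \<zero>\<^bsub>fun_module S M\<^esub>" if \<phi>: "\<phi> \<in> carrier (fun_module S M)" "?\<iota> \<phi> = \<zero>\<^bsub>fun_module (insert x
        S) M\<^esub>" for \<phi>
    proof (rule extensionalityI)
      fix s assume s: "s \<in> S"
      show "\<phi> s = \<zero>\<^bsub>fun_module S M\<^esub> s"
        using fun_cong[OF \<phi>(2), of s] s insert.hyps(2) by (auto simp: fun_module_simps split: if_splits)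
    qed (use \<phi>(1) in \<open>auto simp: fun_module_simps PiE_def\<close>)
    show "\<exists>\<phi>\<in>carrier (fun_module S M). y = ?\<iota> \<phi>"
      if y: "y \<in> carrier (fun_module (insert x S) M)" "y x = \<zero>\<^bsub>M\<^esub>" for y
    proof
      show "restrict y S \<in> carrier (fun_module S M)" using y by (auto simp: fun_module_simps)
      show "y = ?\<iota> (restrict y S)"
        by (rule extensionalityI[of _ "insert x S"]) (use y in \<open>auto simp: fun_module_simps PiE_def\<close>)
    qed
  qed (auto simp: M fun_module_module[OF M])
  show ?case using long_exact_vanishing(1)[OF a insert.IH van[OF i]] .
qed

text \<open>\<open>X\<close> comes with an embedding instead of being the kernel of
  \<open>d 0\<close> itself: the invariants and the cochains live on different types.\<close>

locale acyclic_complex =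
  fixes R :: "('a, 'r) ring_scheme" and \<aa> :: "'a set" and X :: "('a, 'x) module"
    and C :: "nat \<Rightarrow> ('a, 'c) module" and d :: "nat \<Rightarrow> 'c \<Rightarrow> 'c" and e :: "'x \<Rightarrow> 'c" and D :: enat
  assumes a: "ideal \<aa> R" and X: "module R X" and C: "\<And>n. module R (C n)"
    and d: "\<And>n. d n \<in> module_hom R (C n) (C (Suc n))"
    and dd: "\<And>n x. x \<in> carrier (C n) \<Longrightarrow> d (Suc n) (d n x) = \<zero>\<^bsub>C (Suc (Suc n))\<^esub>"
    and e: "e \<in> module_hom R X (C 0)" and e_inj: "\<And>x. x \<in> carrier X \<Longrightarrow> e x = \<zero>\<^bsub>C 0\<^esub> \<Longrightarrow> x = \<zero>\<^bsub>X\<^esub>"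
    and de: "\<And>x. x \<in> carrier X \<Longrightarrow> d 0 (e x) = \<zero>\<^bsub>C (Suc 0)\<^esub>"
    and exact0: "\<And>y. y \<in> carrier (C 0) \<Longrightarrow> d 0 y = \<zero>\<^bsub>C (Suc 0)\<^esub> \<Longrightarrow> \<exists>x\<in>carrier X. y = e x"
    and van: "\<And>i n. enat i < D \<Longrightarrow> lc_zero R \<aa> (int i) (C n)"
begin

definition Z :: "nat \<Rightarrow> ('a, 'c) module" where
  "Z n = (C n)\<lparr>carrier := {x \<in> carrier (C n). d n x = \<zero>\<^bsub>C (Suc n)\<^esub>}\<rparr>"

text \<open>Indexed by the source of the differential, so \<open>B n\<close> consists of
  coboundaries in degree \<open>n + 1\<close>.\<close>

definition B :: "nat \<Rightarrow> ('a, 'c) module" where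
  "B n = (C (Suc n))\<lparr>carrier := d n ` carrier (C n)\<rparr>"

abbreviation H :: "nat \<Rightarrow> ('a, 'c set) module" where
  "H \<equiv> cohomology C d"

lemma Z_module: "module R (Z n)"
  unfolding Z_def by (rule submodule_module[OF C submodule_kernel[OF C C d]])

lemma B_module: "module R (B n)"
  unfolding B_def by (rule submodule_module[OF C submodule_image[OF C C d]])

lemma B_sub_Z: "submodule (d n ` carrier (C n)) R (Z (Suc n))"
  unfolding Z_def
proof (rule submodule_restrict[OF C submodule_kernel[OF C C d] submodule_image[OF C C d]])
  show "d n ` carrier (C n) \<subseteq> {x \<in> carrier (C (Suc n)). d (Suc n) x = \<zero>\<^bsub>C (Suc (Suc n))\<^esub>}"
    using dd[of _ n] hom_closed[OF d[of n]] by blast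
qed

lemma H_eq: "H (Suc n) = quot_module (Z (Suc n)) (d n ` carrier (C n))"
  by (simp add: cohomology_def Z_def)

lemma H_module: "module R (H (Suc n))"
  unfolding H_eq by (rule quot_module_module[OF Z_module B_sub_Z])

lemma short_exact_ZCB: "short_exact R (Z n) (C n) (B n) (\<lambda>x. x) (d n)"
proof (rule short_exact.intro)
  show "(\<lambda>x. x) \<in> module_hom R (Z n) (C n)" by (rule module_homI) (auto simp: Z_def)
  show "d n \<in> module_hom R (C n) (B n)"
    by (rule module_homI) (auto simp: B_def hom_add[OF d] hom_smult[OF d])
qed (auto simp: Z_module B_module C, auto simp: Z_def B_def)

text \<open>\<open>X\<close> takes the place of \<open>Z 0\<close>, so the complex is tied to
  \<open>X\<close> without transporting local cohomology along an isomorphism.\<close>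

lemma short_exact_XCB: "short_exact R X (C 0) (B 0) e (d 0)"
proof (rule short_exact.intro)
  show "d 0 \<in> module_hom R (C 0) (B 0)"
    by (rule module_homI) (auto simp: B_def hom_add[OF d] hom_smult[OF d])
qed (auto simp: X B_module C e e_inj, auto simp: B_def de exact0)

lemma short_exact_BZH:
  "short_exact R (B n) (Z (Suc n)) (H (Suc n)) (\<lambda>x. x) (\<lambda>x. d n ` carrier (C n) +>\<^bsub>Z (Suc n)\<^esub> x)"
proof (rule short_exact.intro)
  note q = quot_module_hom[OF Z_module B_sub_Z] quot_module_kernel[OF Z_module B_sub_Z]
    quot_module_carrier[OF Z_module B_sub_Z] submodule_subset[OF B_sub_Z]
  show "(\<lambda>x. x) \<in> module_hom R (B n) (Z (Suc n))"
    using q(4) by (intro module_homI) (auto simp: B_def, auto simp: Z_def)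
  show "(\<lambda>x. d n ` carrier (C n) +>\<^bsub>Z (Suc n)\<^esub> x) \<in> module_hom R (Z (Suc n)) (H (Suc n))"
    unfolding H_eq by (rule q(1))
  show "\<exists>y\<in>carrier (Z (Suc n)). w = d n ` carrier (C n) +>\<^bsub>Z (Suc n)\<^esub> y" if "w \<in> carrier (H (Suc n))" for w
    using that unfolding H_eq q(3) by blast
  show "d n ` carrier (C n) +>\<^bsub>Z (Suc n)\<^esub> x = \<zero>\<^bsub>H (Suc n)\<^esub>" if "x \<in> carrier (B n)" for x
    using that q(2,4) unfolding H_eq by (auto simp: B_def)
  show "\<exists>x\<in>carrier (B n). y = x"
    if "y \<in> carrier (Z (Suc n))" "d n ` carrier (C n) +>\<^bsub>Z (Suc n)\<^esub> y = \<zero>\<^bsub>H (Suc n)\<^esub>" for y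
    using that q(2) unfolding H_eq by (auto simp: B_def)
  show "x = \<zero>\<^bsub>B n\<^esub>" if "x \<in> carrier (B n)" "x = \<zero>\<^bsub>Z (Suc n)\<^esub>" for x
    using that by (simp add: Z_def B_def)
qed (auto simp: B_module Z_module H_module)

lemmas ZCB = short_exact.long_exact_vanishing[OF short_exact_ZCB a]
lemmas XCB = short_exact.long_exact_vanishing[OF short_exact_XCB a]
lemmas BZH = short_exact.long_exact_vanishing[OF short_exact_BZH a]

text \<open>The argument moves along the diagonal \<open>j + (n + 1) = p\<close>. Degree
  \<open>j\<close> of a cocycle module is controlled by degree \<open>j - 1\<close> of the
  coboundaries of the same index, and these by degree \<open>j - 1\<close> of the next cocycles and
  degree \<open>j - 2\<close> of the next cohomology. The parameter \<open>q\<close> bounds where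
  the diagonal is entered: 0 for the lower bound, \<open>q0\<close> for the upper one.\<close>

lemma cocycles_vanish:
  assumes "p < D"
    and H: "\<And>n. int p - 1 - int (Suc n) \<ge> 0 \<Longrightarrow> Suc n > q \<Longrightarrow> lc_zero R \<aa> (int p - 1 - int (Suc n)) (H
        (Suc n))"
    and "j + Suc n = p" "q \<le> Suc n"
  shows "lc_zero R \<aa> (int j) (Z (Suc n))"
  using assms(3,4)
proof (induction j arbitrary: n)
  case 0
  then have "enat 0 < D" by (intro le_less_trans[OF _ assms(1)]) simp
  \<comment> \<open>The diagonal ends here: in degree 0 the coboundaries contribute only degree
    \<open>-1\<close>, and the complex itself vanishes because \<open>D\<close> is positive.\<close>
  then show ?case using ZCB(2)[where i = 0, OF local_cohomology_neg[OF B_module] van] by simp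
next
  case (Suc j)
  have "lc_zero R \<aa> (int j - 1) (H (Suc (Suc n)))"
  proof (cases j)
    case 0
    then show ?thesis by (simp add: local_cohomology_neg[OF H_module])
  next
    case (Suc k)
    then show ?thesis using H[of "Suc n"] Suc.prems by (auto simp: algebra_simps)
  qed
  moreover have "lc_zero R \<aa> (int j) (Z (Suc (Suc n)))" using Suc by auto
  ultimately have "lc_zero R \<aa> (int j) (B (Suc n))" by (rule BZH(2))
  moreover have "enat (Suc j) < D"
    by (rule le_less_trans[OF _ assms(1)]) (use Suc.prems in simp)
  ultimately show ?case using ZCB(2)[where i = "Suc j", OF _ van] by simp
qed

theorem depth_lower_bound:
  "min D ((INF q\<in>{0<..}. enat q + depth R \<aa> (H q)) + 1) \<le> depth R \<aa> X"
  unfolding depth_ge_iff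
proof (intro allI impI)
  fix p assume "enat p < min D ((INF q\<in>{0<..}. enat q + depth R \<aa> (H q)) + 1)"
  then have pD: "enat p < D" and ph: "enat p < (INF q\<in>{0<..}. enat q + depth R \<aa> (H q)) + 1" by auto
  have H: "lc_zero R \<aa> (int i) (H (Suc n))" if "i + Suc n < p" for i n
  proof -
    \<comment> \<open>Below \<open>h + 1\<close> means at most \<open>h\<close>, also when
      \<open>h\<close> is infinite.\<close>
    have "enat p \<le> (INF q\<in>{0<..}. enat q + depth R \<aa> (H q))"
      using ph by (metis Suc_ile_eq add.commute iless_Suc_eq plus_1_eSuc(1))
    also have "\<dots> \<le> enat (Suc n) + depth R \<aa> (H (Suc n))" by (rule INF_lower) simp
    finally have le: "enat p \<le> enat (Suc n) + depth R \<aa> (H (Suc n))" .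
    have "enat (Suc i) \<le> depth R \<aa> (H (Suc n))"
    proof (cases "depth R \<aa> (H (Suc n))")
      case (enat k)
      then show ?thesis using le that by simp
    qed simp
    then show ?thesis unfolding depth_ge_iff by simp
  qed
  have H': "lc_zero R \<aa> (int p - 1 - int (Suc n)) (H (Suc n))" if "int p - 1 - int (Suc n) \<ge> 0" for n
    using H[of "nat (int p - 1 - int (Suc n))" n] that by simp
  have "lc_zero R \<aa> (int p - 1) (B 0)"
  proof (cases p)
    case 0
    then show ?thesis by (simp add: local_cohomology_neg[OF B_module])
  next
    case (Suc j)
    have "lc_zero R \<aa> (int j) (Z (Suc 0))"
      by (rule cocycles_vanish[where q = 0, OF pD H']) (auto simp: Suc)
    moreover have "lc_zero R \<aa> (int j - 1) (H (Suc 0))"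
    proof (cases j)
      case 0
      then show ?thesis by (simp add: local_cohomology_neg[OF H_module])
    next
      case (Suc k)
      then show ?thesis using H[of k 0] \<open>p = Suc j\<close> by simp
    qed
    ultimately show ?thesis using BZH(2) Suc by simp
  qed
  then show "lc_zero R \<aa> (int p) X" using XCB(2)[OF _ van[OF pD]] by blast
qed

text \<open>If degree \<open>s + 1\<close> of \<open>X\<close> vanished, the hypothesis
  \<open>below\<close> would carry this down to degree \<open>p0 + 1\<close> of the last
  coboundaries before \<open>H q0\<close>. By \<open>above\<close>, degree \<open>p0\<close> of
  \<open>Z q0\<close> vanishes as well, and the sequence would kill degree \<open>p0\<close> of
  \<open>H q0\<close>.\<close>

theorem depth_upper_bound:
  assumes q0: "q0 > 0" and s: "s = p0 + q0" and nz: "\<not> lc_zero R \<aa> (int p0) (H q0)" and sD: "enat s < D"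
    and below: "\<forall>l\<in>{1..q0 - 1}. lc_zero R \<aa> (int s + 1 - int l) (H l)"
    and above: "\<forall>l>q0. lc_zero R \<aa> (int s - 1 - int l) (H l)"
  shows "depth R \<aa> X \<le> enat (s + 1)"
proof (rule ccontr)
  assume "\<not> depth R \<aa> X \<le> enat (s + 1)"
  then have "enat (s + 2) \<le> depth R \<aa> X" by (metis Suc_ile_eq add_2_eq_Suc' not_le Suc_eq_plus1)
  then have X0: "lc_zero R \<aa> (int (s + 1)) X" by (rule depth_ge_iff[THEN iffD1, rule_format]) simp
  obtain m where m: "q0 = Suc m" using q0 by (cases q0) auto
  \<comment> \<open>Degree \<open>p0\<close> and index \<open>q0\<close> lie on the diagonal of
    \<open>s\<close>, and every later cohomology module on it is covered by
    \<open>above\<close>.\<close>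
  have Zp: "lc_zero R \<aa> (int p0) (Z (Suc m))"
    by (rule cocycles_vanish[where q = q0, OF sD]) (use above s m in auto)
  \<comment> \<open>The subtraction is exact because \<open>n < q0\<close> and \<open>q0\<close> is
    at most \<open>s\<close>. The term \<open>H (n + 1)\<close> enters in degree
    \<open>s - n\<close>, which is the index of \<open>below\<close> for
    \<open>l = n + 1\<close>.\<close>
  have Bn: "lc_zero R \<aa> (int (s - n)) (B n)" if "n \<le> m" for n
    using that
  proof (induction n)
    case 0
    then show ?case using XCB(3)[OF van[OF sD]] X0 by (simp add: add.commute)
  next
    case (Suc n)
    have "lc_zero R \<aa> (int (s - n)) (H (Suc n))"
    proof -
      have "int s + 1 - int (Suc n) = int (s - n)" using Suc.prems s m by linarith
      moreover have "lc_zero R \<aa> (int s + 1 - int (Suc n)) (H (Suc n))"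
        using Suc.prems m by (intro below[rule_format]) simp
      ultimately show ?thesis by (simp only:)
    qed
    then have "lc_zero R \<aa> (int (s - n)) (Z (Suc n))" by (rule BZH(1)[OF Suc.IH[OF Suc_leD[OF
        Suc.prems]]])
    also have "int (s - n) = int (s - Suc n) + 1" using Suc.prems s m by linarith
    finally have "lc_zero R \<aa> (int (s - Suc n) + 1) (Z (Suc n))" .
    moreover have "enat (s - Suc n) < D" by (rule le_less_trans[OF _ sD]) simp
    ultimately show ?case by (intro ZCB(3)[OF van])
  qed
  have "int (s - m) = int p0 + 1" using s m by simp
  then have "lc_zero R \<aa> (int p0) (H (Suc m))" using BZH(3)[OF Zp] Bn[of m] by simp
  then show False using nz m by simp
qed

end

section \<open>The cochain complex of a finite group\<close>

text \<open>\<open>del_face G j\<close> drops the first entry for \<open>j = 0\<close>, drops the last one for \<open>j = length gs\<close> and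
  otherwise multiplies the entries \<open>j - 1\<close> and \<open>j\<close>, so the simplicial identity has a single form.\<close>

fun del_face :: "('g, 's) monoid_scheme \<Rightarrow> nat \<Rightarrow> 'g list \<Rightarrow> 'g list" where
  "del_face G j [] = []"
| "del_face G 0 (g # gs) = gs"
| "del_face G (Suc j) [g] = []"
| "del_face G (Suc 0) (g # h # gs) = (g \<otimes>\<^bsub>G\<^esub> h) # gs"
| "del_face G (Suc (Suc j)) (g # h # gs) = g # del_face G (Suc j) (h # gs)"

lemma length_del_face: "length (del_face G j gs) = length gs - 1"
  by (induction G j gs rule: del_face.induct) auto

lemma del_face_Suc_Suc: "gs \<noteq> [] \<Longrightarrow> del_face G (Suc (Suc j)) (g # gs) = g # del_face G (Suc j) gs"
  by (cases gs) auto

lemma del_face_merge_at: "Suc i < length gs \<Longrightarrow> del_face G (Suc i) gs = merge_at G i gs"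
proof (induction i arbitrary: gs)
  case 0
  then obtain g h r where "gs = g # h # r" by (metis Suc_le_length_iff Suc_leI)
  then show ?case by (simp add: merge_at_def)
next
  case (Suc i)
  then obtain g h r where gs: "gs = g # h # r" by (metis Suc_le_length_iff Suc_leI Suc_lessD)
  then show ?case using Suc by (simp add: merge_at_def)
qed

lemma del_face_butlast: "length gs = Suc n \<Longrightarrow> del_face G (Suc n) gs = butlast gs"
proof (induction n arbitrary: gs)
  case 0
  then obtain g where "gs = [g]" by (metis length_0_conv length_Suc_conv)
  then show ?case by simp
next
  case (Suc n)
  then obtain g h r where gs: "gs = g # h # r" by (metis length_Suc_conv)
  then show ?case using Suc by simp
qed

lemma del_face_closed: "monoid G \<Longrightarrow> set gs \<subseteq> carrier G \<Longrightarrow> set (del_face G j gs) \<subseteq> carrier G"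
  by (induction G j gs rule: del_face.induct) (auto simp: monoid.m_closed)

text \<open>Recursion on the list brings the smaller face to the first two entries. There the faces
  commute by computation, except that two adjacent products meet at \<open>i = 1\<close>,
  \<open>j = 2\<close>, where associativity enters.\<close>

lemma (in monoid) del_face_del_face:
  "set gs \<subseteq> carrier G \<Longrightarrow> i < j \<Longrightarrow> j \<le> length gs \<Longrightarrow>
    del_face G i (del_face G j gs) = del_face G (j - 1) (del_face G i gs)"
proof (induction gs arbitrary: i j)
  case (Cons g gs)
  show ?case
  proof (cases gs)
    case Nil
    then show ?thesis using Cons by (cases j; cases i) auto
  next
    case gs: (Cons h r)
    obtain j' where j: "j = Suc j'" using Cons.prems by (cases j) auto
    show ?thesis
    proof (cases i)
      case 0
      then show ?thesis using j gs by (cases j') auto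
    next
      case (Suc i')
      then obtain k where k: "j = Suc (Suc k)" using Cons.prems j by (cases j') auto
      show ?thesis
      proof (cases i')
        case 0
        show ?thesis
        proof (cases r)
          case Nil
          then show ?thesis using 0 Suc k gs Cons.prems by (cases k) auto
        next
          case (Cons l r')
          then show ?thesis using 0 Suc k gs Cons.prems by (cases k) (auto simp: m_assoc)
        qed
      next
        case (Suc i'')
        obtain k' where k': "k = Suc k'" using k Suc \<open>i = Suc i'\<close> Cons.prems by (cases k) auto
        have ne: "del_face G (Suc k) gs \<noteq> []" "del_face G (Suc i'') gs \<noteq> []"
          using Cons.prems k k' Suc \<open>i = Suc i'\<close> by (auto simp flip: length_greater_0_conv simp:
              length_del_face)
        have "del_face G i (del_face G j (g # gs)) = g # del_face G (Suc i'') (del_face G (Suc k) gs)"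
          using ne gs k Suc \<open>i = Suc i'\<close> by (simp add: del_face_Suc_Suc)
        also have "del_face G (Suc i'') (del_face G (Suc k) gs) = del_face G k (del_face G (Suc i'') gs)"
          using Cons.IH[of "Suc i''" "Suc k"] Cons.prems k Suc \<open>i = Suc i'\<close> by simp
        also have "g # \<dots> = del_face G (j - 1) (del_face G i (g # gs))"
          using ne gs k k' Suc \<open>i = Suc i'\<close> by (simp add: del_face_Suc_Suc)
        finally show ?thesis .
      qed
    qed
  qed
qed simp

text \<open>An abelian group on the record type that \<open>alternate\<close> expects.\<close>

locale additive_module = abelian_group G for G :: "('a, 'm) module" (structure)
begin

lemma alternate_closed: "x \<in> carrier G \<Longrightarrow> alternate G k x \<in> carrier G"
  by (simp add: alternate_def)

lemma alternate_alternate: "x \<in> carrier G \<Longrightarrow> alternate G k (alternate G l x) = alternate G (k + l) x"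
  by (simp add: alternate_def)

lemma alternate_add:
  "x \<in> carrier G \<Longrightarrow> y \<in> carrier G \<Longrightarrow> alternate G k (x \<oplus> y) = alternate G k x \<oplus> alternate G k y"
  by (simp add: alternate_def minus_add)

text \<open>The entries \<open>(j, i)\<close> and \<open>(i, j - 1)\<close> with
  \<open>i < j\<close> agree and carry opposite signs. In the induction one new row and one new
  column are added, and these cancel each other.\<close>

lemma alternating_double_sum:
  assumes "\<And>i j. F j i \<in> carrier G"
    and "\<And>i j. i < j \<Longrightarrow> j \<le> Suc n \<Longrightarrow> F j i = F i (j - 1)"
  shows "(\<Oplus>j\<in>{..Suc n}. alternate G j (\<Oplus>i\<in>{..n}. alternate G i (F j i))) = \<zero>"
  using assms(2)
proof (induction n)
  case 0
  have "F (Suc 0) 0 = F 0 0" using 0[of 0 "Suc 0"] by simp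
  then show ?case using assms(1) by (simp add: finsum_Suc alternate_def l_neg Pi_def)
next
  case (Suc n)
  note F = assms(1) and alternate_closed[simp]
  have [simp]: "alternate G k (F j i) \<in> carrier G" for k j i using F by (rule alternate_closed)
  have [simp]: "(\<Oplus>i\<in>{..n}. alternate G i (F j i)) \<in> carrier G" for n j by (rule finsum_closed) auto
  have [simp]: "alternate G k (\<Oplus>i\<in>{..n}. alternate G i (F j i)) \<in> carrier G" for k n j by (rule
      alternate_closed) simp
  have IH: "(\<Oplus>j\<in>{..Suc n}. alternate G j (\<Oplus>i\<in>{..n}. alternate G i (F j i))) = \<zero>"
    using Suc.IH Suc.prems by simp
  have alt_sum: "alternate G k (\<Oplus>i\<in>{..m}. alternate G i (F j i)) = (\<Oplus>i\<in>{..m}. alternate G (k + i)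
      (F j i))" for k j m
    by (induction m) (simp_all add: finsum_Suc Pi_def alternate_add alternate_alternate F)
  \<comment> \<open>The signs \<open>j + (n + 1)\<close> and \<open>(n + 2) + j\<close> have
    opposite parity, so the sum vanishes term by term.\<close>
  have last: "(\<Oplus>j\<in>{..m}. alternate G (j + Suc n) (F j (Suc n))) \<oplus> (\<Oplus>i\<in>{..m}. alternate G (Suc (Suc
      n) + i) (F i (Suc n))) = \<zero>" for m
  proof -
    have "alternate G (j + Suc n) (F j (Suc n)) \<oplus> alternate G (Suc (Suc n) + j) (F j (Suc n)) = \<zero>" for j
      using F by (simp add: alternate_def r_neg l_neg)
    then show ?thesis
      by (subst finsum_addf[symmetric]) (auto intro: add.finprod_one_eqI)
  qed
  have "(\<Oplus>j\<in>{..Suc (Suc n)}. alternate G j (\<Oplus>i\<in>{..Suc n}. alternate G i (F j i))) =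
      alternate G (Suc (Suc n)) (\<Oplus>i\<in>{..Suc n}. alternate G i (F (Suc (Suc n)) i)) \<oplus>
      (\<Oplus>j\<in>{..Suc n}. alternate G j (\<Oplus>i\<in>{..Suc n}. alternate G i (F j i)))"
    by (rule finsum_Suc) auto
  also have "(\<Oplus>j\<in>{..Suc n}. alternate G j (\<Oplus>i\<in>{..Suc n}. alternate G i (F j i))) =
      (\<Oplus>j\<in>{..Suc n}. alternate G (j + Suc n) (F j (Suc n)) \<oplus> alternate G j (\<Oplus>i\<in>{..n}. alternate G
          i (F j i)))"
    by (rule finsum_cong') (auto simp: finsum_Suc[of _ n] Pi_def alternate_add alternate_alternate
        alternate_closed F)
  also have "\<dots> = (\<Oplus>j\<in>{..Suc n}. alternate G (j + Suc n) (F j (Suc n))) \<oplus> \<zero>"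
    unfolding IH[symmetric] by (rule finsum_addf) auto
  also have "\<dots> = (\<Oplus>j\<in>{..Suc n}. alternate G (j + Suc n) (F j (Suc n)))"
    by (rule r_zero) (rule finsum_closed, auto)
  \<comment> \<open>The symmetry hypothesis with \<open>j = n + 2\<close> rewrites the new row as
    the new column.\<close>
  also have "alternate G (Suc (Suc n)) (\<Oplus>i\<in>{..Suc n}. alternate G i (F (Suc (Suc n)) i)) =
      (\<Oplus>i\<in>{..Suc n}. alternate G (Suc (Suc n) + i) (F i (Suc n)))"
    unfolding alt_sum using Suc.prems by (intro finsum_cong') auto
  finally show ?case using last[of "Suc n"] by (subst (asm) a_comm) (auto intro!: finsum_closed)
qed

end

text \<open>In the convolution only the summand at \<open>y = g\<close> survives. Through this
  formula all facts about the action come from the module axioms of the group ring.\<close>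

lemma group_ring_monom_mult:
  assumes A: "cring A" and G: "group G" "finite (carrier G)"
    and a: "a \<in> carrier A" "b \<in> carrier A" and g: "g \<in> carrier G" "h \<in> carrier G"
  shows "group_ring_monom A G a g \<otimes>\<^bsub>group_ring A G\<^esub> group_ring_monom A G b h =
    group_ring_monom A G (a \<otimes>\<^bsub>A\<^esub> b) (g \<otimes>\<^bsub>G\<^esub> h)"
proof -
  interpret A: cring A by (rule A)
  interpret G: group G by (rule G)
  have "(\<Oplus>\<^bsub>A\<^esub>y\<in>carrier G. group_ring_monom A G a g y \<otimes>\<^bsub>A\<^esub> group_ring_monom A G b h (inv\<^bsub>G\<^esub> y \<otimes>\<^bsub>G\<^esub> x)) =
      (if x = g \<otimes>\<^bsub>G\<^esub> h then a \<otimes>\<^bsub>A\<^esub> b else \<zero>\<^bsub>A\<^esub>)" if x: "x \<in> carrier G" for x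
  proof -
    let ?v = "if x = g \<otimes>\<^bsub>G\<^esub> h then a \<otimes>\<^bsub>A\<^esub> b else \<zero>\<^bsub>A\<^esub>"
    have iff: "inv\<^bsub>G\<^esub> g \<otimes>\<^bsub>G\<^esub> x = h \<longleftrightarrow> x = g \<otimes>\<^bsub>G\<^esub> h" using x g by (metis G.inv_solve_left')
    have "(\<Oplus>\<^bsub>A\<^esub>y\<in>carrier G. group_ring_monom A G a g y \<otimes>\<^bsub>A\<^esub> group_ring_monom A G b h (inv\<^bsub>G\<^esub> y \<otimes>\<^bsub>G\<^esub> x)) =
        (\<Oplus>\<^bsub>A\<^esub>y\<in>carrier G. if g = y then ?v else \<zero>\<^bsub>A\<^esub>)"
      using x g a iff by (intro A.finsum_cong') (auto simp: group_ring_monom_def)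
    also have "\<dots> = ?v" using g a G(2) by (intro A.finsum_singleton) auto
    finally show ?thesis .
  qed
  then show ?thesis
    by (auto simp: group_ring_def group_ring_monom_def[of _ _ "a \<otimes>\<^bsub>A\<^esub> b"] intro!: restrict_ext)
qed

section \<open>The base module, the group action and the coboundary\<close>

locale group_ring_module =
  fixes A :: "('a, 'r) ring_scheme" and G :: "('g, 's) monoid_scheme" and M :: "('g \<Rightarrow> 'a, 'm) module"
  assumes A: "cring A" and G: "group G" and finG: "finite (carrier G)" and M: "left_module
      (group_ring A G) M"
begin

sublocale A: cring A by (rule A)
sublocale G: group G by (rule G)
sublocale M: additive_module M using M by (simp add: left_module_def additive_module_def)

abbreviation act :: "'g \<Rightarrow> 'm \<Rightarrow> 'm" where "act \<equiv> group_act A G M"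

abbreviation M\<^sub>A :: "('a, 'm) module" where "M\<^sub>A \<equiv> base_module A G M"

lemma monom_closed: "a \<in> carrier A \<Longrightarrow> group_ring_monom A G a g \<in> carrier (group_ring A G)"
  by (auto simp: group_ring_def group_ring_monom_def)

lemma monom_one: "group_ring_monom A G \<one>\<^bsub>A\<^esub> \<one>\<^bsub>G\<^esub> = \<one>\<^bsub>group_ring A G\<^esub>"
  by (simp add: group_ring_def group_ring_monom_def)

lemma monom_add: "a \<in> carrier A \<Longrightarrow> b \<in> carrier A \<Longrightarrow>
    group_ring_monom A G (a \<oplus>\<^bsub>A\<^esub> b) g = group_ring_monom A G a g \<oplus>\<^bsub>group_ring A G\<^esub> group_ring_monom A G b g"
  by (auto simp: group_ring_def group_ring_monom_def intro!: restrict_ext)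

lemmas monom_mult = group_ring_monom_mult[OF A G finG]

lemma base_simps:
  "carrier M\<^sub>A = carrier M" "\<zero>\<^bsub>M\<^sub>A\<^esub> = \<zero>\<^bsub>M\<^esub>" "x \<oplus>\<^bsub>M\<^sub>A\<^esub> y = x \<oplus>\<^bsub>M\<^esub> y"
  "a \<odot>\<^bsub>M\<^sub>A\<^esub> x = group_ring_monom A G a \<one>\<^bsub>G\<^esub> \<odot>\<^bsub>M\<^esub> x" "a_inv M\<^sub>A = a_inv M"
  by (simp_all add: base_module_def a_inv_def m_inv_def fun_eq_iff)

lemma finsum_base: "finsum M\<^sub>A f S = finsum M f S"
  by (simp add: finsum_def finprod_def base_module_def)

lemma base_module_module: "module A M\<^sub>A"
proof (rule moduleI)
  show "abelian_group M\<^sub>A"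
    by (rule abelian_groupI) (auto simp: base_simps M.a_ac intro: M.l_neg)
qed (auto simp: A base_simps monom_closed monom_add monom_one left_module.smult_closed[OF M]
    left_module.smult_l_distr[OF M] left_module.smult_r_distr[OF M] left_module.smult_one[OF M]
    left_module.smult_assoc[OF M, symmetric] monom_mult)

lemma act_closed: "x \<in> carrier M \<Longrightarrow> act g x \<in> carrier M"
  by (simp add: group_act_def monom_closed left_module.smult_closed[OF M])

lemma act_add: "x \<in> carrier M \<Longrightarrow> y \<in> carrier M \<Longrightarrow> act g (x \<oplus>\<^bsub>M\<^esub> y) = act g x \<oplus>\<^bsub>M\<^esub> act g y"
  by (simp add: group_act_def monom_closed left_module.smult_r_distr[OF M])

lemma act_act: "x \<in> carrier M \<Longrightarrow> g \<in> carrier G \<Longrightarrow> h \<in> carrier G \<Longrightarrow> act g (act h x) = act (g \<otimes>\<^bsub>G\<^esub> h) x"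
  by (simp add: group_act_def monom_closed left_module.smult_assoc[OF M, symmetric] monom_mult)

lemma act_one: "x \<in> carrier M \<Longrightarrow> act \<one>\<^bsub>G\<^esub> x = x"
  by (simp add: group_act_def monom_one left_module.smult_one[OF M])

text \<open>The monomials of \<open>g\<close> and of the scalar \<open>a\<close> commute, their
  product being the monomial of \<open>a\<close> at \<open>g\<close> in either order; hence
  \<open>G\<close> acts linearly over \<open>A\<close>.\<close>

lemma act_smult: "x \<in> carrier M \<Longrightarrow> g \<in> carrier G \<Longrightarrow> a \<in> carrier A \<Longrightarrow>
    act g (a \<odot>\<^bsub>M\<^sub>A\<^esub> x) = a \<odot>\<^bsub>M\<^sub>A\<^esub> act g x"
  by (simp add: group_act_def base_simps monom_closed left_module.smult_assoc[OF M, symmetric]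
      monom_mult)

lemma act_hom: "g \<in> carrier G \<Longrightarrow> act g \<in> module_hom A M\<^sub>A M\<^sub>A"
  by (rule module_homI) (simp_all add: base_simps act_closed act_add act_smult[unfolded base_simps])

lemma cochains_eq: "cochains A G M n = fun_module (tuples G n) M\<^sub>A"
  by (simp add: cochains_def fun_module_def base_simps)

lemma finite_tuples: "finite (tuples G n)"
  unfolding tuples_def using finite_lists_length_eq[OF finG] by simp

text \<open>Only the zeroth face involves the group action. With the factor \<open>coef\<close> all
  terms of the coboundary get one shape, to which the cancellation of alternating double sums
  applies.\<close>

definition coef :: "nat \<Rightarrow> 'g list \<Rightarrow> 'g" where
  "coef j gs = (if j = 0 then hd gs else \<one>\<^bsub>G\<^esub>)"

definition face :: "nat \<Rightarrow> ('g list \<Rightarrow> 'm) \<Rightarrow> 'g list \<Rightarrow> 'm" where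
  "face j \<phi> gs = act (coef j gs) (\<phi> (del_face G j gs))"

lemma coef_closed: "gs \<in> tuples G (Suc n) \<Longrightarrow> coef j gs \<in> carrier G"
  by (cases gs) (auto simp: coef_def tuples_def)

lemma del_face_tuples: "gs \<in> tuples G (Suc n) \<Longrightarrow> del_face G j gs \<in> tuples G n"
  using del_face_closed[OF G.is_monoid] by (auto simp: tuples_def length_del_face)

lemma face_closed: "\<phi> \<in> tuples G n \<rightarrow> carrier M \<Longrightarrow> gs \<in> tuples G (Suc n) \<Longrightarrow> face j \<phi> gs \<in> carrier M"
  unfolding face_def using del_face_tuples by (blast intro: act_closed)

text \<open>The case beyond the unit laws is \<open>i = 0\<close>, \<open>j = 1\<close>, where both
  sides are the product of the first two entries.\<close>

lemma coef_coef:
  assumes gs: "gs \<in> tuples G (Suc (Suc n))" and ij: "i < j" "j \<le> Suc (Suc n)"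
  shows "coef j gs \<otimes>\<^bsub>G\<^esub> coef i (del_face G j gs) = coef i gs \<otimes>\<^bsub>G\<^esub> coef (j - 1) (del_face G i gs)"
proof -
  obtain g h r where g: "gs = g # h # r" "g \<in> carrier G" "h \<in> carrier G"
    using gs by (auto simp: tuples_def length_Suc_conv)
  obtain k where "j = Suc k" using ij by (cases j) auto
  then show ?thesis using g ij by (cases k; cases i) (auto simp: coef_def)
qed

lemma face_face:
  assumes \<phi>: "\<phi> \<in> tuples G n \<rightarrow> carrier M" and gs: "gs \<in> tuples G (Suc (Suc n))"
    and ij: "i < j" "j \<le> Suc (Suc n)"
  shows "face j (face i \<phi>) gs = face i (face (j - 1) \<phi>) gs"
proof -
  have eq: "del_face G i (del_face G j gs) = del_face G (j - 1) (del_face G i gs)"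
    using gs ij by (intro G.del_face_del_face) (auto simp: tuples_def)
  have c: "\<phi> (del_face G k (del_face G l gs)) \<in> carrier M" for k l
    using \<phi> del_face_tuples[OF del_face_tuples[OF gs]] by blast
  show ?thesis
    unfolding face_def using coef_coef[OF gs ij] eq c
    by (simp add: act_act coef_closed[OF gs] coef_closed[OF del_face_tuples[OF gs]])
qed

text \<open>Merges the action term, the products and the last term of the definition into one sum
  with sign \<open>j\<close>.\<close>

lemma coboundary_faces:
  assumes \<phi>: "\<phi> \<in> tuples G n \<rightarrow> carrier M" and gs: "gs \<in> tuples G (Suc n)"
  shows "coboundary A G M n \<phi> gs = (\<Oplus>\<^bsub>M\<^esub>j\<in>{..Suc n}. alternate M j (face j \<phi> gs))"
proof -
  have len: "length gs = Suc n" and ne: "gs \<noteq> []" using gs by (auto simp: tuples_def)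
  have c: "\<phi> (del_face G j gs) \<in> carrier M" for j using \<phi> del_face_tuples[OF gs] by blast
  have f: "alternate M j (face j \<phi> gs) \<in> carrier M" for j by (rule M.alternate_closed[OF
      face_closed[OF \<phi> gs]])
  have "face 0 \<phi> gs = act (hd gs) (\<phi> (tl gs))" using ne by (cases gs) (auto simp: face_def coef_def)
  moreover have "face (Suc i) \<phi> gs = \<phi> (merge_at G i gs)" if "i < n" for i
    using c[of "Suc i"] that by (simp add: face_def coef_def act_one del_face_merge_at[symmetric] len)
  moreover have "face (Suc n) \<phi> gs = \<phi> (butlast gs)"
    using c[of "Suc n"] by (simp add: face_def coef_def act_one del_face_butlast[OF len, where G =
        G, symmetric])
  moreover have "(\<Oplus>\<^bsub>M\<^esub>j\<in>{..Suc n}. alternate M j (face j \<phi> gs)) =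
      alternate M 0 (face 0 \<phi> gs) \<oplus>\<^bsub>M\<^esub> (\<Oplus>\<^bsub>M\<^esub>i\<in>{..<n}. alternate M (Suc i) (face (Suc i) \<phi> gs))
      \<oplus>\<^bsub>M\<^esub> alternate M (Suc n) (face (Suc n) \<phi> gs)"
  proof -
    let ?f = "\<lambda>j. alternate M j (face j \<phi> gs)"
    have s: "(\<Oplus>\<^bsub>M\<^esub>i\<in>{..<n}. ?f (Suc i)) \<in> carrier M" using f by (intro M.finsum_closed) auto
    have "(\<Oplus>\<^bsub>M\<^esub>j\<in>{..Suc n}. ?f j) = (\<Oplus>\<^bsub>M\<^esub>i\<in>{..n}. ?f (Suc i)) \<oplus>\<^bsub>M\<^esub> ?f 0"
      using f by (intro M.finsum_Suc2) auto
    also have "{..n} = insert n {..<n}" by auto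
    also have "(\<Oplus>\<^bsub>M\<^esub>i\<in>insert n {..<n}. ?f (Suc i)) = ?f (Suc n) \<oplus>\<^bsub>M\<^esub> (\<Oplus>\<^bsub>M\<^esub>i\<in>{..<n}. ?f (Suc i))"
      using f by (intro M.finsum_insert) auto
    finally show ?thesis using f s by (simp add: M.a_ac)
  qed
  moreover have "(\<Oplus>\<^bsub>M\<^esub>i\<in>{..<n}. alternate M (Suc i) (\<phi> (merge_at G i gs))) =
      (\<Oplus>\<^bsub>M\<^esub>i\<in>{..<n}. alternate M (Suc i) (face (Suc i) \<phi> gs))"
    using f calculation(2) by (intro M.finsum_cong') auto
  ultimately show ?thesis using gs by (simp add: coboundary_def alternate_def)
qed

lemma coboundary_closed:
  assumes \<phi>: "\<phi> \<in> tuples G n \<rightarrow> carrier M"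
  shows "coboundary A G M n \<phi> \<in> tuples G (Suc n) \<rightarrow>\<^sub>E carrier M"
proof (rule PiE_I)
  show "coboundary A G M n \<phi> gs \<in> carrier M" if "gs \<in> tuples G (Suc n)" for gs
    unfolding coboundary_faces[OF \<phi> that]
    by (rule M.finsum_closed) (auto intro: M.alternate_closed face_closed[OF \<phi> that])
qed (simp add: coboundary_def)

lemma alternate_hom:
  assumes N: "module A N" shows "alternate N k \<in> module_hom A N N"
proof (cases "even k")
  case True
  then show ?thesis by (auto simp: alternate_def[abs_def] module_hom_def)
next
  case False
  have "(\<lambda>x. x) \<in> module_hom A N N" by (auto simp: module_hom_def)
  from hom_neg[OF N N this] show ?thesis using False by (simp add: alternate_def[abs_def])
qed

lemma alternate_base: "alternate M\<^sub>A = alternate M"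
  by (simp add: fun_eq_iff alternate_def base_simps)

lemma coboundary_hom:
  "coboundary A G M n \<in> module_hom A (cochains A G M n) (cochains A G M (Suc n))"
proof (rule module_homI)
  note alt = alternate_hom[OF base_module_module, unfolded alternate_base]
  interpret MA: module A M\<^sub>A by (rule base_module_module)
  fix \<phi> assume "\<phi> \<in> carrier (cochains A G M n)"
  then have \<phi>: "\<phi> \<in> tuples G n \<rightarrow> carrier M" by (auto simp: cochains_eq fun_module_simps base_simps)
  show "coboundary A G M n \<phi> \<in> carrier (cochains A G M (Suc n))"
    using coboundary_closed[OF \<phi>] by (simp add: cochains_eq fun_module_simps base_simps)
  show "coboundary A G M n (a \<odot>\<^bsub>cochains A G M n\<^esub> \<phi>) = a \<odot>\<^bsub>cochains A G M (Suc n)\<^esub> coboundary A G M n \<phi>"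
    if a: "a \<in> carrier A" for a
  proof (rule extensionalityI[of _ "tuples G (Suc n)"])
    fix gs assume gs: "gs \<in> tuples G (Suc n)"
    let ?\<psi> = "a \<odot>\<^bsub>cochains A G M n\<^esub> \<phi>"
    have \<psi>: "?\<psi> \<in> tuples G n \<rightarrow> carrier M"
      using \<phi> MA.smult_closed[OF a] by (auto simp: cochains_eq fun_module_simps base_simps(1))
    have fc: "face j \<phi> gs \<in> carrier M\<^sub>A" for j using face_closed[OF \<phi> gs] by (simp add: base_simps)
    have f: "face j ?\<psi> gs = a \<odot>\<^bsub>M\<^sub>A\<^esub> face j \<phi> gs" for j
    proof -
      have "\<phi> (del_face G j gs) \<in> carrier M" using del_face_tuples[OF gs, of j] \<phi> by blast
      then show ?thesis using del_face_tuples[OF gs, of j] a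
        by (simp add: face_def cochains_eq fun_module_simps act_smult coef_closed[OF gs])
    qed
    \<comment> \<open>The sum is read in the base module, where scalars from \<open>A\<close> can be
      taken out.\<close>
    have "coboundary A G M n ?\<psi> gs = (\<Oplus>\<^bsub>M\<^sub>A\<^esub>j\<in>{..Suc n}. a \<odot>\<^bsub>M\<^sub>A\<^esub> alternate M j (face j \<phi> gs))"
      unfolding coboundary_faces[OF \<psi> gs] f
      using hom_smult[OF alt a fc] by (simp add: finsum_base)
    also have "\<dots> = a \<odot>\<^bsub>M\<^sub>A\<^esub> (\<Oplus>\<^bsub>M\<^sub>A\<^esub>j\<in>{..Suc n}. alternate M j (face j \<phi> gs))"
      using a hom_closed[OF alt fc] by (intro MA.finsum_smult_ldistr[symmetric]) auto
    also have "(\<Oplus>\<^bsub>M\<^sub>A\<^esub>j\<in>{..Suc n}. alternate M j (face j \<phi> gs)) = coboundary A G M n \<phi> gs"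
      unfolding coboundary_faces[OF \<phi> gs] finsum_base ..
    finally show "coboundary A G M n ?\<psi> gs = (a \<odot>\<^bsub>cochains A G M (Suc n)\<^esub> coboundary A G M n \<phi>) gs"
      using gs by (simp add: cochains_eq[of "Suc n"] fun_module_simps)
  qed (auto simp: coboundary_def cochains_eq fun_module_simps)
  fix \<psi> assume "\<psi> \<in> carrier (cochains A G M n)"
  then have \<psi>: "\<psi> \<in> tuples G n \<rightarrow> carrier M" by (auto simp: cochains_eq fun_module_simps base_simps)
  show "coboundary A G M n (\<phi> \<oplus>\<^bsub>cochains A G M n\<^esub> \<psi>) =
    coboundary A G M n \<phi> \<oplus>\<^bsub>cochains A G M (Suc n)\<^esub> coboundary A G M n \<psi>"
  proof (rule extensionalityI[of _ "tuples G (Suc n)"])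
    fix gs assume gs: "gs \<in> tuples G (Suc n)"
    let ?\<xi> = "\<phi> \<oplus>\<^bsub>cochains A G M n\<^esub> \<psi>"
    have \<xi>: "?\<xi> \<in> tuples G n \<rightarrow> carrier M"
      using \<phi> \<psi> by (auto simp: cochains_eq fun_module_simps base_simps)
    have f: "face j ?\<xi> gs = face j \<phi> gs \<oplus>\<^bsub>M\<^esub> face j \<psi> gs" for j
    proof -
      have "\<phi> (del_face G j gs) \<in> carrier M" "\<psi> (del_face G j gs) \<in> carrier M"
        using del_face_tuples[OF gs, of j] \<phi> \<psi> by auto
      then show ?thesis using del_face_tuples[OF gs, of j]
        by (simp add: face_def cochains_eq fun_module_simps base_simps act_add)
    qed
    have "coboundary A G M n ?\<xi> gs = (\<Oplus>\<^bsub>M\<^esub>j\<in>{..Suc n}. alternate M j (face j \<phi> gs) \<oplus>\<^bsub>M\<^esub> alternate M j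
        (face j \<psi> gs))"
      unfolding coboundary_faces[OF \<xi> gs] f
      by (simp add: M.alternate_add face_closed[OF \<phi> gs] face_closed[OF \<psi> gs])
    also have "\<dots> = coboundary A G M n \<phi> gs \<oplus>\<^bsub>M\<^esub> coboundary A G M n \<psi> gs"
      unfolding coboundary_faces[OF \<phi> gs] coboundary_faces[OF \<psi> gs]
      by (rule M.finsum_addf) (auto intro: M.alternate_closed face_closed[OF \<phi> gs] face_closed[OF \<psi> gs])
    finally show "coboundary A G M n ?\<xi> gs =
        (coboundary A G M n \<phi> \<oplus>\<^bsub>cochains A G M (Suc n)\<^esub> coboundary A G M n \<psi>) gs"
      using gs by (simp add: cochains_eq fun_module_simps base_simps)
  qed (auto simp: coboundary_def cochains_eq fun_module_simps)
qed

lemma face_sum: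
  assumes \<psi>: "\<And>i. \<psi> i (del_face G j gs) \<in> carrier M" and gs: "gs \<in> tuples G (Suc n)"
  shows "act (coef j gs) (\<Oplus>\<^bsub>M\<^esub>i\<in>{..m}. alternate M i (\<psi> i (del_face G j gs))) =
    (\<Oplus>\<^bsub>M\<^esub>i\<in>{..m::nat}. alternate M i (face j (\<psi> i) gs))"
proof -
  have a: "act g (alternate M i x) = alternate M i (act g x)" if "x \<in> carrier M" "g \<in> carrier G"
      for g i x
    using hom_uminus[OF base_module_module base_module_module act_hom[OF that(2)], of x] that
    by (simp add: alternate_def base_simps)
  show ?thesis
    by (induction m) (use \<psi> gs coef_closed[OF gs] in
      \<open>auto simp: M.finsum_Suc face_def a act_add act_closed M.alternate_closed M.finsum_closed Pi_def\<close>)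
qed

lemma coboundary_coboundary:
  assumes "\<phi> \<in> carrier (cochains A G M n)"
  shows "coboundary A G M (Suc n) (coboundary A G M n \<phi>) = \<zero>\<^bsub>cochains A G M (Suc (Suc n))\<^esub>"
proof (rule extensionalityI[of _ "tuples G (Suc (Suc n))"])
  have \<phi>: "\<phi> \<in> tuples G n \<rightarrow> carrier M" using assms by (auto simp: cochains_eq fun_module_simps
      base_simps)
  have d: "coboundary A G M n \<phi> \<in> tuples G (Suc n) \<rightarrow> carrier M" using coboundary_closed[OF \<phi>] by
      (auto simp: PiE_def)
  fix gs assume gs: "gs \<in> tuples G (Suc (Suc n))"
  \<comment> \<open>For \<open>i < j\<close> the simplicial identity gives
    \<open>F j i = F i (j - 1)\<close>, the symmetry that makes the double sum cancel.\<close>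
  define F where "F j i = face j (face i \<phi>) gs" for j i
  have Fc: "F j i \<in> carrier M" for j i unfolding F_def using face_closed[OF \<phi>] by (intro
      face_closed[OF _ gs]) auto
  have "face j (coboundary A G M n \<phi>) gs = (\<Oplus>\<^bsub>M\<^esub>i\<in>{..Suc n}. alternate M i (F j i))" for j
  proof -
    note gj = del_face_tuples[OF gs, of j]
    have "act (coef j gs) (\<Oplus>\<^bsub>M\<^esub>i\<in>{..Suc n}. alternate M i (face i \<phi> (del_face G j gs))) =
        (\<Oplus>\<^bsub>M\<^esub>i\<in>{..Suc n}. alternate M i (face j (face i \<phi>) gs))"
      by (rule face_sum[where \<psi> = "\<lambda>i. face i \<phi>", OF face_closed[OF \<phi> gj] gs])
    then show ?thesis by (simp only: F_def face_def[of j "coboundary A G M n \<phi>"]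
        coboundary_faces[OF \<phi> gj])
  qed
  then have "coboundary A G M (Suc n) (coboundary A G M n \<phi>) gs =
      (\<Oplus>\<^bsub>M\<^esub>j\<in>{..Suc (Suc n)}. alternate M j (\<Oplus>\<^bsub>M\<^esub>i\<in>{..Suc n}. alternate M i (F j i)))"
    using coboundary_faces[OF d gs] by simp
  also have "\<dots> = \<zero>\<^bsub>M\<^esub>"
    by (rule M.alternating_double_sum) (auto simp: Fc, auto simp: F_def face_face[OF \<phi> gs])
  finally show "coboundary A G M (Suc n) (coboundary A G M n \<phi>) gs = \<zero>\<^bsub>cochains A G M (Suc (Suc n))\<^esub> gs"
    using gs by (simp add: cochains_eq fun_module_simps base_simps)
qed (auto simp: coboundary_def cochains_eq fun_module_simps)

section \<open>Invariants as the kernel of the first coboundary\<close>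

lemma tuples_0: "tuples G 0 = {[]}"
  by (auto simp: tuples_def)

lemma invariants_submodule:
  "submodule {x \<in> carrier M. \<forall>g\<in>carrier G. act g x = x} A M\<^sub>A"
proof (rule module.submoduleI[OF base_module_module])
  show "\<ominus>\<^bsub>M\<^sub>A\<^esub> x \<in> {x \<in> carrier M. \<forall>g\<in>carrier G. act g x = x}"
    if "x \<in> {x \<in> carrier M. \<forall>g\<in>carrier G. act g x = x}" for x
    using that hom_uminus[OF base_module_module base_module_module act_hom] by (auto simp: base_simps)
  show "\<zero>\<^bsub>M\<^sub>A\<^esub> \<in> {x \<in> carrier M. \<forall>g\<in>carrier G. act g x = x}"
    using hom_zero[OF base_module_module base_module_module act_hom] by (auto simp: base_simps)
  show "a \<odot>\<^bsub>M\<^sub>A\<^esub> x \<in> {x \<in> carrier M. \<forall>g\<in>carrier G. act g x = x}"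
    if "a \<in> carrier A" "x \<in> {x \<in> carrier M. \<forall>g\<in>carrier G. act g x = x}" for a x
    using that module.smult_closed[OF base_module_module, of a x] by (auto simp: act_smult base_simps(1))
qed (auto simp: base_simps act_add)

lemma coboundary_0:
  assumes "\<phi> \<in> carrier (cochains A G M 0)" "g \<in> carrier G"
  shows "coboundary A G M 0 \<phi> [g] = act g (\<phi> []) \<ominus>\<^bsub>M\<^esub> \<phi> []"
proof -
  have "\<phi> [] \<in> carrier M" "[g] \<in> tuples G (Suc 0)"
    using assms by (auto simp: tuples_def cochains_eq fun_module_simps base_simps)
  then show ?thesis by (simp add: coboundary_def alternate_def a_minus_def act_closed)
qed

text \<open>A cochain of degree 0 is its value at \<open>[]\<close>, and \<open>coboundary_0\<close>
  makes it a cocycle exactly when this value is fixed by \<open>G\<close>. So the constant functions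
  embed the invariants as the kernel of the first coboundary.\<close>

lemma acyclic_complex_cochains:
  assumes a: "ideal \<aa> A"
  shows "acyclic_complex A \<aa> (invariants A G M) (cochains A G M) (coboundary A G M)
    (\<lambda>x. \<lambda>gs\<in>tuples G 0. x) (depth A \<aa> M\<^sub>A)"
proof (rule acyclic_complex.intro)
  have inv: "carrier (invariants A G M) = {x \<in> carrier M. \<forall>g\<in>carrier G. act g x = x}"
    "\<zero>\<^bsub>invariants A G M\<^esub> = \<zero>\<^bsub>M\<^esub>" "x \<oplus>\<^bsub>invariants A G M\<^esub> y = x \<oplus>\<^bsub>M\<^esub> y" "b \<odot>\<^bsub>invariants A G M\<^esub> x = b \<odot>\<^bsub>M\<^sub>A\<^esub> x" for x y b
    by (auto simp: invariants_def base_simps)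
  show "module A (invariants A G M)"
    unfolding invariants_def by (rule submodule_module[OF base_module_module invariants_submodule])
  show "module A (cochains A G M n)" for n
    unfolding cochains_eq by (rule fun_module_module[OF base_module_module])
  show "lc_zero A \<aa> (int i) (cochains A G M n)" if "enat i < depth A \<aa> M\<^sub>A" for i n
    unfolding cochains_eq
    by (rule lc_zero_fun_module[OF base_module_module a finite_tuples _ that]) (meson depth_ge_iff
        order_refl)
  let ?e = "\<lambda>x. \<lambda>gs\<in>tuples G 0. x"
  show "?e \<in> module_hom A (invariants A G M) (cochains A G M 0)"
    by (rule module_homI) (auto simp: inv cochains_eq fun_module_simps tuples_0 base_simps(1,3)
        intro!: restrict_ext)
  show "x = \<zero>\<^bsub>invariants A G M\<^esub>" if "?e x = \<zero>\<^bsub>cochains A G M 0\<^esub>" for x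
    using fun_cong[OF that, of "[]"] by (simp add: tuples_0 cochains_eq fun_module_simps base_simps inv)
  have tuples_1: "\<exists>g\<in>carrier G. gs = [g]" if "gs \<in> tuples G (Suc 0)" for gs
    using that by (auto simp: tuples_def length_Suc_conv)
  show "coboundary A G M 0 (?e x) = \<zero>\<^bsub>cochains A G M (Suc 0)\<^esub>" if x: "x \<in> carrier (invariants A G M)" for x
  proof (rule extensionalityI[of _ "tuples G (Suc 0)"])
    have e: "?e x \<in> carrier (cochains A G M 0)" using x by (auto simp: inv cochains_eq
        fun_module_simps base_simps)
    fix gs assume gs: "gs \<in> tuples G (Suc 0)"
    then obtain g where g: "g \<in> carrier G" "gs = [g]" using tuples_1 by blast
    have "coboundary A G M 0 (?e x) gs = act g x \<ominus>\<^bsub>M\<^esub> x" using coboundary_0[OF e g(1)] g(2) by (simp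
        add: tuples_0)
    also have "\<dots> = \<zero>\<^bsub>M\<^esub>" using x g M.diff_eq_zero_iff[of x x] by (simp add: inv)
    finally show "coboundary A G M 0 (?e x) gs = \<zero>\<^bsub>cochains A G M (Suc 0)\<^esub> gs"
      using gs by (simp add: cochains_eq fun_module_simps base_simps)
  qed (auto simp: coboundary_def cochains_eq fun_module_simps)
  show "\<exists>x\<in>carrier (invariants A G M). \<phi> = ?e x"
    if \<phi>: "\<phi> \<in> carrier (cochains A G M 0)" "coboundary A G M 0 \<phi> = \<zero>\<^bsub>cochains A G M (Suc 0)\<^esub>" for \<phi>
  proof
    have c: "\<phi> [] \<in> carrier M" using \<phi>(1) by (auto simp: cochains_eq fun_module_simps tuples_0
        base_simps)
    have "act g (\<phi> []) = \<phi> []" if g: "g \<in> carrier G" for g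
    proof -
      have "[g] \<in> tuples G (Suc 0)" using g by (simp add: tuples_def)
      then have "act g (\<phi> []) \<ominus>\<^bsub>M\<^esub> \<phi> [] = \<zero>\<^bsub>M\<^esub>"
        using coboundary_0[OF \<phi>(1) g] fun_cong[OF \<phi>(2), of "[g]"] by (simp add: cochains_eq
            fun_module_simps base_simps)
      then show ?thesis using M.diff_eq_zero_iff[of "act g (\<phi> [])" "\<phi> []"] c by (simp add: act_closed)
    qed
    then show "\<phi> [] \<in> carrier (invariants A G M)" using c by (simp add: inv)
    show "\<phi> = ?e (\<phi> [])"
    proof
      show "\<phi> gs = ?e (\<phi> []) gs" for gs
        using \<phi>(1) by (cases "gs = []") (simp_all add: cochains_eq fun_module_simps tuples_0
            PiE_def extensional_def)
    qed
  qed
qed (auto simp: a coboundary_hom coboundary_coboundary)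

end

theorem lemma2p1:
  fixes A :: "('a, 'r) ring_scheme" and \<aa> :: "'a set"
    and G :: "('g, 's) monoid_scheme" and M :: "('g \<Rightarrow> 'a, 'm) module"
  assumes "cring A" and "noetherian_ring A" and "ideal \<aa> A"
    and "group G" and "finite (carrier G)"
    and "left_module (group_ring A G) M" and "fin_gen_module (group_ring A G) M"
  shows
    "depth A \<aa> (invariants A G M) \<ge>
        min (depth A \<aa> (base_module A G M)) (cohomological_height A \<aa> G M + 1) \<and>
     (\<forall>(p0::nat) (q0::nat) (s::nat).
        q0 > 0 \<longrightarrow> s = p0 + q0 \<longrightarrow>
        \<not> zero_module (local_cohomology A \<aa> (int p0) (group_cohomology A G M q0)) \<longrightarrow>
        enat s < depth A \<aa> (base_module A G M) \<longrightarrow>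
        (\<forall>l\<in>{1..q0 - 1}. zero_module
            (local_cohomology A \<aa> (int s + 1 - int l) (group_cohomology A G M l))) \<longrightarrow>
        (\<forall>l>q0. zero_module
            (local_cohomology A \<aa> (int s - 1 - int l) (group_cohomology A G M l))) \<longrightarrow>
        depth A \<aa> (invariants A G M) \<le> enat (s + 1))"
proof -
  interpret group_ring_module A G M
    using assms(1,4,5,6) by (rule group_ring_module.intro)
  interpret acyclic_complex A \<aa> "invariants A G M" "cochains A G M" "coboundary A G M"
    "\<lambda>x. \<lambda>gs\<in>tuples G 0. x" "depth A \<aa> (base_module A G M)"
    using assms(3) by (rule acyclic_complex_cochains)
  show ?thesis
    unfolding group_cohomology_def cohomological_height_def
    by (intro conjI allI impI) (rule depth_lower_bound, rule depth_upper_bound)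
qed

end
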